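(* The almost complex structure $\mathbb{J}$ on $\mathbb{U}\subset\mathbb{L}(\mathbb{H}^3)$ (given by rotation of orthogonal Jacobi fields through $90^\circ$ about the oriented geodesic) extends to the whole of the space $\mathbb{L}(\mathbb{H}^3)$ of oriented geodesics of hyperbolic 3-space, and it is integrable. Moreover, the complex surface $(\mathbb{L}(\mathbb{H}^3),\mathbb{J})$ is biholomorphic to $\mathbb{P}^1\times\mathbb{P}^1-\overline{\Delta}$, where $\overline{\Delta}=\{(\mu_1,\mu_2)\in\mathbb{P}^1\times\mathbb{P}^1 \mid \mu_1=\iota(\mu_2)\}$ is the reflected diagonal and $\iota:\mathbb{P}^1=S^2\to S^2$ is the antipodal map ($\iota(\mu)=-1/\bar\mu$ in an affine stereographic coordinate).
   Context: Hyperbolic 3-space $\mathbb{H}^3$ is the upper half-space $\{(x^0,x^1,x^2)\in\mathbb{R}^3: x^0>0\}$ with metric $g=((dx^0)^2+(dx^1)^2+(dx^2)^2)/(x^0)^2$; put $t=x^0$, $z=x^1+ix^2$; orient it by $dx^0\wedge dx^1\wedge dx^2$. $\mathbb{L}(\mathbb{H}^3)$ is the smooth 4-manifold of oriented geodesics of $\mathbb{H}^3$ (the quotient of the unit tangent bundle by the geodesic flow; equivalently, ordered pairs of distinct points of the sphere at infinity). $\mathbb{U}\subset\mathbb{L}(\mathbb{H}^3)$ is the open set of oriented geodesics not parallel to the $x^0$-axis in the upper half-space model. It has global coordinates $(\xi,\eta)\in(\mathbb{C}-\{0\})\times\mathbb{C}$: the oriented geodesic $(\xi,\eta)$ is parameterised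 by arc length $r\in\mathbb{R}$ as $$t=\frac{1}{|\xi|\cosh r},\qquad z=\eta+\frac{\tanh r}{\bar\xi}.$$ $\Phi:\mathbb{U}\times\mathbb{R}\to\mathbb{H}^3$ is the map $(\xi,\eta,r)\mapsto(t,z)$ so defined. For an oriented geodesic $\gamma$, $\mathcal{J}^\perp(\gamma)$ is the 4-dimensional real vector space of Jacobi fields along $\gamma$ orthogonal to $\gamma$, and $Pr_\gamma$ is orthogonal projection onto the plane orthogonal to $\dot\gamma$. For $\gamma\in\mathbb{U}$, $h=Pr_\gamma\circ D\Phi$ sends $\mathbb{X}\in T_\gamma\mathbb{U}$ to the vector field $r\mapsto Pr_\gamma(D\Phi_{(\gamma,r)}(\mathbb{X}))$ along $\gamma$; it is an isomorphism $T_\gamma\mathbb{U}\to\mathcal{J}^\perp(\gamma)$. $\mathcal{R}_\gamma$ is rotation through $+90^\circ$ about $\dot\gamma$ (so $(\dot\gamma,v,\mathcal{R}_\gamma v)$ is positively oriented for unit $v\perp\dot\gamma$); it maps $\mathcal{J}^\perp(\gamma)$ to itself. The almost complex structure on $\mathbb{U}$ is $\mathbb{J}=h^{-1}\circ\mathcal{R}_\gamma\circ h$. *)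

theory Defs
  imports "HOL-Analysis.Analysis"
begin

section \<open>Smooth maps\<close>

primrec Ck_on :: "nat \<Rightarrow> ('a::real_normed_vector \<Rightarrow> 'b::real_normed_vector) \<Rightarrow> 'a set \<Rightarrow> bool"
where
  "Ck_on 0 f S \<longleftrightarrow> continuous_on S f"
| "Ck_on (Suc k) f S \<longleftrightarrow> (\<forall>x\<in>S. f differentiable (at x)) \<and>
     (\<forall>v. Ck_on k (\<lambda>x. frechet_derivative f (at x) v) S)"

text \<open>On an arbitrary subset \<open>S\<close>, smooth means locally the restriction of a smooth map on an open
  set; for open \<open>S\<close> this is the usual notion, for an embedded submanifold the intrinsic one.\<close>

definition smooth_on :: "'a::real_normed_vector set \<Rightarrow> ('a \<Rightarrow> 'b::real_normed_vector) \<Rightarrow> bool" where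
  "smooth_on S f \<longleftrightarrow>
     (\<forall>x\<in>S. \<exists>N g. open N \<and> x \<in> N \<and> (\<forall>k. Ck_on k g N) \<and> (\<forall>y\<in>S \<inter> N. g y = f y))"


section \<open>Charts, almost complex structures, complex surfaces\<close>

text \<open>A chart \<open>(W, \<phi>)\<close> with values in \<open>\<complex>\<^sup>2 = \<real>\<^sup>4\<close>; the values of \<open>\<phi>\<close> outside
  \<open>W\<close> are irrelevant.\<close>

type_synonym 'a chart = "'a set \<times> ('a \<Rightarrow> complex \<times> complex)"

definition chart_inv :: "'a chart \<Rightarrow> complex \<times> complex \<Rightarrow> 'a" where
  "chart_inv c = inv_into (fst c) (snd c)"

definition mult_ii :: "complex \<times> complex \<Rightarrow> complex \<times> complex" where
  "mult_ii v = (\<i> * fst v, \<i> * snd v)"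

text \<open>An almost complex structure, as a smooth (1,1)-tensor field with square \<open>-1\<close>, given by its
  components in all charts of the (maximal) atlas \<open>A\<close>: \<open>J c p\<close> is the endomorphism of the
  tangent space at \<open>p\<close> expressed in the chart \<open>c\<close>. The last clause is the transformation law.\<close>

definition almost_complex_structure ::
    "'a chart set \<Rightarrow> ('a chart \<Rightarrow> 'a \<Rightarrow> complex \<times> complex \<Rightarrow> complex \<times> complex) \<Rightarrow> bool" where
  "almost_complex_structure A J \<longleftrightarrow>
     (\<forall>c\<in>A. \<forall>p\<in>fst c. linear (J c p) \<and> (\<forall>v. J c p (J c p v) = - v)) \<and>
     (\<forall>c\<in>A. \<forall>v. smooth_on (snd c ` fst c) (\<lambda>y. J c (chart_inv c y) v)) \<and>
     (\<forall>c\<in>A. \<forall>d\<in>A. \<forall>p\<in>fst c \<inter> fst d. \<forall>v.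
        frechet_derivative (snd d \<circ> chart_inv c) (at (snd c p)) (J c p v) =
        J d p (frechet_derivative (snd d \<circ> chart_inv c) (at (snd c p)) v))"

text \<open>The charts of \<open>A\<close> that are holomorphic coordinates for \<open>J\<close>.\<close>

definition holomorphic_charts ::
    "'a chart set \<Rightarrow> ('a chart \<Rightarrow> 'a \<Rightarrow> complex \<times> complex \<Rightarrow> complex \<times> complex) \<Rightarrow> 'a chart set" where
  "holomorphic_charts A J = {c \<in> A. \<forall>p\<in>fst c. J c p = mult_ii}"

text \<open>Integrability: \<open>J\<close> is induced by a complex structure, i.e. there are local coordinates
  around every point in which \<open>J\<close> is multiplication by the imaginary unit.\<close>

definition integrable_on_manifold ::
    "'a set \<Rightarrow> 'a chart set \<Rightarrow>
      ('a chart \<Rightarrow> 'a \<Rightarrow> complex \<times> complex \<Rightarrow> complex \<times> complex) \<Rightarrow> bool" where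
  "integrable_on_manifold M A J \<longleftrightarrow> (\<forall>p\<in>M. \<exists>c\<in>holomorphic_charts A J. p \<in> fst c)"

definition holomorphic2_on ::
    "(complex \<times> complex) set \<Rightarrow> (complex \<times> complex \<Rightarrow> complex \<times> complex) \<Rightarrow> bool" where
  "holomorphic2_on S f \<longleftrightarrow>
     (\<forall>x\<in>S. \<exists>D. (f has_derivative D) (at x) \<and> (\<forall>v. D (mult_ii v) = mult_ii (D v)))"

text \<open>Openness of the coordinate domains makes the map continuous for the topologies induced by
  the two holomorphic atlases.\<close>

definition holomorphic_map :: "'a chart set \<Rightarrow> 'b chart set \<Rightarrow> ('a \<Rightarrow> 'b) \<Rightarrow> bool" where
  "holomorphic_map A B F \<longleftrightarrow>
     (\<forall>c\<in>A. \<forall>d\<in>B.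
        open (snd c ` {p \<in> fst c. F p \<in> fst d}) \<and>
        holomorphic2_on (snd c ` {p \<in> fst c. F p \<in> fst d}) (snd d \<circ> F \<circ> chart_inv c))"

definition biholomorphic ::
    "'a set \<Rightarrow> 'a chart set \<Rightarrow> 'b set \<Rightarrow> 'b chart set \<Rightarrow> bool" where
  "biholomorphic M A N B \<longleftrightarrow>
     (\<exists>F. bij_betw F M N \<and> holomorphic_map A B F \<and> holomorphic_map B A (inv_into M F))"


section \<open>Hyperbolic 3-space\<close>

text \<open>The upper half-space coordinates \<open>(x\<^sup>0, x\<^sup>1, x\<^sup>2)\<close> of a point \<open>p\<close> are
  \<open>(p $ 1, p $ 2, p $ 3)\<close>.\<close>

definition H3 :: "(real^3) set" where
  "H3 = {p. p $ 1 > 0}"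

definition hyp_metric :: "real^3 \<Rightarrow> real^3 \<Rightarrow> real^3 \<Rightarrow> real" where
  "hyp_metric p v w = (v \<bullet> w) / (p $ 1)\<^sup>2"

definition metric_matrix :: "real^3 \<Rightarrow> real^3^3" where
  "metric_matrix p = (\<chi> i j. hyp_metric p (axis i 1) (axis j 1))"

definition metric_partial :: "real^3 \<Rightarrow> 3 \<Rightarrow> 3 \<Rightarrow> 3 \<Rightarrow> real" where
  "metric_partial p i j l = frechet_derivative (\<lambda>q. metric_matrix q $ j $ l) (at p) (axis i 1)"

definition christoffel :: "real^3 \<Rightarrow> 3 \<Rightarrow> 3 \<Rightarrow> 3 \<Rightarrow> real" where
  "christoffel p k i j =
     (\<Sum>l\<in>UNIV. matrix_inv (metric_matrix p) $ k $ l *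
        (metric_partial p i j l + metric_partial p j i l - metric_partial p l i j)) / 2"

definition velocity :: "(real \<Rightarrow> real^3) \<Rightarrow> real \<Rightarrow> real^3" where
  "velocity \<gamma> r = vector_derivative \<gamma> (at r)"

definition unit_geodesic :: "(real \<Rightarrow> real^3) \<Rightarrow> bool" where
  "unit_geodesic \<gamma> \<longleftrightarrow>
     (\<forall>r. \<gamma> r \<in> H3 \<and>
          \<gamma> differentiable (at r) \<and> velocity \<gamma> differentiable (at r) \<and>
          hyp_metric (\<gamma> r) (velocity \<gamma> r) (velocity \<gamma> r) = 1 \<and>
          (\<forall>k. vector_derivative (velocity \<gamma>) (at r) $ k +
             (\<Sum>i\<in>UNIV. \<Sum>j\<in>UNIV. christoffel (\<gamma> r) k i j * velocity \<gamma> r $ i * velocity \<gamma> r $ j) = 0))"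


section \<open>The space of oriented geodesics\<close>

definition unit_tangent_bundle :: "((real^3) \<times> (real^3)) set" where
  "unit_tangent_bundle = {(p, v). p \<in> H3 \<and> hyp_metric p v v = 1}"

definition geodesic_flow_rel :: "(((real^3) \<times> (real^3)) \<times> ((real^3) \<times> (real^3))) set" where
  "geodesic_flow_rel =
     {((\<gamma> r, velocity \<gamma> r), (\<gamma> s, velocity \<gamma> s)) | \<gamma> r s. unit_geodesic \<gamma>}"

type_synonym geodesic = "((real^3) \<times> (real^3)) set"

definition oriented_geodesics :: "geodesic set" where
  "oriented_geodesics = unit_tangent_bundle // geodesic_flow_rel"

definition geodesic_through :: "(real^3) \<times> (real^3) \<Rightarrow> geodesic" where
  "geodesic_through u = geodesic_flow_rel `` {u}"

text \<open>The maximal atlas of the quotient manifold, i.e.\ of the smooth structure for which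
  \<^const>\<open>geodesic_through\<close> is a submersion: a chart is smooth when lifted to the unit tangent
  bundle, and its inverse lifts locally to smooth maps into the unit tangent bundle.\<close>

definition geodesic_atlas :: "geodesic chart set" where
  "geodesic_atlas =
     {(W, \<phi>). W \<subseteq> oriented_geodesics \<and> inj_on \<phi> W \<and> open (\<phi> ` W) \<and>
        openin (top_of_set unit_tangent_bundle) {u \<in> unit_tangent_bundle. geodesic_through u \<in> W} \<and>
        smooth_on {u \<in> unit_tangent_bundle. geodesic_through u \<in> W} (\<phi> \<circ> geodesic_through) \<and>
        (\<forall>y\<in>\<phi> ` W. \<exists>N \<sigma>. open N \<and> y \<in> N \<and> N \<subseteq> \<phi> ` W \<and> smooth_on N \<sigma> \<and>
           (\<forall>y'\<in>N. \<sigma> y' \<in> unit_tangent_bundle \<and>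
              geodesic_through (\<sigma> y') = chart_inv (W, \<phi>) y'))}"


section \<open>The almost complex structure on the non-vertical geodesics\<close>

definition nonvertical_geodesics :: "geodesic set" where
  "nonvertical_geodesics =
     {l \<in> oriented_geodesics. \<not> (\<forall>(p, v)\<in>l. v \<in> span {axis 1 1})}"

definition coord_domain :: "(complex \<times> complex) set" where
  "coord_domain = (- {0}) \<times> UNIV"

definition Phi :: "complex \<times> complex \<Rightarrow> real \<Rightarrow> real^3" where
  "Phi = (\<lambda>(\<xi>, \<eta>) r.
     let t = 1 / (cmod \<xi> * cosh r); z = \<eta> + of_real (tanh r) / cnj \<xi>
     in vector [t, Re z, Im z])"

definition coord_geodesic :: "complex \<times> complex \<Rightarrow> geodesic" where
  "coord_geodesic x = range (\<lambda>r. (Phi x r, velocity (Phi x) r))"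

definition coord_chart :: "geodesic chart" where
  "coord_chart = (nonvertical_geodesics, inv_into coord_domain coord_geodesic)"

definition proj_perp :: "real^3 \<Rightarrow> real^3 \<Rightarrow> real^3 \<Rightarrow> real^3" where
  "proj_perp p u v = v - hyp_metric p v u *\<^sub>R u"

text \<open>Rotation of \<open>v \<bottom> u\<close> through \<open>+90\<close> degrees about the hyperbolic unit vector
  \<open>u\<close> at \<open>p\<close>. The metric is conformal to the Euclidean one, whose unit vector in the direction
  of \<open>u\<close> is \<open>u / x\<^sup>0\<close>; the orientation is the standard one of \<open>\<real>\<^sup>3\<close>.\<close>

definition rot90 :: "real^3 \<Rightarrow> real^3 \<Rightarrow> real^3 \<Rightarrow> real^3" where
  "rot90 p u v = cross3 ((1 / p $ 1) *\<^sub>R u) v"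

text \<open>Tangent vectors to the non-vertical geodesics are written in the coordinates
  \<open>(\<xi>, \<eta>)\<close>, hence are elements of \<open>\<complex>\<^sup>2\<close>. The range of \<open>jacobi_iso x\<close> below is the
  space of orthogonal Jacobi fields along \<open>Phi x\<close>; it is invariant under \<open>rotate_field x\<close>.\<close>

definition jacobi_iso :: "complex \<times> complex \<Rightarrow> complex \<times> complex \<Rightarrow> real \<Rightarrow> real^3" where
  "jacobi_iso x X = (\<lambda>r. proj_perp (Phi x r) (velocity (Phi x) r)
     (frechet_derivative (\<lambda>y. Phi y r) (at x) X))"

definition rotate_field :: "complex \<times> complex \<Rightarrow> (real \<Rightarrow> real^3) \<Rightarrow> real \<Rightarrow> real^3" where
  "rotate_field x V = (\<lambda>r. rot90 (Phi x r) (velocity (Phi x) r) (V r))"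

definition JU :: "complex \<times> complex \<Rightarrow> complex \<times> complex \<Rightarrow> complex \<times> complex" where
  "JU x = the_inv (jacobi_iso x) \<circ> rotate_field x \<circ> jacobi_iso x"

definition extends_JU ::
    "(geodesic chart \<Rightarrow> geodesic \<Rightarrow> complex \<times> complex \<Rightarrow> complex \<times> complex) \<Rightarrow> bool" where
  "extends_JU J \<longleftrightarrow> coord_chart \<in> geodesic_atlas \<and>
     (\<forall>p\<in>nonvertical_geodesics. J coord_chart p = JU (snd coord_chart p))"


section \<open>The complement of the reflected diagonal\<close>

text \<open>The projective line as the unit sphere; its holomorphic atlas consists of the affine
  stereographic coordinate \<open>\<mu>\<close> from the north pole and of \<open>1 / \<mu>\<close>.\<close>

definition P1 :: "(real^3) set" where
  "P1 = sphere 0 1"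

definition north :: "real^3" where
  "north = axis 3 1"

definition mu_north :: "real^3 \<Rightarrow> complex" where
  "mu_north x = Complex (x $ 1) (x $ 2) / of_real (1 - x $ 3)"

definition mu_south :: "real^3 \<Rightarrow> complex" where
  "mu_south x = Complex (x $ 1) (- (x $ 2)) / of_real (1 + x $ 3)"

definition P1_atlas :: "((real^3) set \<times> (real^3 \<Rightarrow> complex)) set" where
  "P1_atlas = {(P1 - {north}, mu_north), (P1 - {- north}, mu_south)}"

definition antipodal :: "real^3 \<Rightarrow> real^3" where
  "antipodal x = - x"

definition reflected_diagonal :: "((real^3) \<times> (real^3)) set" where
  "reflected_diagonal = {(x, y). x \<in> P1 \<and> y \<in> P1 \<and> x = antipodal y}"

definition P1xP1_minus :: "((real^3) \<times> (real^3)) set" where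
  "P1xP1_minus = P1 \<times> P1 - reflected_diagonal"

definition P1xP1_minus_atlas :: "((real^3) \<times> (real^3)) chart set" where
  "P1xP1_minus_atlas =
     {((V \<times> W) \<inter> P1xP1_minus, map_prod f g) | V f W g. (V, f) \<in> P1_atlas \<and> (W, g) \<in> P1_atlas}"

end

theory Submission
  imports Defs
begin

text \<open>
  An oriented geodesic of hyperbolic space is the same as an ordered pair of distinct points of
  the sphere at infinity, its backward and its forward end. The proof shows that the rotation of
  Jacobi fields is multiplication by the imaginary unit in stereographic coordinates of the ends,
  provided that one of the ends is replaced by its antipode. This gives the extension of the
  almost complex structure, its integrability and the biholomorphic map at the same time.

  To see why, move one end of a geodesic and keep the other. The resulting Jacobi field grows
  towards the moving end, and rotating it by 90 degrees about the direction of travel rotates the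
  motion of the end. At the forward end the geodesic leaves the half-space and at the backward end
  it enters it, so in one affine coordinate of the boundary the two rotations have opposite
  senses: with \<open>z\<close> the forward and \<open>w\<close> the backward end, \<open>dz\<close> is multiplied by \<open>- \<i>\<close> and \<open>dw\<close> by
  \<open>\<i>\<close>. As the antipodal map is antiholomorphic, the antipode of the forward end and the backward
  end are holomorphic coordinates, and that the ends are distinct means that this pair avoids the
  reflected diagonal.

  The geometry is done in the hyperboloid model, realised by Hermitian matrices. There the
  geodesic with initial point \<open>X\<close> and velocity \<open>V\<close> is \<open>X cosh r + V sinh r\<close>, and the light-like
  vectors \<open>X + V\<close> and \<open>X - V\<close> span the rays of the two ends. The flow rescales them by \<open>exp r\<close> and
  \<open>exp (- r)\<close>, so the ends are first integrals that determine the orbit (\<open>geodesic_flow_rel_iff\<close>)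
  and identify the quotient with pairs of points (\<open>geodesic_ends_bij\<close>). That every unit speed
  geodesic has this form follows by solving the linear system \<open>X' = V\<close>, \<open>V' = X\<close>. The ends are
  rational functions of the unit tangent vector and have a rational section, which puts the charts
  of the ends into the maximal atlas of the quotient (\<open>end_chart_in_atlas\<close>). Their transitions are
  the holomorphic ones of the sphere (\<open>end_chart_transitions_holomorphic\<close>), so \<open>\<i>\<close> can be
  transported to an almost complex structure on the space of geodesics
  (\<open>almost_complex_structure_from_holomorphic_atlas\<close>).

  It remains to compare this structure with the rotation of Jacobi fields over the non-vertical
  geodesics. The coordinates \<open>(\<xi>, \<eta>)\<close> have the ends \<open>\<eta> \<plusminus> 1 / cnj \<xi>\<close> (\<open>coord_geodesic_ends\<close>), and a
  computation of the derivative of \<^const>\<open>Phi\<close> turns the rotation into an explicit formula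
  (\<open>rotate_jacobi_iso\<close>, \<open>JU_eq\<close>), which the derivative of the transition to the ends intertwines
  with multiplication by \<open>\<i>\<close>.
\<close>

section \<open>Smooth maps\<close>

lemma Ck_on_mono: "Ck_on k f S \<Longrightarrow> T \<subseteq> S \<Longrightarrow> Ck_on k f T"
  by (induction k arbitrary: f) (auto intro: continuous_on_subset)

text \<open>The derivatives in \<^const>\<open>Ck_on\<close> are taken at the points of an open set, so they see only the
  values on that set.\<close>

lemma Ck_on_cong:
  assumes "open S" "\<And>x. x \<in> S \<Longrightarrow> f x = g x" "Ck_on k f S"
  shows "Ck_on k g S"
  using assms(2,3)
proof (induction k arbitrary: f g)
  case 0
  then show ?case using continuous_on_cong by (metis Ck_on.simps(1))
next
  case (Suc k)
  have D: "(g has_derivative frechet_derivative f (at x)) (at x)" if "x \<in> S" for x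
    by (rule has_derivative_transform_within_open[of f, OF _ assms(1) that])
      (use Suc.prems that in \<open>auto simp: frechet_derivative_works\<close>)
  then have "g differentiable (at x)" if "x \<in> S" for x
    using that differentiable_def by blast
  moreover have "Ck_on k (\<lambda>x. frechet_derivative g (at x) v) S" for v
    by (rule Suc.IH[of "\<lambda>x. frechet_derivative f (at x) v"])
      (use Suc.prems(2) in \<open>simp_all add: frechet_derivative_at[OF D, symmetric]\<close>)
  ultimately show ?case by simp
qed

lemma Ck_on_local:
  assumes "open S" "\<And>x. x \<in> S \<Longrightarrow> \<exists>N. open N \<and> x \<in> N \<and> Ck_on k f (S \<inter> N)"
  shows "Ck_on k f S"
  using assms(2)
proof (induction k arbitrary: f)
  case 0
  have "isCont f x" if x: "x \<in> S" for x
  proof -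
    obtain N where "open N" "x \<in> N" "continuous_on (S \<inter> N) f"
      using 0[OF x] by auto
    then show ?thesis
      using assms(1) x by (auto simp: continuous_on_eq_continuous_at open_Int)
  qed
  then show ?case by (simp add: continuous_at_imp_continuous_on)
next
  case (Suc k)
  have "f differentiable (at x)" if "x \<in> S" for x
    using Suc.prems[OF that] that by auto
  moreover have "Ck_on k (\<lambda>x. frechet_derivative f (at x) v) S" for v
  proof (rule Suc.IH)
    show "\<exists>N. open N \<and> x \<in> N \<and> Ck_on k (\<lambda>x. frechet_derivative f (at x) v) (S \<inter> N)"
      if x: "x \<in> S" for x
      using Suc.prems[OF x] unfolding Ck_on.simps(2) by blast
  qed
  ultimately show ?case by simp
qed

lemma Ck_on_continuous: "Ck_on k f S \<Longrightarrow> continuous_on S f"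
  by (cases k) (auto intro!: continuous_at_imp_continuous_on differentiable_imp_continuous_within)

lemma Ck_on_lower: "Ck_on (Suc k) f S \<Longrightarrow> Ck_on k f S"
proof (induction k arbitrary: f)
  case 0
  then show ?case by (simp only: Ck_on.simps(1)) (erule Ck_on_continuous)
next
  case (Suc k)
  have "f differentiable (at x)" if "x \<in> S" for x
    using Suc.prems that by simp
  moreover have "Ck_on k (\<lambda>x. frechet_derivative f (at x) v) S" for v
    using Ck_on.simps(2)[of "Suc k" f S] Suc.prems by (intro Suc.IH) blast
  ultimately show ?case by simp
qed

text \<open>With \<open>frechet_derivative\<close> being a choice operator, this is the rule by which a derivative
  computed by hand enters the recursion of \<^const>\<open>Ck_on\<close>; every closure property below is an induction
  that ends with it.\<close>

lemma Ck_on_SucI: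
  assumes "open S" "\<And>x. x \<in> S \<Longrightarrow> (f has_derivative (\<lambda>v. f' v x)) (at x)"
    "\<And>v. Ck_on k (f' v) S"
  shows "Ck_on (Suc k) f S"
proof -
  have "Ck_on k (\<lambda>x. frechet_derivative f (at x) v) S" for v
    by (rule Ck_on_cong[OF assms(1) _ assms(3)[of v]])
      (simp add: frechet_derivative_at[OF assms(2), symmetric])
  with assms(2) show ?thesis by (auto simp: differentiable_def)
qed

lemma Ck_on_SucD:
  assumes "Ck_on (Suc k) f S" "x \<in> S"
  shows "(f has_derivative frechet_derivative f (at x)) (at x)"
  using assms by (simp add: frechet_derivative_works)

lemma Ck_on_const: "Ck_on k (\<lambda>x. c) S"
  by (induction k arbitrary: c) auto

lemma Ck_on_linear:
  assumes "bounded_linear h" "Ck_on k f S" "open S"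
  shows "Ck_on k (\<lambda>x. h (f x)) S"
  using assms(2)
proof (induction k arbitrary: f)
  case 0
  then show ?case using assms(1) by (auto intro: bounded_linear.continuous_on)
next
  case (Suc k)
  show ?case
    by (rule Ck_on_SucI[OF assms(3) bounded_linear.has_derivative[OF assms(1)
            Ck_on_SucD[OF Suc.prems]]]) (use Suc.prems in \<open>auto intro: Suc.IH\<close>)
qed

lemma Ck_on_id: "open S \<Longrightarrow> Ck_on k (\<lambda>x. x) S"
proof (cases k)
  case (Suc n)
  assume "open S"
  then show ?thesis unfolding Suc
    by (intro Ck_on_SucI[where f' = "\<lambda>v x. v"]) (auto intro: Ck_on_const)
qed auto

lemma Ck_on_add:
  assumes "Ck_on k f S" "Ck_on k g S" "open S"
  shows "Ck_on k (\<lambda>x. f x + g x) S"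
  using assms(1,2)
proof (induction k arbitrary: f g)
  case 0
  then show ?case by (auto intro: continuous_on_add)
next
  case (Suc k)
  show ?case
    by (rule Ck_on_SucI[OF assms(3) has_derivative_add[OF Ck_on_SucD[OF Suc.prems(1)]
            Ck_on_SucD[OF Suc.prems(2)]]]) (use Suc.prems in \<open>auto intro: Suc.IH\<close>)
qed

lemma Ck_on_bilinear:
  assumes "bounded_bilinear h" "Ck_on k f S" "Ck_on k g S" "open S"
  shows "Ck_on k (\<lambda>x. h (f x) (g x)) S"
  using assms(2,3)
proof (induction k arbitrary: f g)
  case 0
  then show ?case using assms(1) by (auto intro: bounded_bilinear.continuous_on)
next
  case (Suc k)
  have "Ck_on k f S" "Ck_on k g S"
    using Suc.prems by (auto simp only: Ck_on_lower)
  then show ?case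
    by (intro Ck_on_SucI[OF assms(4) bounded_bilinear.FDERIV[OF assms(1)
            Ck_on_SucD[OF Suc.prems(1)] Ck_on_SucD[OF Suc.prems(2)]]] Ck_on_add assms(4) Suc.IH)
      (use Suc.prems in auto)
qed

lemma Ck_on_sum:
  assumes "\<And>i. i \<in> I \<Longrightarrow> Ck_on k (f i) S" "open S"
  shows "Ck_on k (\<lambda>x. \<Sum>i\<in>I. f i x) S"
  using assms by (induction I rule: infinite_finite_induct) (auto intro: Ck_on_const Ck_on_add)

lemma Ck_on_inverse:
  fixes f :: "'a::real_normed_vector \<Rightarrow> 'b::real_normed_field"
  assumes "Ck_on k f S" "open S" "\<And>x. x \<in> S \<Longrightarrow> f x \<noteq> 0"
  shows "Ck_on k (\<lambda>x. inverse (f x)) S"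
  using assms(1)
proof (induction k)
  case 0
  then show ?case using assms(3) by (auto intro: continuous_on_inverse)
next
  case (Suc k)
  have I: "Ck_on k (\<lambda>x. inverse (f x)) S"
    using Suc Ck_on_lower by blast
  show ?case
  proof (rule Ck_on_SucI[OF assms(2), where
        f' = "\<lambda>v x. (-1) *\<^sub>R (inverse (f x) * frechet_derivative f (at x) v * inverse (f x))"])
    show "((\<lambda>x. inverse (f x)) has_derivative
        (\<lambda>v. (-1) *\<^sub>R (inverse (f x) * frechet_derivative f (at x) v * inverse (f x)))) (at x)"
      if "x \<in> S" for x
      using Ck_on_SucD[OF Suc.prems that] assms(3)[OF that]
      by (auto intro!: derivative_eq_intros)
    show "Ck_on k (\<lambda>x. (-1) *\<^sub>R (inverse (f x) * frechet_derivative f (at x) v * inverse (f x))) S"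
      for v
      using Suc.prems
      by (intro Ck_on_linear[OF bounded_linear_scaleR_right]
          Ck_on_bilinear[OF bounded_bilinear_mult] I assms(2)) auto
  qed
qed

lemma frechet_derivative_basis:
  fixes g :: "'a::euclidean_space \<Rightarrow> 'b::real_normed_vector"
  assumes "g differentiable (at y)"
  shows "frechet_derivative g (at y) w = (\<Sum>b\<in>Basis. (w \<bullet> b) *\<^sub>R frechet_derivative g (at y) b)"
proof -
  have "linear (frechet_derivative g (at y))"
    using assms by (rule linear_frechet_derivative)
  then show ?thesis
    by (subst euclidean_representation[of w, symmetric])
      (simp only: linear_sum linear_scale o_def)
qed

text \<open>Expanding the argument \<open>w\<close> of the derivative in an orthonormal basis reduces the dependence
  of \<open>Dg (f x) (w x)\<close> on two moving arguments to products of functions of one, since \<^const>\<open>Ck_on\<close>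
  speaks only of derivatives in fixed directions. This is where finite dimension enters.\<close>

lemma Ck_on_derivative_apply:
  fixes g :: "'a::euclidean_space \<Rightarrow> 'b::real_normed_vector"
  assumes "\<And>x. x \<in> S \<Longrightarrow> g differentiable (at (f x))"
    "\<And>b. b \<in> Basis \<Longrightarrow> Ck_on k (\<lambda>x. frechet_derivative g (at (f x)) b) S"
    "Ck_on k w S" "open S"
  shows "Ck_on k (\<lambda>x. frechet_derivative g (at (f x)) (w x)) S"
proof (rule Ck_on_cong[OF assms(4)])
  show "(\<Sum>b\<in>Basis. (w x \<bullet> b) *\<^sub>R frechet_derivative g (at (f x)) b) =
      frechet_derivative g (at (f x)) (w x)" if "x \<in> S" for x
    using frechet_derivative_basis[OF assms(1)[OF that]] by metis
  show "Ck_on k (\<lambda>x. \<Sum>b\<in>Basis. (w x \<bullet> b) *\<^sub>R frechet_derivative g (at (f x)) b) S"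
    by (intro Ck_on_sum Ck_on_bilinear[OF bounded_bilinear_scaleR] assms
        Ck_on_linear[OF bounded_linear_inner_left])
qed

lemma Ck_on_compose:
  fixes f :: "'a::real_normed_vector \<Rightarrow> 'b::euclidean_space"
  assumes "Ck_on k g T" "Ck_on k f S" "f ` S \<subseteq> T" "open S"
  shows "Ck_on k (\<lambda>x. g (f x)) S"
  using assms(1,2)
proof (induction k arbitrary: g)
  case 0
  then show ?case using assms(3) by (auto intro: continuous_on_compose2)
next
  case (Suc k)
  have g: "(g has_derivative frechet_derivative g (at (f x))) (at (f x))" if "x \<in> S" for x
    using Suc.prems(1) assms(3) that by (auto simp: frechet_derivative_works)
  show ?case
  proof (rule Ck_on_SucI[OF assms(4), where
        f' = "\<lambda>v x. frechet_derivative g (at (f x)) (frechet_derivative f (at x) v)"])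
    show "((\<lambda>x. g (f x)) has_derivative
        (\<lambda>v. frechet_derivative g (at (f x)) (frechet_derivative f (at x) v))) (at x)"
      if "x \<in> S" for x
      using has_derivative_compose[OF Ck_on_SucD[OF Suc.prems(2) that] g[OF that]] .
    show "Ck_on k (\<lambda>x. frechet_derivative g (at (f x)) (frechet_derivative f (at x) v)) S" for v
    proof (rule Ck_on_derivative_apply)
      show "Ck_on k (\<lambda>x. frechet_derivative g (at (f x)) b) S" for b
        using Suc.prems(1) by (intro Suc.IH[of "\<lambda>y. frechet_derivative g (at y) b"]
            Ck_on_lower[OF Suc.prems(2)]) auto
    qed (use Suc.prems g assms(4) in \<open>auto simp: differentiable_def\<close>)
  qed
qed

text \<open>Openness of the domain is part of the notion, since without it the differentiability
  demanded by \<^const>\<open>Ck_on\<close> would not be a condition on the restriction of \<open>f\<close> to \<open>S\<close>.\<close>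

definition C_infinity_on :: "'a::real_normed_vector set \<Rightarrow> ('a \<Rightarrow> 'b::real_normed_vector) \<Rightarrow> bool"
  where "C_infinity_on S f \<longleftrightarrow> open S \<and> (\<forall>k. Ck_on k f S)"

named_theorems smooth_intros

lemma C_infinity_on_const [smooth_intros]: "open S \<Longrightarrow> C_infinity_on S (\<lambda>x. c)"
  by (simp add: C_infinity_on_def Ck_on_const)

lemma C_infinity_on_open: "C_infinity_on S f \<Longrightarrow> open S"
  by (simp add: C_infinity_on_def)

lemma C_infinity_on_ident [smooth_intros]: "open S \<Longrightarrow> C_infinity_on S (\<lambda>x. x)"
  by (simp add: C_infinity_on_def Ck_on_id)

lemma C_infinity_on_linear:
  "bounded_linear h \<Longrightarrow> C_infinity_on S f \<Longrightarrow> C_infinity_on S (\<lambda>x. h (f x))"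
  by (simp add: C_infinity_on_def Ck_on_linear)

lemma C_infinity_on_bilinear:
  "bounded_bilinear h \<Longrightarrow> C_infinity_on S f \<Longrightarrow> C_infinity_on S g \<Longrightarrow>
    C_infinity_on S (\<lambda>x. h (f x) (g x))"
  by (simp add: C_infinity_on_def Ck_on_bilinear)

lemma C_infinity_on_add [smooth_intros]:
  "C_infinity_on S f \<Longrightarrow> C_infinity_on S g \<Longrightarrow> C_infinity_on S (\<lambda>x. f x + g x)"
  by (simp add: C_infinity_on_def Ck_on_add)

lemmas C_infinity_on_linear_intros [smooth_intros] =
  C_infinity_on_linear[OF bounded_linear_fst]
  C_infinity_on_linear[OF bounded_linear_snd]
  C_infinity_on_linear[OF bounded_linear_Re]
  C_infinity_on_linear[OF bounded_linear_Im]
  C_infinity_on_linear[OF bounded_linear_cnj]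
  C_infinity_on_linear[OF bounded_linear_of_real]
  C_infinity_on_linear[OF bounded_linear_vec_nth]
  C_infinity_on_linear[OF bounded_linear_minus[OF bounded_linear_ident]]

lemmas C_infinity_on_bilinear_intros [smooth_intros] =
  C_infinity_on_bilinear[OF bounded_bilinear_mult]
  C_infinity_on_bilinear[OF bounded_bilinear_scaleR]
  C_infinity_on_bilinear[OF bounded_bilinear_inner]

lemma C_infinity_on_diff [smooth_intros]:
  "C_infinity_on S f \<Longrightarrow> C_infinity_on S g \<Longrightarrow> C_infinity_on S (\<lambda>x. f x - g x)"
  unfolding diff_conv_add_uminus by (intro smooth_intros)

lemma C_infinity_on_divide [smooth_intros]:
  fixes g :: "'a::real_normed_vector \<Rightarrow> 'b::real_normed_field"
  assumes "C_infinity_on S f" "C_infinity_on S g" "\<And>x. x \<in> S \<Longrightarrow> g x \<noteq> 0"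
  shows "C_infinity_on S (\<lambda>x. f x / g x)"
proof -
  have "C_infinity_on S (\<lambda>x. inverse (g x))"
    using assms(2,3) by (simp add: C_infinity_on_def Ck_on_inverse)
  with assms(1) show ?thesis unfolding divide_inverse by (rule C_infinity_on_bilinear_intros)
qed

lemma C_infinity_on_power [smooth_intros]:
  fixes f :: "'a::real_normed_vector \<Rightarrow> 'b::{real_normed_algebra_1}"
  shows "C_infinity_on S f \<Longrightarrow> C_infinity_on S (\<lambda>x. f x ^ n)"
proof (induction n)
  case 0
  then show ?case by (simp add: C_infinity_on_def Ck_on_const)
next
  case (Suc n)
  then show ?case by (auto intro: smooth_intros)
qed

lemma C_infinity_on_Pair [smooth_intros]:
  assumes "C_infinity_on S f" "C_infinity_on S g"
  shows "C_infinity_on S (\<lambda>x. (f x, g x))"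
proof -
  have "bounded_linear (\<lambda>a. (a, 0))" "bounded_linear (\<lambda>b. (0, b))"
    by (intro bounded_linear_Pair bounded_linear_ident bounded_linear_zero)+
  from C_infinity_on_add[OF C_infinity_on_linear[OF this(1) assms(1)]
      C_infinity_on_linear[OF this(2) assms(2)]]
  show ?thesis by simp
qed

lemma C_infinity_on_Complex [smooth_intros]:
  assumes "C_infinity_on S f" "C_infinity_on S g"
  shows "C_infinity_on S (\<lambda>x. Complex (f x) (g x))"
  using assms C_infinity_on_open[OF assms(1)] unfolding Complex_eq by (intro smooth_intros)

lemma C_infinity_on_vector_3 [smooth_intros]:
  fixes f :: "'a::real_normed_vector \<Rightarrow> real"
  assumes "C_infinity_on S f" "C_infinity_on S g" "C_infinity_on S h"
  shows "C_infinity_on S (\<lambda>x. vector [f x, g x, h x] :: real^3)"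
proof -
  have "(vector [a, b, c] :: real^3) = a *\<^sub>R axis 1 1 + b *\<^sub>R axis 2 1 + c *\<^sub>R axis 3 1" for a b c
    by (simp add: vec_eq_iff forall_3 axis_def)
  then show ?thesis
    using assms C_infinity_on_open[OF assms(1)] by (simp only:) (intro smooth_intros)
qed

lemma C_infinity_on_imp_continuous: "C_infinity_on S f \<Longrightarrow> continuous_on S f"
  unfolding C_infinity_on_def by (auto intro: Ck_on_continuous)

lemma C_infinity_on_imp_differentiable:
  "C_infinity_on S f \<Longrightarrow> x \<in> S \<Longrightarrow> (f has_derivative frechet_derivative f (at x)) (at x)"
  by (rule Ck_on_SucD[where k = 0]) (simp_all only: C_infinity_on_def)

lemma C_infinity_on_subset: "C_infinity_on S f \<Longrightarrow> T \<subseteq> S \<Longrightarrow> open T \<Longrightarrow> C_infinity_on T f"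
  unfolding C_infinity_on_def by (auto intro: Ck_on_mono)

lemma C_infinity_on_cong:
  "C_infinity_on S f \<Longrightarrow> (\<And>x. x \<in> S \<Longrightarrow> f x = g x) \<Longrightarrow> C_infinity_on S g"
  unfolding C_infinity_on_def by (auto intro: Ck_on_cong)

lemma C_infinity_on_compose:
  fixes f :: "'a::real_normed_vector \<Rightarrow> 'b::euclidean_space"
  shows "C_infinity_on T g \<Longrightarrow> C_infinity_on S f \<Longrightarrow> f ` S \<subseteq> T \<Longrightarrow> C_infinity_on S (\<lambda>x. g (f x))"
  unfolding C_infinity_on_def by (auto intro: Ck_on_compose)

lemma C_infinity_on_open_preimage:
  "C_infinity_on S f \<Longrightarrow> open T \<Longrightarrow> open {x \<in> S. f x \<in> T}"
  using continuous_open_preimage[of S f T] C_infinity_on_imp_continuous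
  by (auto simp: C_infinity_on_def Int_def vimage_def)

lemma C_infinity_on_derivative:
  fixes g :: "'a::euclidean_space \<Rightarrow> 'b::real_normed_vector"
  assumes "C_infinity_on T g" "C_infinity_on S f" "f ` S \<subseteq> T" "C_infinity_on S w"
  shows "C_infinity_on S (\<lambda>x. frechet_derivative g (at (f x)) (w x))"
proof -
  have "Ck_on (Suc k) g T" for k using assms(1) by (simp only: C_infinity_on_def)
  then have "C_infinity_on T (\<lambda>y. frechet_derivative g (at y) b)" for b
    using assms(1) by (simp add: C_infinity_on_def)
  from C_infinity_on_compose[OF this assms(2,3)]
  have D: "C_infinity_on S (\<lambda>x. frechet_derivative g (at (f x)) b)" for b .
  have g: "g differentiable (at (f x))" if "x \<in> S" for x
    using C_infinity_on_imp_differentiable[OF assms(1)] assms(3) that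
    unfolding differentiable_def by (metis image_subset_iff)
  have "Ck_on k (\<lambda>x. frechet_derivative g (at (f x)) (w x)) S" for k
    by (rule Ck_on_derivative_apply[OF g]) (use D assms(2,4) in \<open>simp_all add: C_infinity_on_def\<close>)
  then show ?thesis using assms(2) by (simp add: C_infinity_on_def)
qed

lemma C_infinity_on_imp_smooth_on: "C_infinity_on S f \<Longrightarrow> smooth_on S f"
  unfolding C_infinity_on_def smooth_on_def by blast

lemma C_infinity_on_local:
  assumes "\<And>x. x \<in> S \<Longrightarrow> \<exists>N. x \<in> N \<and> N \<subseteq> S \<and> C_infinity_on N f"
  shows "C_infinity_on S f"
proof -
  have "open S"
    using assms unfolding C_infinity_on_def by (subst open_subopen) blast
  moreover have "Ck_on k f S" for k
  proof (rule Ck_on_local[OF \<open>open S\<close>])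
    show "\<exists>N. open N \<and> x \<in> N \<and> Ck_on k f (S \<inter> N)" if "x \<in> S" for x
    proof -
      obtain N where "x \<in> N" "N \<subseteq> S" "C_infinity_on N f"
        using assms[OF \<open>x \<in> S\<close>] by blast
      moreover from this have "S \<inter> N = N" by blast
      ultimately show ?thesis unfolding C_infinity_on_def by (intro exI[of _ N]) simp
    qed
  qed
  ultimately show ?thesis by (simp add: C_infinity_on_def)
qed

section \<open>Almost complex structures from holomorphic atlases\<close>

abbreviation transition :: "'a chart \<Rightarrow> 'a chart \<Rightarrow> complex \<times> complex \<Rightarrow> complex \<times> complex" where
  "transition c d \<equiv> snd d \<circ> chart_inv c"

text \<open>The second clause also says that the overlap of two charts is open in either of them.\<close>

definition smooth_atlas :: "'a chart set \<Rightarrow> bool" where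
  "smooth_atlas A \<longleftrightarrow> (\<forall>c\<in>A. inj_on (snd c) (fst c)) \<and>
     (\<forall>c\<in>A. \<forall>d\<in>A. C_infinity_on (snd c ` (fst c \<inter> fst d)) (transition c d))"

abbreviation transition_derivative ::
    "'a chart \<Rightarrow> 'a chart \<Rightarrow> 'a \<Rightarrow> complex \<times> complex \<Rightarrow> complex \<times> complex" where
  "transition_derivative c d p \<equiv> frechet_derivative (transition c d) (at (snd c p))"

lemma chart_inv_apply: "inj_on (snd c) (fst c) \<Longrightarrow> p \<in> fst c \<Longrightarrow> chart_inv c (snd c p) = p"
  by (simp add: chart_inv_def)

lemma smooth_atlasD:
  assumes "smooth_atlas A" "c \<in> A"
  shows "inj_on (snd c) (fst c)" "p \<in> fst c \<Longrightarrow> chart_inv c (snd c p) = p"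
    "d \<in> A \<Longrightarrow> C_infinity_on (snd c ` (fst c \<inter> fst d)) (transition c d)"
    "d \<in> A \<Longrightarrow> open (snd c ` (fst c \<inter> fst d))"
proof -
  show i: "inj_on (snd c) (fst c)" using assms by (simp add: smooth_atlas_def)
  show "p \<in> fst c \<Longrightarrow> chart_inv c (snd c p) = p"
    by (rule chart_inv_apply[OF i])
  show t: "C_infinity_on (snd c ` (fst c \<inter> fst d)) (transition c d)" if "d \<in> A"
    using assms that by (simp add: smooth_atlas_def)
  show "open (snd c ` (fst c \<inter> fst d))" if "d \<in> A"
    using C_infinity_on_open[OF t[OF that]] .
qed

lemma transition_has_derivative:
  assumes "smooth_atlas A" "c \<in> A" "d \<in> A" "p \<in> fst c" "p \<in> fst d"
  shows "(transition c d has_derivative transition_derivative c d p) (at (snd c p))"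
  by (rule C_infinity_on_imp_differentiable[OF smooth_atlasD(3)[OF assms(1-3)]])
    (use assms in auto)

text \<open>The chain rule for \<open>e \<circ> c\<^sup>-\<^sup>1 = (e \<circ> d\<^sup>-\<^sup>1) \<circ> (d \<circ> c\<^sup>-\<^sup>1)\<close>, an identity that holds only near
  \<open>c p\<close>, namely where \<open>d \<circ> c\<^sup>-\<^sup>1\<close> lands in the overlap of \<open>d\<close> and \<open>e\<close>.\<close>

lemma transition_derivative_compose:
  assumes A: "smooth_atlas A" and cde: "c \<in> A" "d \<in> A" "e \<in> A"
    and p: "p \<in> fst c" "p \<in> fst d" "p \<in> fst e"
  shows "transition_derivative d e p (transition_derivative c d p v) =
      transition_derivative c e p v"
proof -
  let ?S = "snd c ` (fst c \<inter> fst d)" and ?T = "snd d ` (fst d \<inter> fst e)"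
  note inv = smooth_atlasD(2)[OF A]
  define N where "N = {y \<in> ?S. transition c d y \<in> ?T}"
  have N: "open N" "snd c p \<in> N"
    unfolding N_def
    using C_infinity_on_open_preimage[OF smooth_atlasD(3)[OF A cde(1,2)] smooth_atlasD(4)[OF A
        cde(2,3)]]
      p inv[OF cde(1)] by auto
  have eq: "(transition d e \<circ> transition c d) y = transition c e y" if "y \<in> N" for y
  proof -
    obtain q q' where q: "q \<in> fst c" "q \<in> fst d" "y = snd c q" and q': "q' \<in> fst d" "q' \<in> fst e"
        "transition c d y = snd d q'"
      using \<open>y \<in> N\<close> unfolding N_def by blast
    have "q = q'"
      using q q' inv[OF cde(1) q(1)] inj_onD[OF smooth_atlasD(1)[OF A cde(2)], of q q'] by simp
    then show ?thesis using q q' inv cde by simp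
  qed
  have "((transition d e \<circ> transition c d) has_derivative
      transition_derivative d e p \<circ> transition_derivative c d p) (at (snd c p))"
    using transition_has_derivative[OF A cde(1,2) p(1,2)] transition_has_derivative[OF A cde(2,3)
        p(2,3)]
    by (intro diff_chain_at) (simp_all add: inv[OF cde(1) p(1)])
  then have "(transition c e has_derivative
      transition_derivative d e p \<circ> transition_derivative c d p) (at (snd c p))"
    by (rule has_derivative_transform_within_open[OF _ N]) (rule eq)
  then show ?thesis
    by (simp add: frechet_derivative_at[symmetric])
qed

lemma transition_derivative_self:
  assumes A: "smooth_atlas A" "c \<in> A" and p: "p \<in> fst c"
  shows "transition_derivative c c p v = v"
proof -
  have "((\<lambda>y. y) has_derivative (\<lambda>v. v)) (at (snd c p))" by (rule has_derivative_ident)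
  then have "(transition c c has_derivative (\<lambda>v. v)) (at (snd c p))"
  proof (rule has_derivative_transform_within_open)
    show "open (snd c ` (fst c \<inter> fst c))" by (rule smooth_atlasD(4)[OF A A(2)])
  qed (use p smooth_atlasD(2)[OF A] in auto)
  then show ?thesis by (simp add: frechet_derivative_at[symmetric])
qed

lemma mult_ii_simps:
  "mult_ii (mult_ii v) = - v" "linear mult_ii" "bounded_linear mult_ii"
proof -
  show "linear mult_ii"
    by (rule linearI) (auto simp: mult_ii_def algebra_simps)
  then show "bounded_linear mult_ii" by (rule linear_conv_bounded_linear[THEN iffD1])
qed (simp add: mult_ii_def prod_eq_iff flip: mult.assoc)

text \<open>A subatlas \<open>E\<close> with holomorphic transitions carries multiplication by the imaginary unit
  over to the manifold: in a chart \<open>c\<close> around \<open>p\<close> it becomes the conjugate of \<^const>\<open>mult_ii\<close> by the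
  derivative of the transition to some \<open>e \<in> E\<close> around \<open>p\<close>. Two choices of \<open>e\<close> give the same
  endomorphism because the derivative of the transition between them commutes with \<^const>\<open>mult_ii\<close>.
  Once this is known, all the axioms follow from the chain rule.\<close>

lemma almost_complex_structure_from_holomorphic_atlas:
  assumes A: "smooth_atlas A" and E: "E \<subseteq> A"
    and cover: "\<And>c p. c \<in> A \<Longrightarrow> p \<in> fst c \<Longrightarrow> \<exists>e\<in>E. p \<in> fst e"
    and hol: "\<And>e e'. e \<in> E \<Longrightarrow> e' \<in> E \<Longrightarrow> holomorphic2_on (snd e ` (fst e \<inter> fst e')) (transition e e')"
  obtains J where "almost_complex_structure A J" "E \<subseteq> holomorphic_charts A J"
proof -
  define J where "J c p v = (let e = SOME e. e \<in> E \<and> p \<in> fst e in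
      transition_derivative e c p (mult_ii (transition_derivative c e p v)))" for c p v
  note comp = transition_derivative_compose[OF A] and self = transition_derivative_self[OF A]
  have lin: "linear (transition_derivative c d p)" if "c \<in> A" "d \<in> A" "p \<in> fst c" "p \<in> fst d"
      for c d p
    by (rule has_derivative_linear[OF transition_has_derivative[OF A that]])
  have ii: "transition_derivative e e' p (mult_ii v) = mult_ii (transition_derivative e e' p v)"
    if e: "e \<in> E" "e' \<in> E" and p: "p \<in> fst e" "p \<in> fst e'" for e e' p v
  proof -
    have "snd e p \<in> snd e ` (fst e \<inter> fst e')" using p by blast
    then obtain D where D: "(transition e e' has_derivative D) (at (snd e p))"
        "\<And>v. D (mult_ii v) = mult_ii (D v)"
      using hol[OF e] unfolding holomorphic2_on_def by blast
    then show ?thesis by (simp add: frechet_derivative_at[OF D(1), symmetric])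
  qed
  have J: "J c p v = transition_derivative e c p (mult_ii (transition_derivative c e p v))"
    if c: "c \<in> A" "p \<in> fst c" and e: "e \<in> E" "p \<in> fst e" for c p v e
  proof -
    define e0 where "e0 = (SOME e. e \<in> E \<and> p \<in> fst e)"
    have "e0 \<in> E \<and> p \<in> fst e0"
      unfolding e0_def by (rule someI[of _ e]) (use e in simp)
    then have e0: "e0 \<in> E" "p \<in> fst e0" by blast+
    have eA: "e \<in> A" "e0 \<in> A" using e e0 E by blast+
    have "transition_derivative e c p (mult_ii (transition_derivative c e p v)) =
        transition_derivative e c p (mult_ii (transition_derivative e0 e p (transition_derivative c
            e0 p v)))"
      by (simp only: comp[OF c(1) eA(2,1) c(2) e0(2) e(2)])
    also have "\<dots> = transition_derivative e c p (transition_derivative e0 e p (mult_ii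
        (transition_derivative c e0 p v)))"
      by (simp only: ii[OF e0(1) e(1) e0(2) e(2)])
    also have "\<dots> = transition_derivative e0 c p (mult_ii (transition_derivative c e0 p v))"
      by (simp only: comp[OF eA(2,1) c(1) e0(2) e(2) c(2)])
    finally show ?thesis by (simp add: J_def Let_def e0_def)
  qed
  have Jlin: "linear (J c p)" and Jsq: "J c p (J c p v) = - v" if c: "c \<in> A" "p \<in> fst c" for c p v
  proof -
    obtain e where e: "e \<in> E" "e \<in> A" "p \<in> fst e" using cover[OF c] E by blast
    have "J c p = transition_derivative e c p \<circ> mult_ii \<circ> transition_derivative c e p"
      using J[OF c e(1,3)] by auto
    then show "linear (J c p)"
      using lin[of e c p] lin[of c e p] mult_ii_simps(2) c e by (simp add: linear_compose)
    have "J c p (J c p v) = transition_derivative e c p (mult_ii (mult_ii (transition_derivative c e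
        p v)))"
      unfolding J[OF c e(1,3)] comp[OF e(2) c(1) e(2,3) c(2) e(3)] self[OF e(2,3)] ..
    also have "\<dots> = - transition_derivative e c p (transition_derivative c e p v)"
      using lin[of e c p] c e by (simp add: mult_ii_simps(1) linear_neg)
    also have "\<dots> = - v"
      unfolding comp[OF c(1) e(2) c(1,2) e(3) c(2)] self[OF c] ..
    finally show "J c p (J c p v) = - v" .
  qed
  have Jsmooth: "smooth_on (snd c ` fst c) (\<lambda>y. J c (chart_inv c y) v)" if c: "c \<in> A" for c v
    unfolding smooth_on_def
  proof
    fix y assume "y \<in> snd c ` fst c"
    then obtain p where p: "p \<in> fst c" "y = snd c p" by blast
    obtain e where e: "e \<in> E" "e \<in> A" "p \<in> fst e" using cover[OF c p(1)] E by blast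
    let ?N = "snd c ` (fst c \<inter> fst e)"
    define g where "g y = frechet_derivative (transition e c) (at (transition c e y))
      (mult_ii (frechet_derivative (transition c e) (at y) v))" for y
    note T = smooth_atlasD(3)[OF A c e(2)] and T' = smooth_atlasD(3)[OF A e(2) c]
    have "C_infinity_on ?N (\<lambda>y. frechet_derivative (transition c e) (at y) v)"
      by (rule C_infinity_on_derivative[OF T])
        (use C_infinity_on_open[OF T] in \<open>auto intro!: smooth_intros\<close>)
    then have g: "C_infinity_on ?N g"
      unfolding g_def
      by (intro C_infinity_on_derivative[OF T' T] C_infinity_on_linear[OF mult_ii_simps(3)])
        (use smooth_atlasD(2)[OF A c] in auto)
    have eq: "g y' = J c (chart_inv c y') v" if "y' \<in> ?N" for y'
    proof -
      obtain q where q: "q \<in> fst c" "q \<in> fst e" "y' = snd c q" using \<open>y' \<in> ?N\<close> by blast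
      then show ?thesis
        unfolding q(3) smooth_atlasD(2)[OF A c q(1)] J[OF c q(1) e(1) q(2)]
        by (simp add: g_def smooth_atlasD(2)[OF A c q(1)])
    qed
    have "C_infinity_on ?N (\<lambda>y. J c (chart_inv c y) v)"
      by (rule C_infinity_on_cong[OF g eq])
    moreover have "y \<in> ?N" using p e by blast
    ultimately show "\<exists>N g. open N \<and> y \<in> N \<and> (\<forall>k. Ck_on k g N) \<and>
        (\<forall>z\<in>snd c ` fst c \<inter> N. g z = J c (chart_inv c z) v)"
      unfolding C_infinity_on_def by blast
  qed
  have Jtrans: "transition_derivative c d p (J c p v) = J d p (transition_derivative c d p v)"
    if c: "c \<in> A" "p \<in> fst c" and d: "d \<in> A" "p \<in> fst d" for c d p v
  proof -
    obtain e where e: "e \<in> E" "e \<in> A" "p \<in> fst e" using cover[OF c] E by blast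
    show ?thesis
      unfolding J[OF c e(1,3)] J[OF d e(1,3)] comp[OF e(2) c(1) d(1) e(3) c(2) d(2)]
        comp[OF c(1) d(1) e(2) c(2) d(2) e(3)] ..
  qed
  have "almost_complex_structure A J"
    unfolding almost_complex_structure_def
  proof (intro conjI ballI allI)
    fix c d p v assume "c \<in> A" "d \<in> A" "p \<in> fst c \<inter> fst d"
    then show "transition_derivative c d p (J c p v) = J d p (transition_derivative c d p v)"
      by (intro Jtrans) auto
  qed (rule Jlin Jsq Jsmooth, assumption+)+
  moreover have "e \<in> holomorphic_charts A J" if e: "e \<in> E" for e
  proof -
    have "J e p v = mult_ii v" if "p \<in> fst e" for p v
    proof -
      have "e \<in> A" using e E by blast
      then show ?thesis by (simp only: J[OF _ that e that] self[OF _ that])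
    qed
    then show ?thesis
      using e E by (auto simp: holomorphic_charts_def)
  qed
  ultimately show thesis using that by blast
qed

text \<open>If the charts of \<open>B\<close>, pulled back along a bijection \<open>F\<close>, are holomorphic coordinates for
  \<open>J\<close>, then \<open>F\<close> and its inverse read in charts are transitions between holomorphic coordinates.
  The transformation law of \<open>J\<close> says that the derivatives of those commute with \<^const>\<open>mult_ii\<close>.\<close>

lemma biholomorphic_from_pulled_back_charts:
  assumes A: "smooth_atlas A" and J: "almost_complex_structure A J"
    and AM: "\<And>c. c \<in> A \<Longrightarrow> fst c \<subseteq> M"
    and F: "bij_betw F M N" and BN: "\<And>d. d \<in> B \<Longrightarrow> fst d \<subseteq> N"
    and B: "\<And>d. d \<in> B \<Longrightarrow> ({p \<in> M. F p \<in> fst d}, snd d \<circ> F) \<in> holomorphic_charts A J"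
  shows "biholomorphic M (holomorphic_charts A J) N B"
proof -
  have hol: "holomorphic2_on (snd c ` (fst c \<inter> fst e)) (transition c e)"
    if c: "c \<in> holomorphic_charts A J" and e: "e \<in> holomorphic_charts A J" for c e
    unfolding holomorphic2_on_def
  proof
    fix y assume "y \<in> snd c ` (fst c \<inter> fst e)"
    then obtain p where p: "p \<in> fst c" "p \<in> fst e" "y = snd c p" by blast
    have ce: "c \<in> A" "e \<in> A" "J c p = mult_ii" "J e p = mult_ii"
      using c e p by (auto simp: holomorphic_charts_def)
    have "transition_derivative c e p (mult_ii v) = mult_ii (transition_derivative c e p v)" for v
      using J[unfolded almost_complex_structure_def, THEN conjunct2, THEN conjunct2, rule_format,
          OF ce(1,2) IntI[OF p(1,2)]] by (simp only: ce(3,4))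
    then show "\<exists>D. (transition c e has_derivative D) (at y) \<and> (\<forall>v. D (mult_ii v) = mult_ii (D v))"
      using transition_has_derivative[OF A ce(1,2) p(1,2)] p(3) by blast
  qed
  have "open (snd c ` {p \<in> fst c. F p \<in> fst d}) \<and>
      holomorphic2_on (snd c ` {p \<in> fst c. F p \<in> fst d}) (snd d \<circ> F \<circ> chart_inv c)"
    if c: "c \<in> holomorphic_charts A J" and d: "d \<in> B" for c d
  proof -
    define e where "e = ({p \<in> M. F p \<in> fst d}, snd d \<circ> F)"
    have e: "e \<in> holomorphic_charts A J" using B[OF d] by (simp add: e_def)
    have cA: "c \<in> A" "e \<in> A" using c e by (auto simp: holomorphic_charts_def)
    have "{p \<in> fst c. F p \<in> fst d} = fst c \<inter> fst e"
      using AM[OF cA(1)] by (auto simp: e_def)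
    then show ?thesis
      using hol[OF c e] smooth_atlasD(4)[OF A cA] by (simp add: e_def)
  qed
  then have 1: "holomorphic_map (holomorphic_charts A J) B F"
    unfolding holomorphic_map_def by (intro ballI)
  have "open (snd d ` {x \<in> fst d. inv_into M F x \<in> fst c}) \<and>
      holomorphic2_on (snd d ` {x \<in> fst d. inv_into M F x \<in> fst c}) (snd c \<circ> inv_into M F \<circ>
          chart_inv d)"
    if d: "d \<in> B" and c: "c \<in> holomorphic_charts A J" for c d
  proof -
    define e where "e = ({p \<in> M. F p \<in> fst d}, snd d \<circ> F)"
    have e: "e \<in> holomorphic_charts A J" using B[OF d] by (simp add: e_def)
    have cA: "c \<in> A" "e \<in> A" using c e by (auto simp: holomorphic_charts_def)
    have F': "inv_into M F (F p) = p" if "p \<in> M" for p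
      using F that by (simp add: bij_betw_def)
    have F'': "F (inv_into M F x) = x" "inv_into M F x \<in> M" if "x \<in> N" for x
      using F that by (auto simp: bij_betw_def f_inv_into_f inv_into_into)
    have inj: "inj_on (snd d) (fst d)"
    proof
      fix x x' assume *: "x \<in> fst d" "x' \<in> fst d" "snd d x = snd d x'"
      then have N: "x \<in> N" "x' \<in> N" using BN[OF d] by blast+
      then have "inv_into M F x \<in> fst e" "inv_into M F x' \<in> fst e"
        "snd e (inv_into M F x) = snd e (inv_into M F x')"
        using F'' * by (simp_all add: e_def)
      then have "inv_into M F x = inv_into M F x'"
        using inj_onD[OF smooth_atlasD(1)[OF A cA(2)]] by blast
      moreover have "F (inv_into M F x) = x" "F (inv_into M F x') = x'"
        by (rule F''(1)[OF N(1)], rule F''(1)[OF N(2)])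
      ultimately show "x = x'" by metis
    qed
    have "{x \<in> fst d. inv_into M F x \<in> fst c} = F ` (fst c \<inter> fst e)"
    proof (intro equalityI subsetI)
      fix x assume x: "x \<in> {x \<in> fst d. inv_into M F x \<in> fst c}"
      then have "x = F (inv_into M F x)" "inv_into M F x \<in> fst c \<inter> fst e"
        using F''[of x] BN[OF d] by (auto simp: e_def)
      then show "x \<in> F ` (fst c \<inter> fst e)" by (rule image_eqI)
    next
      fix x assume "x \<in> F ` (fst c \<inter> fst e)"
      then obtain p where "x = F p" "p \<in> fst c" "p \<in> M" "F p \<in> fst d" by (auto simp: e_def)
      then show "x \<in> {x \<in> fst d. inv_into M F x \<in> fst c}" by (simp add: F')
    qed
    then have "snd d ` {x \<in> fst d. inv_into M F x \<in> fst c} = (snd d \<circ> F) ` (fst c \<inter> fst e)"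
      by (simp only: image_comp)
    then have S: "snd d ` {x \<in> fst d. inv_into M F x \<in> fst c} = snd e ` (fst e \<inter> fst c)"
      by (simp add: e_def Int_commute)
    have T: "(snd c \<circ> inv_into M F \<circ> chart_inv d) y = transition e c y"
        if "y \<in> snd e ` (fst e \<inter> fst c)" for y
    proof -
      obtain p where p: "p \<in> fst e" "p \<in> fst c" "y = snd e p"
        using \<open>y \<in> snd e ` (fst e \<inter> fst c)\<close> by blast
      then have "p \<in> M" "F p \<in> fst d" "y = snd d (F p)" by (auto simp: e_def)
      then have "(snd c \<circ> inv_into M F \<circ> chart_inv d) y = snd c p"
        by (simp add: chart_inv_apply[OF inj] F')
      then show ?thesis using p smooth_atlasD(2)[OF A cA(2)] by simp
    qed
    have o: "open (snd e ` (fst e \<inter> fst c))" by (rule smooth_atlasD(4)[OF A cA(2,1)])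
    have "holomorphic2_on (snd e ` (fst e \<inter> fst c)) (snd c \<circ> inv_into M F \<circ> chart_inv d)"
      unfolding holomorphic2_on_def
    proof
      fix y assume y: "y \<in> snd e ` (fst e \<inter> fst c)"
      then obtain D where "(transition e c has_derivative D) (at y)"
          "\<forall>v. D (mult_ii v) = mult_ii (D v)"
        using hol[OF e c] unfolding holomorphic2_on_def by blast
      moreover from this(1) have "((snd c \<circ> inv_into M F \<circ> chart_inv d) has_derivative D) (at y)"
        by (rule has_derivative_transform_within_open[OF _ o y]) (rule T[symmetric])
      ultimately show "\<exists>D. ((snd c \<circ> inv_into M F \<circ> chart_inv d) has_derivative D) (at y) \<and>
          (\<forall>v. D (mult_ii v) = mult_ii (D v))" by blast
    qed
    then show ?thesis using S o by simp
  qed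
  then have "holomorphic_map B (holomorphic_charts A J) (inv_into M F)"
    unfolding holomorphic_map_def by (intro ballI)
  with 1 F show ?thesis unfolding biholomorphic_def by blast
qed

section \<open>Upper half-space and the hyperboloid\<close>

lemma metric_matrix_entry: "metric_matrix p $ i $ j = (if i = j then 1 / (p $ 1)\<^sup>2 else 0)"
  by (simp add: metric_matrix_def hyp_metric_def inner_axis_axis)

lemma matrix_inv_metric_matrix:
  assumes "p $ 1 \<noteq> 0"
  shows "matrix_inv (metric_matrix p) $ k $ l = (if k = l then (p $ 1)\<^sup>2 else 0)"
proof -
  define M :: "real^3^3" where "M = (\<chi> k l. if k = l then (p $ 1)\<^sup>2 else 0)"
  have "metric_matrix p ** M = mat 1" "M ** metric_matrix p = mat 1"
    using assms by (simp_all add: matrix_matrix_mult_def mat_def vec_eq_iff metric_matrix_entry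
        M_def forall_3 sum_3)
  then have "metric_matrix p ** matrix_inv (metric_matrix p) = mat 1"
    unfolding matrix_inv_def by (rule someI2[of _ M, OF conjI conjunct1])
  with \<open>M ** metric_matrix p = mat 1\<close> have "matrix_inv (metric_matrix p) = M"
    by (metis (no_types) matrix_mul_assoc matrix_mul_lid matrix_mul_rid)
  then show ?thesis by (simp add: M_def)
qed

lemma metric_partial_eq:
  assumes "p $ 1 \<noteq> 0"
  shows "metric_partial p i j l = (if i = 1 \<and> j = l then - 2 / (p $ 1) ^ 3 else 0)"
proof -
  have "((\<lambda>q. metric_matrix q $ j $ l) has_derivative
      (\<lambda>v. if j = l then - 2 * v $ 1 / (p $ 1) ^ 3 else 0)) (at p)"
  proof (cases "j = l")
    case True
    have "((\<lambda>q. 1 / (q $ 1)\<^sup>2) has_derivative (\<lambda>v. - 2 * v $ 1 / (p $ 1) ^ 3)) (at p)"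
      using assms by (auto intro!: derivative_eq_intros bounded_linear.has_derivative[OF
          bounded_linear_vec_nth]
          simp: fun_eq_iff field_simps power2_eq_square power3_eq_cube)
    with True show ?thesis by (simp add: metric_matrix_entry)
  qed (simp add: metric_matrix_entry)
  then have "frechet_derivative (\<lambda>q. metric_matrix q $ j $ l) (at p) =
      (\<lambda>v. if j = l then - 2 * v $ 1 / (p $ 1) ^ 3 else 0)"
    by (rule frechet_derivative_at[symmetric])
  then show ?thesis by (simp add: metric_partial_def axis_def)
qed

text \<open>The metric is conformal to the Euclidean one with factor \<open>t\<^sup>-\<^sup>2\<close>, where \<open>t = p $ 1\<close>, which
  gives \<open>\<Gamma>\<^sup>k\<^sub>i\<^sub>j = (\<delta>\<^sub>k\<^sub>1 \<delta>\<^sub>i\<^sub>j - \<delta>\<^sub>i\<^sub>1 \<delta>\<^sub>j\<^sub>k - \<delta>\<^sub>j\<^sub>1 \<delta>\<^sub>i\<^sub>k) / t\<close>.\<close>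

lemma christoffel_contraction:
  assumes "p $ 1 \<noteq> 0"
  shows "(\<Sum>i\<in>UNIV. \<Sum>j\<in>UNIV. christoffel p k i j * v $ i * v $ j) =
    ((if k = 1 then v \<bullet> v else 0) - 2 * v $ 1 * v $ k) / p $ 1"
proof -
  have C: "christoffel p k i j = ((if k = 1 \<and> i = j then 1 else 0)
      - (if i = 1 \<and> j = k then 1 else 0) - (if j = 1 \<and> i = k then 1 else 0)) / p $ 1" for i j
  proof -
    have "christoffel p k i j = (p $ 1)\<^sup>2 *
        (metric_partial p i j k + metric_partial p j i k - metric_partial p k i j) / 2"
      using exhaust_3[of k] unfolding christoffel_def matrix_inv_metric_matrix[OF assms] sum_3 by
          auto
    also have "\<dots> = ((if k = 1 \<and> i = j then 1 else 0) - (if i = 1 \<and> j = k then 1 else 0)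
        - (if j = 1 \<and> i = k then 1 else 0)) / p $ 1"
      using assms unfolding metric_partial_eq[OF assms]
      by (auto simp: power2_eq_square power3_eq_cube divide_simps)
    finally show ?thesis .
  qed
  show ?thesis
    unfolding C using assms exhaust_3[of k]
    by (elim disjE) (simp_all add: sum_3 inner_vec_def field_simps)
qed

lemma mem_unit_tangent_bundle:
  "(p, v) \<in> unit_tangent_bundle \<longleftrightarrow> p $ 1 > 0 \<and> v \<bullet> v = (p $ 1)\<^sup>2"
  by (auto simp: unit_tangent_bundle_def H3_def hyp_metric_def)

text \<open>A triple \<open>(a, b, c)\<close> stands for the Hermitian matrix with diagonal entries \<open>a\<close>, \<open>c\<close> and
  off-diagonal entry \<open>b\<close>. These matrices form Minkowski space, with the determinant as quadratic
  form.\<close>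

type_synonym hermitian = "real \<times> complex \<times> real"

text \<open>The polar form of the determinant, normalised such that \<open>lorentz m m\<close> is twice the
  determinant.\<close>

definition lorentz :: "hermitian \<Rightarrow> hermitian \<Rightarrow> real" where
  "lorentz = (\<lambda>(a, b, c) (a', b', c'). a * c' + a' * c - 2 * (b \<bullet> b'))"

lemma lorentz_commute: "lorentz m n = lorentz n m"
  by (auto simp: lorentz_def inner_commute split: prod.splits)

lemma lorentz_add_left: "lorentz (m + m') n = lorentz m n + lorentz m' n"
  by (auto simp: lorentz_def inner_left_distrib algebra_simps split: prod.splits)

lemma lorentz_scaleR_left: "lorentz (r *\<^sub>R m) n = r * lorentz m n"
  by (auto simp: lorentz_def algebra_simps split: prod.splits)

lemma lorentz_add_right: "lorentz m (n + n') = lorentz m n + lorentz m n'"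
  by (metis lorentz_add_left lorentz_commute)

lemma lorentz_scaleR_right: "lorentz m (r *\<^sub>R n) = r * lorentz m n"
  by (metis lorentz_scaleR_left lorentz_commute)

lemma lorentz_diff_left: "lorentz (m - m') n = lorentz m n - lorentz m' n"
  using lorentz_add_left[of "m - m'" m' n] by simp

lemma lorentz_diff_right: "lorentz m (n - n') = lorentz m n - lorentz m n'"
  using lorentz_add_right[of m "n - n'" n'] by simp

lemmas lorentz_simps = lorentz_add_left lorentz_add_right lorentz_diff_left lorentz_diff_right
  lorentz_scaleR_left lorentz_scaleR_right

text \<open>The isometry of the upper half-space onto the sheet of the hyperboloid of determinant one
  with positive entry \<open>c\<close>, and below it its derivative.\<close>

definition hyperboloid_point :: "real^3 \<Rightarrow> hermitian" where
  "hyperboloid_point p = ((p \<bullet> p) / p $ 1, Complex (p $ 2 / p $ 1) (p $ 3 / p $ 1), 1 / p $ 1)"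

definition hyperboloid_velocity :: "real^3 \<Rightarrow> real^3 \<Rightarrow> hermitian" where
  "hyperboloid_velocity p v = (2 * (p \<bullet> v) / p $ 1 - (p \<bullet> p) * v $ 1 / (p $ 1)\<^sup>2,
     Complex (v $ 2 / p $ 1 - p $ 2 * v $ 1 / (p $ 1)\<^sup>2) (v $ 3 / p $ 1 - p $ 3 * v $ 1 / (p $
         1)\<^sup>2),
     - (v $ 1) / (p $ 1)\<^sup>2)"

text \<open>The inverse of the isometry, and below it its derivative.\<close>

definition half_space_point :: "hermitian \<Rightarrow> real^3" where
  "half_space_point = (\<lambda>(a, b, c). vector [1 / c, Re b / c, Im b / c])"

definition half_space_velocity :: "hermitian \<Rightarrow> hermitian \<Rightarrow> real^3" where
  "half_space_velocity = (\<lambda>(a, b, c) (a', b', c'). vector [- c' / c\<^sup>2,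
     (Re b' * c - Re b * c') / c\<^sup>2, (Im b' * c - Im b * c') / c\<^sup>2])"

text \<open>A unit tangent vector becomes an orthonormal pair in Minkowski space. The map below inverts
  this.\<close>

lemma hyperboloid_frame:
  assumes "(p, v) \<in> unit_tangent_bundle"
  shows "lorentz (hyperboloid_point p) (hyperboloid_point p) = 2"
      "lorentz (hyperboloid_point p) (hyperboloid_velocity p v) = 0"
    "lorentz (hyperboloid_velocity p v) (hyperboloid_velocity p v) = - 2"
proof -
  define t x y a b c where d: "t = p $ 1" "x = p $ 2" "y = p $ 3" "a = v $ 1"
      "b = v $ 2" "c = v $ 3"
  have t: "t \<noteq> 0" and v: "a\<^sup>2 + b\<^sup>2 + c\<^sup>2 = t\<^sup>2"
    using assms by (auto simp: mem_unit_tangent_bundle d inner_vec_def sum_3 power2_eq_square)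
  show "lorentz (hyperboloid_point p) (hyperboloid_point p) = 2"
      "lorentz (hyperboloid_point p) (hyperboloid_velocity p v) = 0"
    using t by (simp_all add: lorentz_def hyperboloid_point_def hyperboloid_velocity_def
        inner_complex_def inner_vec_def sum_3
        d[symmetric] divide_simps) algebra+
  show "lorentz (hyperboloid_velocity p v) (hyperboloid_velocity p v) = - 2"
    using t v by (simp add: lorentz_def hyperboloid_point_def hyperboloid_velocity_def
        inner_complex_def inner_vec_def sum_3
        d[symmetric] divide_simps) algebra
qed

lemma half_space_point_hyperboloid: "p $ 1 \<noteq> 0 \<Longrightarrow> half_space_point (hyperboloid_point p) = p"
  by (simp add: half_space_point_def hyperboloid_point_def vec_eq_iff forall_3)

lemma half_space_velocity_hyperboloid: "p $ 1 \<noteq> 0 \<Longrightarrow> half_space_velocity (hyperboloid_point p)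
    (hyperboloid_velocity p v) = v"
  by (simp add: half_space_velocity_def hyperboloid_point_def hyperboloid_velocity_def vec_eq_iff
      forall_3 field_simps power2_eq_square)

lemma half_space_of_frame:
  assumes "snd (snd X) > 0" "lorentz X X = 2" "lorentz X V = 0" "lorentz V V = - 2"
  shows "(half_space_point X, half_space_velocity X V) \<in> unit_tangent_bundle"
      "hyperboloid_point (half_space_point X) = X" "hyperboloid_velocity (half_space_point X)
      (half_space_velocity X V) = V"
proof -
  obtain a b1 b2 c a' b1' b2' c' where XV: "X = (a, Complex b1 b2, c)" "V = (a', Complex b1' b2',
      c')"
    by (metis complex_surj prod.collapse)
  have c: "c > 0" and h: "a * c = 1 + b1\<^sup>2 + b2\<^sup>2" "a * c' + a' * c = 2 * (b1 * b1' + b2 * b2')"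
    "a' * c' + 1 = b1'\<^sup>2 + b2'\<^sup>2"
    using assms by (auto simp: XV lorentz_def inner_complex_def power2_eq_square)
  show "(half_space_point X, half_space_velocity X V) \<in> unit_tangent_bundle"
    using c h by (simp add: mem_unit_tangent_bundle XV half_space_point_def half_space_velocity_def
        inner_vec_def sum_3 divide_simps)
      algebra
  show "hyperboloid_point (half_space_point X) = X"
    using c h by (simp add: XV hyperboloid_point_def half_space_point_def inner_vec_def sum_3
        divide_simps)
      (simp add: power2_eq_square)
  show "hyperboloid_velocity (half_space_point X) (half_space_velocity X V) = V"
    using c h by (simp add: XV hyperboloid_point_def hyperboloid_velocity_def
        half_space_velocity_def half_space_point_def inner_vec_def sum_3 divide_simps)
      algebra
qed

section \<open>Light-like vectors and the sphere at infinity\<close>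

text \<open>The forward light cone without its apex. Its rays are the points of the sphere at infinity.\<close>

definition null_cone :: "hermitian set" where
  "null_cone = {n. lorentz n n = 0 \<and> fst n \<ge> 0 \<and> snd (snd n) \<ge> 0 \<and> fst n + snd (snd n) > 0}"

text \<open>For \<open>X\<close> on the hyperboloid with unit tangent vector \<open>V\<close>, the geodesic is \<open>X cosh r + V sinh
  r = (e\<^sup>r (X + V) + e\<^sup>-\<^sup>r (X - V)) / 2\<close>. Hence \<open>X + V\<close> and \<open>X - V\<close> are light-like vectors on the
  rays of the forward and of the backward end, and the geodesic flow only rescales them.\<close>

definition forward_null :: "(real^3) \<times> (real^3) \<Rightarrow> hermitian" where
  "forward_null u = hyperboloid_point (fst u) + hyperboloid_velocity (fst u) (snd u)"

definition backward_null :: "(real^3) \<times> (real^3) \<Rightarrow> hermitian" where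
  "backward_null u = hyperboloid_point (fst u) - hyperboloid_velocity (fst u) (snd u)"

definition unit_vector_of_null :: "hermitian \<Rightarrow> hermitian \<Rightarrow> (real^3) \<times> (real^3)" where
  "unit_vector_of_null m n =
     (half_space_point ((1/2) *\<^sub>R (m + n)), half_space_velocity ((1/2) *\<^sub>R (m + n)) ((1/2) *\<^sub>R (m -
         n)))"

text \<open>A light-like vector with \<open>c = 0\<close> also has \<open>b = 0\<close>, so that the sign of \<open>a\<close> has to be read
  off from the pairing with the second vector.\<close>

lemma null_pair_in_cone:
  assumes "lorentz m m = 0" "lorentz n n = 0" "lorentz m n > 0" "snd (snd m) \<ge> 0" "snd (snd n) \<ge> 0"
  shows "m \<in> null_cone"
proof -
  obtain a b c a' b' c' where mn: "m = (a, b, c)" "n = (a', b', c')" by (metis prod.collapse)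
  have h: "a * c = b \<bullet> b" "a' * c' = b' \<bullet> b'" "c \<ge> 0" "c' \<ge> 0" "a * c' + a' * c - 2 * (b \<bullet> b') > 0"
    using assms by (auto simp: mn lorentz_def)
  show ?thesis
  proof (cases "c = 0")
    case True
    then have "b = 0" using h by simp
    then have "a * c' > 0" using h True by simp
    then have "a > 0" using h by (simp add: zero_less_mult_iff)
    then show ?thesis using assms True by (simp add: null_cone_def mn)
  next
    case False
    then have "c > 0" using h by simp
    moreover have "a * c \<ge> 0" using h by simp
    ultimately have "a \<ge> 0" by (simp add: zero_le_mult_iff)
    then show ?thesis using assms \<open>c > 0\<close> by (simp add: null_cone_def mn)
  qed
qed

text \<open>Together with the next lemma: unit tangent vectors correspond to pairs of forward light-like
  vectors with pairing \<open>4\<close>. In this description both the flow and the ends become linear algebra.\<close>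

lemma null_vectors_of_unit_vector:
  assumes "u \<in> unit_tangent_bundle"
  shows "forward_null u \<in> null_cone" "backward_null u \<in> null_cone"
      "lorentz (forward_null u) (backward_null u) = 4"
    "unit_vector_of_null (forward_null u) (backward_null u) = u"
proof -
  obtain p v where u: "u = (p, v)" by fastforce
  note m = assms[unfolded u]
  have p: "p $ 1 > 0" and v: "v \<bullet> v = (p $ 1)\<^sup>2"
    using m by (auto simp: mem_unit_tangent_bundle)
  have "(v $ 1)\<^sup>2 \<le> (p $ 1)\<^sup>2"
  proof -
    have "(v $ 1)\<^sup>2 + (v $ 2)\<^sup>2 + (v $ 3)\<^sup>2 = (p $ 1)\<^sup>2"
      using v by (simp add: inner_vec_def sum_3 power2_eq_square)
    then show ?thesis
      using zero_le_power2[of "v $ 2"] zero_le_power2[of "v $ 3"] by linarith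
  qed
  then have "\<bar>v $ 1\<bar> \<le> p $ 1"
    using p by (metis abs_le_square_iff abs_of_pos)
  then have c: "snd (snd (forward_null u)) \<ge> 0" "snd (snd (backward_null u)) \<ge> 0"
    using p by (auto simp: forward_null_def backward_null_def hyperboloid_point_def
        hyperboloid_velocity_def u divide_simps power2_eq_square)
  have l: "lorentz (forward_null u) (forward_null u) = 0" "lorentz (backward_null u) (backward_null
      u) = 0"
    "lorentz (forward_null u) (backward_null u) = 4"
    using hyperboloid_frame[OF m]
    by (simp_all add: forward_null_def backward_null_def u lorentz_simps lorentz_commute[of
        "hyperboloid_velocity p v" "hyperboloid_point p"])
  show "forward_null u \<in> null_cone" "backward_null u \<in> null_cone"
    using null_pair_in_cone[OF l(1,2) _ c] null_pair_in_cone[OF l(2,1) _ c(2,1)] l(3)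
    by (simp_all add: lorentz_commute[of "backward_null u" "forward_null u"])
  show "lorentz (forward_null u) (backward_null u) = 4" by fact
  have "(1/2::real) *\<^sub>R (forward_null u + backward_null u) = hyperboloid_point p"
      "(1/2::real) *\<^sub>R (forward_null u - backward_null u) = hyperboloid_velocity p v"
    by (simp_all add: forward_null_def backward_null_def u scaleR_add_right scaleR_diff_right flip:
        scaleR_left_distrib)
  then show "unit_vector_of_null (forward_null u) (backward_null u) = u"
    using p by (simp add: unit_vector_of_null_def half_space_point_hyperboloid
        half_space_velocity_hyperboloid u)
qed

lemma unit_vector_of_null:
  assumes "m \<in> null_cone" "n \<in> null_cone" "lorentz m n = 4"
  shows "unit_vector_of_null m n \<in> unit_tangent_bundle"
    "forward_null (unit_vector_of_null m n) = m" "backward_null (unit_vector_of_null m n) = n"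
proof -
  obtain a b c a' b' c' where mn: "m = (a, b, c)" "n = (a', b', c')" by (metis prod.collapse)
  define X where "X = (1/2::real) *\<^sub>R (m + n)"
  define V where "V = (1/2::real) *\<^sub>R (m - n)"
  have h: "a * c = b \<bullet> b" "a' * c' = b' \<bullet> b'" "c \<ge> 0" "c' \<ge> 0" "a * c' + a' * c - 2 * (b \<bullet> b') = 4"
    using assms by (auto simp: mn lorentz_def null_cone_def)
  have "c + c' \<noteq> 0"
  proof
    assume "c + c' = 0"
    then have "c = 0" "c' = 0" using h by auto
    then show False using h by simp
  qed
  then have c: "snd (snd X) > 0"
    using h by (auto simp: X_def mn)
  have l: "lorentz X X = 2" "lorentz X V = 0" "lorentz V V = -2"
    using assms by (simp_all add: X_def V_def lorentz_simps lorentz_commute[of n m] null_cone_def)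
  note f = half_space_of_frame[OF c l]
  show "unit_vector_of_null m n \<in> unit_tangent_bundle"
    using f(1) by (simp add: unit_vector_of_null_def X_def V_def)
  have u: "unit_vector_of_null m n = (half_space_point X, half_space_velocity X V)"
    by (simp add: unit_vector_of_null_def X_def V_def)
  have "X + V = (1/2::real) *\<^sub>R (2 *\<^sub>R m)" "X - V = (1/2::real) *\<^sub>R (2 *\<^sub>R n)"
    unfolding X_def V_def by (simp_all add: scaleR_2 scaleR_add_right scaleR_diff_right flip:
        scaleR_left_distrib)
  then show "forward_null (unit_vector_of_null m n) = m" "backward_null (unit_vector_of_null m n) =
      n"
    unfolding forward_null_def backward_null_def u using f by simp_all
qed

lemma null_cone_scaleR: "n \<in> null_cone \<Longrightarrow> r > 0 \<Longrightarrow> r *\<^sub>R n \<in> null_cone"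
  by (simp add: null_cone_def lorentz_simps flip: distrib_left)

text \<open>In the coordinates \<open>(2 Re b, 2 Im b, a - c, a + c)\<close> the determinant is a quarter of the
  standard Lorentz form, so the ray of a light-like vector is the unit vector of its spatial
  part.\<close>

definition direction :: "hermitian \<Rightarrow> real^3" where
  "direction = (\<lambda>(a, b, c). vector [2 * Re b / (a + c), 2 * Im b / (a + c), (a - c) / (a + c)])"

definition null_of_direction :: "real^3 \<Rightarrow> hermitian" where
  "null_of_direction x = (1 + x $ 3, Complex (x $ 1) (x $ 2), 1 - x $ 3)"

lemma mem_P1: "x \<in> P1 \<longleftrightarrow> (x $ 1)\<^sup>2 + (x $ 2)\<^sup>2 + (x $ 3)\<^sup>2 = 1"
  by (simp add: P1_def norm_eq_1 inner_vec_def sum_3 power2_eq_square)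

lemma direction_in_P1: "n \<in> null_cone \<Longrightarrow> direction n \<in> P1"
proof -
  assume "n \<in> null_cone"
  moreover obtain a b1 b2 c where n: "n = (a, Complex b1 b2, c)"
      by (metis prod.collapse complex_surj)
  ultimately have "a + c > 0" "a * c = b1\<^sup>2 + b2\<^sup>2"
    by (auto simp: null_cone_def lorentz_def inner_complex_def power2_eq_square)
  then have "a + c \<noteq> 0" "(2 * b1)\<^sup>2 + (2 * b2)\<^sup>2 + (a - c)\<^sup>2 = (a + c)\<^sup>2" by (simp, algebra)
  then show ?thesis
    by (simp add: mem_P1 n direction_def power_divide flip: add_divide_distrib)
qed

lemma null_of_direction_in_cone: "x \<in> P1 \<Longrightarrow> null_of_direction x \<in> null_cone"
proof -
  assume x: "x \<in> P1"
  then have "(x $ 3)\<^sup>2 \<le> 1" unfolding mem_P1 by (smt (verit) zero_le_power2)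
  then have "\<bar>x $ 3\<bar> \<le> 1" by (simp add: abs_square_le_1)
  moreover have "lorentz (null_of_direction x) (null_of_direction x) = 0"
    using x by (simp add: mem_P1 lorentz_def null_of_direction_def inner_complex_def) algebra
  ultimately show ?thesis by (auto simp: null_cone_def null_of_direction_def)
qed

lemma direction_null_of_direction: "direction (null_of_direction x) = x"
  by (simp add: direction_def null_of_direction_def vec_eq_iff forall_3)

lemma direction_scaleR: "r \<noteq> 0 \<Longrightarrow> direction (r *\<^sub>R n) = direction n"
  by (cases n) (simp add: direction_def vec_eq_iff forall_3 flip: distrib_left right_diff_distrib)

lemma null_of_direction_direction:
  assumes "fst n + snd (snd n) \<noteq> 0"
  shows "n = ((fst n + snd (snd n)) / 2) *\<^sub>R null_of_direction (direction n)"
proof -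
  obtain a b1 b2 c where n: "n = (a, Complex b1 b2, c)" by (metis prod.collapse complex_surj)
  show ?thesis using assms
    by (simp add: n direction_def null_of_direction_def complex_eq_iff) (simp add: field_simps)
qed

lemma direction_eq_scaleR:
  assumes "m \<in> null_cone" "n \<in> null_cone" "direction m = direction n"
  obtains r where "r > 0" "m = r *\<^sub>R n"
proof -
  define s where "s = (\<lambda>n :: hermitian. (fst n + snd (snd n)) / 2)"
  have s: "s m > 0" "s n > 0" using assms(1,2) by (auto simp: s_def null_cone_def)
  have "m = s m *\<^sub>R null_of_direction (direction m)" "n = s n *\<^sub>R null_of_direction (direction n)"
    using null_of_direction_direction[of m] null_of_direction_direction[of n] s
    by (auto simp: s_def)
  note k = this[folded assms(3)]
  have "(s m / s n) *\<^sub>R n = (s m / s n) *\<^sub>R (s n *\<^sub>R null_of_direction (direction m))"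
    using k(2) by simp
  also have "\<dots> = m"
    using k(1) s by simp
  finally have "m = (s m / s n) *\<^sub>R n" by simp
  then show thesis using s that[of "s m / s n"] by simp
qed

lemma lorentz_null_of_direction:
  "lorentz (null_of_direction x) (null_of_direction y) = 2 * (1 - x \<bullet> y)"
  by (simp add: lorentz_def null_of_direction_def inner_complex_def inner_vec_def sum_3
      algebra_simps)

lemma direction_neq:
  assumes "m \<in> null_cone" "lorentz m n \<noteq> 0" "n \<in> null_cone"
  shows "direction m \<noteq> direction n"
proof
  assume "direction m = direction n"
  then obtain r where "m = r *\<^sub>R n" using direction_eq_scaleR[OF assms(1,3)] by metis
  then show False using assms by (simp add: lorentz_simps null_cone_def)
qed

section \<open>Unit speed geodesics\<close>

lemma has_vector_derivative_real3_iff: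
  fixes f :: "real \<Rightarrow> real^3"
  shows "(f has_vector_derivative v) (at r) \<longleftrightarrow>
    (\<forall>i. ((\<lambda>r. f r $ i) has_real_derivative v $ i) (at r))"
proof
  assume "(f has_vector_derivative v) (at r)"
  then show "\<forall>i. ((\<lambda>r. f r $ i) has_real_derivative v $ i) (at r)"
    by (simp add: has_real_derivative_iff_has_vector_derivative
        bounded_linear.has_vector_derivative[OF bounded_linear_vec_nth])
next
  assume *: "\<forall>i. ((\<lambda>r. f r $ i) has_real_derivative v $ i) (at r)"
  have e: "w = w $ 1 *\<^sub>R axis 1 1 + w $ 2 *\<^sub>R axis 2 1 + w $ 3 *\<^sub>R axis 3 1" for w :: "real^3"
    by (simp add: vec_eq_iff forall_3 axis_def)
  have "((\<lambda>r. f r $ 1 *\<^sub>R axis 1 1 + f r $ 2 *\<^sub>R axis 2 1 + f r $ 3 *\<^sub>R axis 3 1 :: real^3)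
      has_vector_derivative v $ 1 *\<^sub>R axis 1 1 + v $ 2 *\<^sub>R axis 2 1 + v $ 3 *\<^sub>R axis 3 1) (at r)"
    by (intro has_vector_derivative_add has_vector_derivative_scaleR[OF _
        has_vector_derivative_const,
          simplified] *[rule_format])
  then show "(f has_vector_derivative v) (at r)"
    by (simp flip: e)
qed

lemma has_vector_derivative_hermitian_iff:
  fixes f :: "real \<Rightarrow> hermitian"
  shows "(f has_vector_derivative d) (at r) \<longleftrightarrow>
    ((\<lambda>r. fst (f r)) has_real_derivative fst d) (at r) \<and>
    ((\<lambda>r. fst (snd (f r))) has_vector_derivative fst (snd d)) (at r) \<and>
    ((\<lambda>r. snd (snd (f r))) has_real_derivative snd (snd d)) (at r)" (is "?L = ?R")
proof
  show "?L \<Longrightarrow> ?R"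
    unfolding has_real_derivative_iff_has_vector_derivative
    by (intro conjI bounded_linear.has_vector_derivative[OF bounded_linear_fst]
        bounded_linear.has_vector_derivative[OF bounded_linear_snd])
  assume ?R
  then have "((\<lambda>r. (fst (f r), fst (snd (f r)), snd (snd (f r)))) has_vector_derivative
      (fst d, fst (snd d), snd (snd d))) (at r)"
    by (intro has_vector_derivative_Pair) (simp_all add:
        has_real_derivative_iff_has_vector_derivative)
  then show ?L by simp
qed

definition acceleration :: "real^3 \<Rightarrow> real^3 \<Rightarrow> real^3" where
  "acceleration p v = (1 / p $ 1) *\<^sub>R ((2 * v $ 1) *\<^sub>R v - (v \<bullet> v) *\<^sub>R axis 1 1)"

text \<open>The geodesic equation solved for the second derivative.\<close>

lemma unit_geodesic_iff:
  "unit_geodesic \<gamma> \<longleftrightarrow>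
    (\<forall>r. (\<gamma> r, velocity \<gamma> r) \<in> unit_tangent_bundle \<and>
      (\<gamma> has_vector_derivative velocity \<gamma> r) (at r) \<and>
      (velocity \<gamma> has_vector_derivative acceleration (\<gamma> r) (velocity \<gamma> r)) (at r))"
proof -
  have *: "(\<forall>k. a $ k + (\<Sum>i\<in>UNIV. \<Sum>j\<in>UNIV. christoffel p k i j * v $ i * v $ j) = 0)
      \<longleftrightarrow> a = acceleration p v" if "p $ 1 > 0" for p v a :: "real^3"
  proof -
    have "p $ 1 \<noteq> 0" using that by simp
    then show ?thesis
      unfolding christoffel_contraction[OF \<open>p $ 1 \<noteq> 0\<close>]
      by (auto simp: vec_eq_iff forall_3 acceleration_def axis_def field_simps)
  qed
  have d: "(f has_vector_derivative d) (at r) \<longleftrightarrow> f differentiable (at r) \<and>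
      vector_derivative f (at r) = d"
    for f :: "real \<Rightarrow> real^3" and d r
    using vector_derivative_at vector_derivative_works differentiableI_vector by metis
  have v: "(\<gamma> has_vector_derivative velocity \<gamma> r) (at r) \<longleftrightarrow> \<gamma> differentiable (at r)" for r
    by (simp add: d velocity_def)
  show ?thesis
    unfolding unit_geodesic_def mem_unit_tangent_bundle v d[of "velocity \<gamma>"]
  proof (intro all_cong1)
    fix r
    show "(\<gamma> r \<in> H3 \<and> \<gamma> differentiable (at r) \<and> velocity \<gamma> differentiable (at r) \<and>
        hyp_metric (\<gamma> r) (velocity \<gamma> r) (velocity \<gamma> r) = 1 \<and>
        (\<forall>k. vector_derivative (velocity \<gamma>) (at r) $ k +
             (\<Sum>i\<in>UNIV. \<Sum>j\<in>UNIV. christoffel (\<gamma> r) k i j * velocity \<gamma> r $ i * velocity \<gamma> r $ j) =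
                 0)) =
       ((0 < \<gamma> r $ 1 \<and> velocity \<gamma> r \<bullet> velocity \<gamma> r = (\<gamma> r $ 1)\<^sup>2) \<and> \<gamma> differentiable at r \<and>
        velocity \<gamma> differentiable at r \<and>
        vector_derivative (velocity \<gamma>) (at r) = acceleration (\<gamma> r) (velocity \<gamma> r))"
    proof (cases "\<gamma> r $ 1 > 0")
      case True
      then show ?thesis unfolding *[OF True] by (auto simp: H3_def hyp_metric_def)
    qed (simp add: H3_def)
  qed
qed

lemma half_space_point_has_vector_derivative:
  assumes "(X has_vector_derivative V) (at r)" "snd (snd (X r)) \<noteq> 0"
  shows "((\<lambda>r. half_space_point (X r)) has_vector_derivative half_space_velocity (X r) V) (at r)"
  using assms unfolding has_vector_derivative_real3_iff has_vector_derivative_hermitian_iff forall_3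
    half_space_point_def half_space_velocity_def case_prod_unfold
  by (auto intro!: derivative_eq_intros simp: power2_eq_square)

text \<open>A curve on the hyperboloid with \<open>X'' = X\<close> is a geodesic of the half-space; the only
  nonlinear input is the unit speed, which turns \<open>v \<bullet> v\<close> in the acceleration into \<open>1 / c\<^sup>2\<close>.\<close>

lemma half_space_velocity_has_vector_derivative:
  assumes "(X has_vector_derivative V r) (at r)" "(V has_vector_derivative X r) (at r)"
    "snd (snd (X r)) > 0" "(half_space_point (X r), half_space_velocity (X r) (V r)) \<in>
        unit_tangent_bundle"
  shows "((\<lambda>r. half_space_velocity (X r) (V r)) has_vector_derivative acceleration (half_space_point
      (X r)) (half_space_velocity (X r) (V r))) (at r)"
proof -
  obtain a b1 b2 c a' b1' b2' c' where XV: "X r = (a, Complex b1 b2, c)" "V r = (a',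
      Complex b1' b2', c')"
    by (metis complex_surj prod.collapse)
  have c: "c \<noteq> 0" using assms(3) by (auto simp: XV)
  have u: "half_space_velocity (X r) (V r) \<bullet> half_space_velocity (X r) (V r) = 1 / c\<^sup>2"
    using assms(4) by (simp add: mem_unit_tangent_bundle half_space_point_def XV power_divide)
  have acc: "acceleration (half_space_point (X r)) (half_space_velocity (X r) (V r)) =
      vector [2 * c'\<^sup>2 / c ^ 3 - 1 / c,
     - 2 * c' * (b1' * c - b1 * c') / c ^ 3, - 2 * c' * (b2' * c - b2 * c') / c ^ 3]"
    unfolding acceleration_def u using c
    by (simp add: vec_eq_iff forall_3 half_space_point_def half_space_velocity_def XV axis_def
        power2_eq_square power3_eq_cube
        field_simps)
  show ?thesis
    using assms(1,2) c unfolding acc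
    unfolding has_vector_derivative_real3_iff has_vector_derivative_hermitian_iff forall_3
        half_space_velocity_def
      case_prod_unfold
    by (auto intro!: derivative_eq_intros
        simp: XV power2_eq_square power3_eq_cube divide_simps)
      (simp_all add: algebra_simps)
qed

text \<open>The orbit of the geodesic flow, with its initial vector given by light-like vectors on the
  two ends.\<close>

definition null_curve :: "hermitian \<Rightarrow> hermitian \<Rightarrow> real \<Rightarrow> (real^3) \<times> (real^3)" where
  "null_curve m n r = unit_vector_of_null (exp r *\<^sub>R m) (exp (- r) *\<^sub>R n)"

lemma null_curve:
  assumes "m \<in> null_cone" "n \<in> null_cone" "lorentz m n = 4"
  shows "null_curve m n r \<in> unit_tangent_bundle"
    "forward_null (null_curve m n r) = exp r *\<^sub>R m" "backward_null (null_curve m n r) =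
        exp (- r) *\<^sub>R n"
proof -
  have "exp r *\<^sub>R m \<in> null_cone" "exp (- r) *\<^sub>R n \<in> null_cone"
    "lorentz (exp r *\<^sub>R m) (exp (- r) *\<^sub>R n) = 4"
    using assms by (simp_all add: null_cone_scaleR lorentz_simps exp_minus)
  from unit_vector_of_null[OF this] show "null_curve m n r \<in> unit_tangent_bundle"
    "forward_null (null_curve m n r) = exp r *\<^sub>R m" "backward_null (null_curve m n r) =
        exp (- r) *\<^sub>R n"
    by (simp_all add: null_curve_def)
qed

lemma null_curve_geodesic:
  assumes "m \<in> null_cone" "n \<in> null_cone" "lorentz m n = 4"
  shows "unit_geodesic (\<lambda>r. fst (null_curve m n r))"
    "velocity (\<lambda>r. fst (null_curve m n r)) r = snd (null_curve m n r)"
proof -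
  define X where "X r = (1/2::real) *\<^sub>R (exp r *\<^sub>R m + exp (- r) *\<^sub>R n)" for r
  define V where "V r = (1/2::real) *\<^sub>R (exp r *\<^sub>R m - exp (- r) *\<^sub>R n)" for r
  have X: "(X has_vector_derivative V r) (at r)" and V: "(V has_vector_derivative X r) (at r)" for r
    unfolding X_def V_def by (auto intro!: derivative_eq_intros simp: algebra_simps)
  have c: "null_curve m n r = (half_space_point (X r), half_space_velocity (X r) (V r))" for r
    by (simp add: null_curve_def unit_vector_of_null_def X_def V_def)
  have U: "(half_space_point (X r), half_space_velocity (X r) (V r)) \<in> unit_tangent_bundle" for r
    using null_curve(1)[OF assms] c by metis
  then have pos: "snd (snd (X r)) > 0" for r
    using U[of r] by (cases "X r") (simp add: mem_unit_tangent_bundle half_space_point_def)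
  have d: "((\<lambda>r. half_space_point (X r)) has_vector_derivative half_space_velocity (X r) (V r)) (at
      r)" for r
    using half_space_point_has_vector_derivative[OF X] pos[of r] by simp
  then have v: "velocity (\<lambda>r. half_space_point (X r)) = (\<lambda>r. half_space_velocity (X r) (V r))"
    unfolding velocity_def by (auto intro: vector_derivative_at)
  show "unit_geodesic (\<lambda>r. fst (null_curve m n r))"
    unfolding c fst_conv unit_geodesic_iff v
    using U d half_space_velocity_has_vector_derivative[OF X V pos U] by blast
  show "velocity (\<lambda>r. fst (null_curve m n r)) r = snd (null_curve m n r)"
    unfolding c fst_conv v by simp
qed

text \<open>The converse: on the hyperboloid, every unit speed geodesic satisfies the linear system \<open>X'
  = V\<close>, \<open>V' = X\<close>. So all of them are known explicitly, and the ends are constant along each.\<close>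

lemma geodesic_hyperboloid_point_derivative:
  assumes "unit_geodesic \<gamma>"
  shows "((\<lambda>r. hyperboloid_point (\<gamma> r)) has_vector_derivative hyperboloid_velocity (\<gamma> r) (velocity \<gamma>
      r)) (at r)"
    "((\<lambda>r. hyperboloid_velocity (\<gamma> r) (velocity \<gamma> r)) has_vector_derivative hyperboloid_point (\<gamma> r))
        (at r)"
proof -
  have U: "(\<gamma> r, velocity \<gamma> r) \<in> unit_tangent_bundle"
    and g: "\<And>i. ((\<lambda>r. \<gamma> r $ i) has_real_derivative velocity \<gamma> r $ i) (at r)"
    and v: "\<And>i. ((\<lambda>r. velocity \<gamma> r $ i) has_real_derivative acceleration (\<gamma> r) (velocity \<gamma> r) $ i)
        (at r)"
    using assms unfolding unit_geodesic_iff has_vector_derivative_real3_iff by auto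
  have t: "\<gamma> r $ 1 \<noteq> 0" using U by (auto simp: mem_unit_tangent_bundle)
  show "((\<lambda>r. hyperboloid_point (\<gamma> r)) has_vector_derivative hyperboloid_velocity (\<gamma> r) (velocity \<gamma>
      r)) (at r)"
    unfolding has_vector_derivative_hermitian_iff hyperboloid_point_def hyperboloid_velocity_def
        inner_vec_def sum_3
    using t
    by (auto intro!: derivative_eq_intros g simp: divide_simps power2_eq_square
        has_vector_derivative_complex_iff)
  have u: "velocity \<gamma> r $ 1 * velocity \<gamma> r $ 1 + velocity \<gamma> r $ 2 * velocity \<gamma> r $ 2
     + velocity \<gamma> r $ 3 * velocity \<gamma> r $ 3 = \<gamma> r $ 1 * \<gamma> r $ 1"
    using U by (simp add: mem_unit_tangent_bundle inner_vec_def sum_3 power2_eq_square)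
  have a: "acceleration (\<gamma> r) (velocity \<gamma> r) $ i = (2 * velocity \<gamma> r $ 1 * velocity \<gamma> r $ i
     - (\<gamma> r $ 1)\<^sup>2 * (if i = 1 then 1 else 0)) / \<gamma> r $ 1" for i
    using U by (simp add: mem_unit_tangent_bundle acceleration_def axis_def)
  show "((\<lambda>r. hyperboloid_velocity (\<gamma> r) (velocity \<gamma> r)) has_vector_derivative hyperboloid_point (\<gamma>
      r)) (at r)"
    unfolding has_vector_derivative_hermitian_iff hyperboloid_point_def hyperboloid_velocity_def
        inner_vec_def sum_3
    using t
    apply (auto intro!: derivative_eq_intros g v simp: has_vector_derivative_complex_iff)
       apply (simp_all add: a divide_simps power2_eq_square)
    \<comment> \<open>The first entry is the one that needs the unit speed.\<close>
    subgoal using u by algebra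
    by (simp_all add: algebra_simps power4_eq_xxxx)
qed

lemma linear_ode_solution:
  fixes f :: "real \<Rightarrow> 'a::real_normed_vector"
  assumes "\<And>r. (f has_vector_derivative s *\<^sub>R f r) (at r)"
  shows "f r = exp (s * r) *\<^sub>R f 0"
proof -
  have "((\<lambda>r. exp (- s * r)) has_real_derivative - s * exp (- s * r)) (at r)" for r
    by (auto intro!: derivative_eq_intros)
  from has_vector_derivative_scaleR[OF this assms]
  have "((\<lambda>r. exp (- s * r) *\<^sub>R f r) has_vector_derivative 0) (at r)" for r
    by (simp add: mult.commute)
  then obtain c where c: "\<And>r. r \<in> UNIV \<Longrightarrow> exp (- s * r) *\<^sub>R f r = c"
    using has_vector_derivative_zero_constant[OF convex_UNIV] by blast
  have "f r = exp (s * r) *\<^sub>R (exp (- s * r) *\<^sub>R f r)"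
    by (simp flip: exp_add)
  also have "\<dots> = exp (s * r) *\<^sub>R f 0"
    using c[of r] c[of 0] by simp
  finally show ?thesis .
qed

lemma geodesic_null_vectors:
  assumes "unit_geodesic \<gamma>"
  shows "forward_null (\<gamma> r, velocity \<gamma> r) = exp r *\<^sub>R forward_null (\<gamma> 0, velocity \<gamma> 0)"
    "backward_null (\<gamma> r, velocity \<gamma> r) = exp (- r) *\<^sub>R backward_null (\<gamma> 0, velocity \<gamma> 0)"
proof -
  note d = geodesic_hyperboloid_point_derivative[OF assms]
  show "forward_null (\<gamma> r, velocity \<gamma> r) = exp r *\<^sub>R forward_null (\<gamma> 0, velocity \<gamma> 0)"
    by (rule linear_ode_solution[of "\<lambda>r. forward_null (\<gamma> r, velocity \<gamma> r)" 1, simplified])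
      (use has_vector_derivative_add[OF d] in \<open>simp add: forward_null_def add.commute\<close>)
  show "backward_null (\<gamma> r, velocity \<gamma> r) = exp (- r) *\<^sub>R backward_null (\<gamma> 0, velocity \<gamma> 0)"
    by (rule linear_ode_solution[of "\<lambda>r. backward_null (\<gamma> r, velocity \<gamma> r)" "-1", simplified])
      (use has_vector_derivative_diff[OF d] in \<open>simp add: backward_null_def\<close>)
qed

definition forward_end :: "(real^3) \<times> (real^3) \<Rightarrow> real^3" where
  "forward_end u = direction (forward_null u)"

definition backward_end :: "(real^3) \<times> (real^3) \<Rightarrow> real^3" where
  "backward_end u = direction (backward_null u)"

text \<open>Equal ends mean that the light-like vectors agree up to positive factors \<open>x\<close> and \<open>y\<close>. The
  pairing of both pairs is \<open>4\<close>, hence \<open>x * y = 1\<close>, and the flow for time \<open>ln x\<close> achieves exactly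
  this rescaling.\<close>

lemma same_ends_on_null_curve:
  assumes "u \<in> unit_tangent_bundle" "u' \<in> unit_tangent_bundle"
    "forward_end u' = forward_end u" "backward_end u' = backward_end u"
  obtains r where "u' = null_curve (forward_null u) (backward_null u) r"
proof -
  note n = null_vectors_of_unit_vector[OF assms(1)] and n' = null_vectors_of_unit_vector[OF
      assms(2)]
  obtain x where x: "x > 0" "forward_null u' = x *\<^sub>R forward_null u"
    using direction_eq_scaleR[OF n'(1) n(1) assms(3)[unfolded forward_end_def]] .
  obtain y where y: "backward_null u' = y *\<^sub>R backward_null u"
    using direction_eq_scaleR[OF n'(2) n(2) assms(4)[unfolded backward_end_def]] .
  have "y * x = 1"
    using n(3) n'(3) by (simp add: x y lorentz_simps)
  then have "exp (ln x) = x" "exp (- ln x) = y"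
    using x by (auto simp: exp_minus field_simps)
  then have "u' = null_curve (forward_null u) (backward_null u) (ln x)"
    using n'(4) by (simp add: null_curve_def x(2) y)
  then show thesis by (rule that)
qed

lemma null_curve_ends:
  assumes "m \<in> null_cone" "n \<in> null_cone" "lorentz m n = 4"
  shows "forward_end (null_curve m n r) = direction m" "backward_end (null_curve m n r) =
      direction n"
  by (simp_all add: forward_end_def backward_end_def null_curve[OF assms] direction_scaleR)

lemma null_curve_0: "u \<in> unit_tangent_bundle \<Longrightarrow> null_curve (forward_null u) (backward_null u) 0 = u"
  by (simp add: null_curve_def null_vectors_of_unit_vector)

text \<open>An oriented geodesic is determined by its ordered pair of ends. In particular the relation
  is an equivalence on the unit tangent bundle.\<close>

lemma geodesic_flow_rel_iff:
  "(u, u') \<in> geodesic_flow_rel \<longleftrightarrow> u \<in> unit_tangent_bundle \<and> u' \<in> unit_tangent_bundle \<and>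
    forward_end u = forward_end u' \<and> backward_end u = backward_end u'"
proof
  assume "(u, u') \<in> geodesic_flow_rel"
  then obtain \<gamma> r s where g: "unit_geodesic \<gamma>" "u = (\<gamma> r, velocity \<gamma> r)" "u' = (\<gamma> s, velocity \<gamma> s)"
    unfolding geodesic_flow_rel_def by blast
  have E: "forward_end (\<gamma> r, velocity \<gamma> r) = forward_end (\<gamma> 0, velocity \<gamma> 0)"
    "backward_end (\<gamma> r, velocity \<gamma> r) = backward_end (\<gamma> 0, velocity \<gamma> 0)" for r
    unfolding forward_end_def backward_end_def geodesic_null_vectors[OF g(1), of r]
    by (simp_all add: direction_scaleR)
  show "u \<in> unit_tangent_bundle \<and> u' \<in> unit_tangent_bundle \<and>
    forward_end u = forward_end u' \<and> backward_end u = backward_end u'"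
    using g(1) E(1)[of r] E(2)[of r] E(1)[of s] E(2)[of s] by (simp add: unit_geodesic_iff g(2,3))
next
  assume *: "u \<in> unit_tangent_bundle \<and> u' \<in> unit_tangent_bundle \<and>
    forward_end u = forward_end u' \<and> backward_end u = backward_end u'"
  define c where "c = null_curve (forward_null u) (backward_null u)"
  obtain r where r: "u' = c r"
    using same_ends_on_null_curve[of u u'] * unfolding c_def by metis
  have 0: "c 0 = u"
    using * by (simp add: c_def null_curve_0)
  define \<gamma> where "\<gamma> = (\<lambda>r. fst (c r))"
  have \<gamma>: "unit_geodesic \<gamma>" "velocity \<gamma> s = snd (c s)" for s
    using * null_curve_geodesic[of "forward_null u" "backward_null u"]
        null_vectors_of_unit_vector[of u] by (auto simp: c_def \<gamma>_def)
  have "(u, u') = ((\<gamma> 0, velocity \<gamma> 0), (\<gamma> r, velocity \<gamma> r))"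
    unfolding \<gamma>(2) by (simp add: \<gamma>_def 0 r)
  with \<gamma>(1) show "(u, u') \<in> geodesic_flow_rel"
    unfolding geodesic_flow_rel_def by blast
qed

lemma geodesic_through_eq_null_curve:
  assumes "u \<in> unit_tangent_bundle"
  shows "geodesic_through u = range (null_curve (forward_null u) (backward_null u))"
proof -
  note n = null_vectors_of_unit_vector[OF assms]
  have "geodesic_through u \<subseteq> range (null_curve (forward_null u) (backward_null u))"
  proof
    fix u' assume "u' \<in> geodesic_through u"
    then show "u' \<in> range (null_curve (forward_null u) (backward_null u))"
      using same_ends_on_null_curve[of u u'] by (auto simp: geodesic_through_def
          geodesic_flow_rel_iff)
  qed
  moreover have "null_curve (forward_null u) (backward_null u) r \<in> geodesic_through u" for r
    using assms null_curve(1)[OF n(1-3)] null_curve_ends[OF n(1-3)]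
    by (auto simp: geodesic_through_def geodesic_flow_rel_iff forward_end_def backward_end_def)
  ultimately show ?thesis by blast
qed

section \<open>Geodesics as pairs of endpoints\<close>

lemma ends_in_P1: "u \<in> unit_tangent_bundle \<Longrightarrow> forward_end u \<in> P1" "u \<in> unit_tangent_bundle \<Longrightarrow>
    backward_end u \<in> P1"
  by (simp_all add: forward_end_def backward_end_def direction_in_P1 null_vectors_of_unit_vector)

lemma ends_distinct: "u \<in> unit_tangent_bundle \<Longrightarrow> forward_end u \<noteq> backward_end u"
  unfolding forward_end_def backward_end_def
  by (rule direction_neq) (simp_all add: null_vectors_of_unit_vector)

lemma oriented_geodesics_eq: "oriented_geodesics = geodesic_through ` unit_tangent_bundle"
  by (auto simp: oriented_geodesics_def quotient_def geodesic_through_def)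

lemma geodesic_through_eq_iff:
  assumes "u \<in> unit_tangent_bundle" "u' \<in> unit_tangent_bundle"
  shows "geodesic_through u = geodesic_through u' \<longleftrightarrow> forward_end u = forward_end u' \<and>
      backward_end u = backward_end u'"
proof
  assume "geodesic_through u = geodesic_through u'"
  moreover have "u' \<in> geodesic_through u'"
    using assms by (simp add: geodesic_through_def geodesic_flow_rel_iff)
  ultimately have "u' \<in> geodesic_through u" by simp
  then show "forward_end u = forward_end u' \<and> backward_end u = backward_end u'"
    by (simp add: geodesic_through_def geodesic_flow_rel_iff)
next
  assume "forward_end u = forward_end u' \<and> backward_end u = backward_end u'"
  then show "geodesic_through u = geodesic_through u'"
    using assms by (auto simp: geodesic_through_def geodesic_flow_rel_iff)
qed

text \<open>The forward end is replaced by its antipode. A positive rotation about the geodesic turns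
  the sphere positively near one end and negatively near the other, so exactly one of the two ends
  has to be composed with an orientation reversing map for the result to be holomorphic.
  Distinctness of the ends becomes avoidance of the reflected diagonal.\<close>

definition geodesic_ends :: "geodesic \<Rightarrow> (real^3) \<times> (real^3)" where
  "geodesic_ends l = (let u = (SOME u. u \<in> l) in (- forward_end u, backward_end u))"

lemma geodesic_ends_through:
  assumes "u \<in> unit_tangent_bundle"
  shows "geodesic_ends (geodesic_through u) = (- forward_end u, backward_end u)"
proof -
  have "u \<in> geodesic_through u"
    using assms by (simp add: geodesic_through_def geodesic_flow_rel_iff)
  then have "(SOME u'. u' \<in> geodesic_through u) \<in> geodesic_through u"
    by (rule someI)
  then show ?thesis
    by (auto simp: geodesic_ends_def Let_def geodesic_through_def geodesic_flow_rel_iff)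
qed

text \<open>The first light-like vector is scaled such that the pairing is \<open>4\<close>. Scaling only one of the
  two avoids square roots, so that the section is rational.\<close>

definition unit_vector_with_ends :: "(real^3) \<times> (real^3) \<Rightarrow> (real^3) \<times> (real^3)" where
  "unit_vector_with_ends = (\<lambda>(x, y). unit_vector_of_null
     ((2 / (1 - x \<bullet> y)) *\<^sub>R null_of_direction x) (null_of_direction y))"

lemma P1_inner_less_1: "x \<in> P1 \<Longrightarrow> y \<in> P1 \<Longrightarrow> x \<noteq> y \<Longrightarrow> x \<bullet> y < 1"
proof -
  assume "x \<in> P1" "y \<in> P1" "x \<noteq> y"
  then have "(x - y) \<bullet> (x - y) > 0" "x \<bullet> x = 1" "y \<bullet> y = 1"
    by (auto simp: P1_def norm_eq_1)
  then show ?thesis by (simp add: inner_diff_left inner_diff_right inner_commute)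
qed

lemma unit_vector_with_ends:
  assumes "x \<in> P1" "y \<in> P1" "x \<noteq> y"
  shows "unit_vector_with_ends (x, y) \<in> unit_tangent_bundle"
    "forward_end (unit_vector_with_ends (x, y)) = x" "backward_end (unit_vector_with_ends (x, y)) =
        y"
proof -
  have 1: "x \<bullet> y < 1" using P1_inner_less_1 assms by blast
  let ?m = "(2 / (1 - x \<bullet> y)) *\<^sub>R null_of_direction x"
  have m: "?m \<in> null_cone" "null_of_direction y \<in> null_cone" "lorentz ?m (null_of_direction y) = 4"
    using 1 assms by (simp_all add: null_cone_scaleR null_of_direction_in_cone lorentz_simps
        lorentz_null_of_direction field_simps)
  note v = unit_vector_of_null[OF m]
  have r: "2 / (1 - x \<bullet> y) \<noteq> 0" using 1 by simp
  show "unit_vector_with_ends (x, y) \<in> unit_tangent_bundle"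
    "forward_end (unit_vector_with_ends (x, y)) = x" "backward_end (unit_vector_with_ends (x, y)) =
        y"
    using v r by (simp_all add: unit_vector_with_ends_def forward_end_def backward_end_def
        direction_scaleR
        direction_null_of_direction)
qed

lemma mem_P1xP1_minus: "(x, y) \<in> P1xP1_minus \<longleftrightarrow> x \<in> P1 \<and> y \<in> P1 \<and> - x \<noteq> y"
  by (auto simp: P1xP1_minus_def reflected_diagonal_def antipodal_def)

lemma P1_uminus: "- x \<in> P1 \<longleftrightarrow> x \<in> P1"
  by (simp add: P1_def)

lemma geodesic_ends_section:
  assumes "(x, y) \<in> P1xP1_minus"
  shows "geodesic_ends (geodesic_through (unit_vector_with_ends (- x, y))) = (x, y)"
  using assms unit_vector_with_ends[of "- x" y]
  by (simp add: mem_P1xP1_minus P1_uminus geodesic_ends_through)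

lemma geodesic_ends_bij: "bij_betw geodesic_ends oriented_geodesics P1xP1_minus"
  unfolding bij_betw_def
proof (intro conjI equalityI subsetI)
  show "inj_on geodesic_ends oriented_geodesics"
    by (auto simp: inj_on_def oriented_geodesics_eq geodesic_ends_through geodesic_through_eq_iff)
  show "z \<in> P1xP1_minus" if "z \<in> geodesic_ends ` oriented_geodesics" for z
    using that ends_in_P1 ends_distinct
    by (auto simp: oriented_geodesics_eq geodesic_ends_through mem_P1xP1_minus P1_uminus)
  show "z \<in> geodesic_ends ` oriented_geodesics" if "z \<in> P1xP1_minus" for z
  proof -
    obtain x y where z: "z = (x, y)" by fastforce
    show ?thesis
      using that unit_vector_with_ends[of "- x" y] geodesic_ends_section[of x y]
      unfolding z oriented_geodesics_eq mem_P1xP1_minus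
      by (metis P1_uminus image_eqI)
  qed
qed

lemma C_infinity_on_null_vectors:
  "C_infinity_on {u. fst u $ 1 \<noteq> 0} forward_null" "C_infinity_on {u. fst u $ 1 \<noteq> 0} backward_null"
proof -
  have o: "open {u :: (real^3) \<times> (real^3). fst u $ 1 \<noteq> 0}"
    by (intro open_Collect_neq continuous_intros)
  have p: "C_infinity_on {u. fst u $ 1 \<noteq> 0} (\<lambda>u :: (real^3) \<times> (real^3). hyperboloid_point (fst u))"
    unfolding hyperboloid_point_def by (intro smooth_intros o) auto
  have v: "C_infinity_on {u. fst u $ 1 \<noteq> 0} (\<lambda>u. hyperboloid_velocity (fst u) (snd u))"
    unfolding hyperboloid_velocity_def by (intro smooth_intros o) auto
  show "C_infinity_on {u. fst u $ 1 \<noteq> 0} forward_null" "C_infinity_on {u. fst u $ 1 \<noteq> 0}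
      backward_null"
    using C_infinity_on_add[OF p v] C_infinity_on_diff[OF p v]
    by (simp_all add: forward_null_def[abs_def] backward_null_def[abs_def])
qed

lemma C_infinity_on_direction: "C_infinity_on {n. fst n + snd (snd n) \<noteq> 0} direction"
proof -
  have "open {n :: hermitian. fst n + snd (snd n) \<noteq> 0}"
    by (intro open_Collect_neq continuous_intros)
  then show ?thesis
    unfolding direction_def case_prod_unfold by (intro smooth_intros; simp)
qed

lemma C_infinity_on_unit_vector_of_null:
  "C_infinity_on {z. snd (snd (fst z)) + snd (snd (snd z)) \<noteq> 0} (\<lambda>z. unit_vector_of_null (fst z)
      (snd z))"
proof -
  have "open {z :: hermitian \<times> hermitian. snd (snd (fst z)) + snd (snd (snd z)) \<noteq> 0}"
    by (intro open_Collect_neq continuous_intros)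
  then show ?thesis
    unfolding unit_vector_of_null_def half_space_point_def half_space_velocity_def case_prod_unfold
    by (intro smooth_intros) (auto simp: add_divide_distrib[symmetric])
qed

text \<open>An open neighbourhood of the unit tangent bundle on which the rational expressions for the
  two ends have no pole.\<close>

definition ends_domain :: "((real^3) \<times> (real^3)) set" where
  "ends_domain = {u. fst u $ 1 \<noteq> 0 \<and> fst (forward_null u) + snd (snd (forward_null u)) \<noteq> 0 \<and>
     fst (backward_null u) + snd (snd (backward_null u)) \<noteq> 0}"

lemma C_infinity_on_ends: "C_infinity_on ends_domain forward_end"
    "C_infinity_on ends_domain backward_end"
proof -
  let ?Q = "{u :: (real^3) \<times> (real^3). fst u $ 1 \<noteq> 0}" and ?D =
      "{n :: hermitian. fst n + snd (snd n) \<noteq> 0}"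
  have eq: "ends_domain = {u \<in> ?Q. forward_null u \<in> ?D} \<inter> {u \<in> ?Q. backward_null u \<in> ?D}"
    by (auto simp: ends_domain_def)
  have "open {u \<in> ?Q. forward_null u \<in> ?D}" "open {u \<in> ?Q. backward_null u \<in> ?D}"
    by (rule C_infinity_on_null_vectors[THEN C_infinity_on_open_preimage,
          OF C_infinity_on_open[OF C_infinity_on_direction]])+
  then have o: "open ends_domain"
    unfolding eq by (rule open_Int)
  have n: "C_infinity_on ends_domain forward_null" "C_infinity_on ends_domain backward_null"
    by (rule C_infinity_on_null_vectors[THEN C_infinity_on_subset, OF _ o],
        force simp: ends_domain_def)+
  have "C_infinity_on ends_domain (\<lambda>u. direction (forward_null u))"
      "C_infinity_on ends_domain (\<lambda>u. direction (backward_null u))"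
    by (rule C_infinity_on_compose[OF C_infinity_on_direction], rule n,
        force simp: ends_domain_def)+
  then show "C_infinity_on ends_domain forward_end" "C_infinity_on ends_domain backward_end"
    by (simp_all add: forward_end_def[abs_def] backward_end_def[abs_def])
qed

lemma unit_tangent_bundle_subset_ends_domain: "unit_tangent_bundle \<subseteq> ends_domain"
proof
  fix u assume u: "u \<in> unit_tangent_bundle"
  then have "fst u $ 1 > 0" by (cases u) (simp add: mem_unit_tangent_bundle)
  then show "u \<in> ends_domain"
    using null_vectors_of_unit_vector(1,2)[OF u] by (simp add: ends_domain_def null_cone_def)
qed

lemma unit_vector_with_ends_smooth:
  assumes "C_infinity_on S f" "C_infinity_on S g"
    "\<And>z. z \<in> S \<Longrightarrow> f z \<in> P1 \<and> g z \<in> P1 \<and> f z \<noteq> g z"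
  shows "C_infinity_on S (\<lambda>z. unit_vector_with_ends (f z, g z))"
proof -
  have o: "open S" using assms(1) by (rule C_infinity_on_open)
  have n: "1 - f z \<bullet> g z > 0" if "z \<in> S" for z
    using P1_inner_less_1 assms(3)[OF that] by fastforce
  have c: "(2 / (1 - f z \<bullet> g z)) * (1 - f z $ 3) + (1 - g z $ 3) \<noteq> 0" if z: "z \<in> S" for z
  proof
    assume a: "(2 / (1 - f z \<bullet> g z)) * (1 - f z $ 3) + (1 - g z $ 3) = 0"
    \<comment> \<open>Both summands are nonnegative, so they vanish, and then both points are the north pole.\<close>
    have "null_of_direction (f z) \<in> null_cone" "null_of_direction (g z) \<in> null_cone"
      using assms(3)[OF z] by (auto intro: null_of_direction_in_cone)
    then have le: "1 - f z $ 3 \<ge> 0" "1 - g z $ 3 \<ge> 0" by (auto simp: null_cone_def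
        null_of_direction_def)
    then have "(2 / (1 - f z \<bullet> g z)) * (1 - f z $ 3) \<ge> 0"
      using n[OF z] by simp
    with a le have g0: "1 - g z $ 3 = 0" and "(2 / (1 - f z \<bullet> g z)) * (1 - f z $ 3) = 0"
        by linarith+
    then have f0: "1 - f z $ 3 = 0" using n[OF z] by simp
    have "(x $ 1)\<^sup>2 + (x $ 2)\<^sup>2 + (x $ 3)\<^sup>2 = 1 \<Longrightarrow> 1 - x $ 3 = 0 \<Longrightarrow> x = vector [0, 0, 1]"
        for x :: "real^3"
      by (simp add: vec_eq_iff forall_3 sum_power2_eq_zero_iff)
    then have "f z = g z" using assms(3)[OF z] f0 g0 unfolding mem_P1 by metis
    then show False using assms(3)[OF z] by simp
  qed
  have N: "C_infinity_on S (\<lambda>z. ((2 / (1 - f z \<bullet> g z)) *\<^sub>R null_of_direction (f z),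
      null_of_direction (g z)))"
    unfolding null_of_direction_def
    by (intro smooth_intros assms(1,2) o) (use n in fastforce)
  have sub: "(\<lambda>z. ((2 / (1 - f z \<bullet> g z)) *\<^sub>R null_of_direction (f z), null_of_direction (g z))) ` S
      \<subseteq> {z. snd (snd (fst z)) + snd (snd (snd z)) \<noteq> 0}"
    using c by (simp add: image_subset_iff null_of_direction_def)
  show ?thesis
    using C_infinity_on_compose[OF C_infinity_on_unit_vector_of_null N sub]
    by (simp add: unit_vector_with_ends_def)
qed

section \<open>Stereographic charts of the endpoints\<close>

text \<open>The light-like matrix with \<open>b = \<mu>\<close> and \<open>c = 1\<close> is the one of rank one with image spanned by
  \<open>(\<mu>, 1)\<close>.\<close>

definition stereo_inv :: "complex \<Rightarrow> real^3" where
  "stereo_inv \<mu> = direction ((cmod \<mu>)\<^sup>2, \<mu>, 1)"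

lemma stereo_inv_pos: "(cmod \<mu>)\<^sup>2 + 1 > 0"
  by (simp add: add_nonneg_pos)

lemma C_infinity_on_stereo_inv: "C_infinity_on UNIV stereo_inv"
proof -
  have "C_infinity_on UNIV (\<lambda>\<mu>. ((Re \<mu>)\<^sup>2 + (Im \<mu>)\<^sup>2, \<mu>, 1 :: real))"
    by (intro smooth_intros) auto
  then have "C_infinity_on UNIV (\<lambda>\<mu>. ((cmod \<mu>)\<^sup>2, \<mu>, 1 :: real))"
    by (simp only: cmod_power2)
  then have "C_infinity_on UNIV (\<lambda>\<mu>. direction ((cmod \<mu>)\<^sup>2, \<mu>, 1))"
  proof (rule C_infinity_on_compose[OF C_infinity_on_direction])
    show "range (\<lambda>\<mu>. ((cmod \<mu>)\<^sup>2, \<mu>, 1)) \<subseteq> {n. fst n + snd (snd n) \<noteq> 0}"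
      using stereo_inv_pos by (auto simp: less_imp_neq[THEN not_sym])
  qed
  then show ?thesis by (simp only: stereo_inv_def[abs_def])
qed

lemma stereo_inv_in_P1: "stereo_inv \<mu> \<in> P1"
  unfolding stereo_inv_def
  by (rule direction_in_P1)
    (use stereo_inv_pos[of \<mu>] in \<open>simp add: null_cone_def lorentz_def power2_norm_eq_inner\<close>)

lemma mu_north_eq: "mu_north x = Complex (x $ 1 / (1 - x $ 3)) (x $ 2 / (1 - x $ 3))"
  by (simp add: mu_north_def complex_eq_iff Re_divide_of_real Im_divide_of_real del: of_real_diff)

lemma stereo_inv_height: "1 - stereo_inv \<mu> $ 3 = 2 / ((cmod \<mu>)\<^sup>2 + 1)"
  using stereo_inv_pos[of \<mu>] by (simp add: stereo_inv_def direction_def field_simps)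

lemma stereo_inv_not_north: "1 - stereo_inv \<mu> $ 3 \<noteq> 0"
  unfolding stereo_inv_height using stereo_inv_pos[of \<mu>] by simp

lemma mu_north_stereo_inv: "mu_north (stereo_inv \<mu>) = \<mu>"
  unfolding mu_north_eq stereo_inv_height
  using stereo_inv_pos[of \<mu>] by (simp add: stereo_inv_def direction_def complex_eq_iff)

lemma stereo_inv_mu_north:
  assumes "x \<in> P1" "1 - x $ 3 \<noteq> 0"
  shows "stereo_inv (mu_north x) = x"
proof -
  have "(x $ 1)\<^sup>2 + (x $ 2)\<^sup>2 = (1 + x $ 3) * (1 - x $ 3)"
    using assms(1) unfolding mem_P1 by algebra
  then have "(cmod (mu_north x))\<^sup>2 = (1 + x $ 3) / (1 - x $ 3)"
    using assms(2) unfolding mu_north_eq cmod_power2 complex.sel power_divide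
        add_divide_distrib[symmetric]
    by (simp add: power2_eq_square)
  then have "null_of_direction x = (1 - x $ 3) *\<^sub>R ((cmod (mu_north x))\<^sup>2, mu_north x, 1)"
    using assms(2) by (simp add: null_of_direction_def mu_north_eq complex_eq_iff)
  then have "direction (null_of_direction x) = stereo_inv (mu_north x)"
    by (simp only: direction_scaleR[OF assms(2)] stereo_inv_def)
  then show ?thesis by (simp add: direction_null_of_direction)
qed

text \<open>Conjugates the southern chart into the northern one and thereby halves the work on
  \<^const>\<open>P1_atlas\<close>.\<close>

definition half_turn :: "real^3 \<Rightarrow> real^3" where
  "half_turn x = vector [x $ 1, - x $ 2, - x $ 3]"

lemma half_turn: "half_turn (half_turn x) = x" "half_turn x \<in> P1 \<longleftrightarrow> x \<in> P1"
  "half_turn x $ 3 = - x $ 3"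
  by (simp_all add: half_turn_def vec_eq_iff forall_3 mem_P1)

lemma mu_south_eq: "mu_south x = mu_north (half_turn x)"
  by (simp add: mu_south_def mu_north_def half_turn_def)

lemma P1_north_pole: "x \<in> P1 \<Longrightarrow> x = axis 3 1 \<longleftrightarrow> 1 - x $ 3 = 0"
  unfolding mem_P1 by (auto simp: vec_eq_iff forall_3 axis_def sum_power2_eq_zero_iff)

lemma P1_south_pole:
  assumes "x \<in> P1"
  shows "x = - axis 3 1 \<longleftrightarrow> 1 + x $ 3 = 0"
proof -
  have "x = - axis 3 1 \<longleftrightarrow> - x = axis 3 1" by (metis minus_minus)
  then show ?thesis using P1_north_pole[of "- x"] assms by (simp add: P1_uminus)
qed

text \<open>What the atlas of geodesics needs of either chart of the sphere: it extends smoothly to an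
  open subset of the ambient space, and it has a globally defined smooth inverse.\<close>

lemma P1_chart_inverse:
  assumes "(V, f) \<in> P1_atlas"
  obtains g D where "C_infinity_on UNIV g" "C_infinity_on D f" "V = P1 \<inter> D"
    "\<And>\<mu>. g \<mu> \<in> V" "\<And>\<mu>. f (g \<mu>) = \<mu>" "\<And>x. x \<in> V \<Longrightarrow> g (f x) = x"
proof -
  let ?N = "{x :: real^3. 1 - x $ 3 \<noteq> 0}" and ?S = "{x :: real^3. 1 + x $ 3 \<noteq> 0}"
  have o: "open ?N" "open ?S" by (intro open_Collect_neq continuous_intros)+
  have north: "C_infinity_on ?N mu_north"
    unfolding mu_north_eq[abs_def] using o(1) by (intro smooth_intros) simp_all
  have turn: "C_infinity_on T (\<lambda>x. half_turn (h x))" if "C_infinity_on T h"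
      for T :: "'z::real_normed_vector set" and h
    unfolding half_turn_def by (intro smooth_intros that)
  consider "V = P1 - {north}" "f = mu_north" | "V = P1 - {- north}" "f = mu_south"
    using assms by (auto simp: P1_atlas_def)
  then show thesis
  proof cases
    case 1
    have V: "V = P1 \<inter> ?N" using P1_north_pole by (auto simp: 1 north_def)
    show thesis
    proof (rule that[of stereo_inv ?N])
      show "stereo_inv \<mu> \<in> V" for \<mu>
        using stereo_inv_in_P1[of \<mu>] stereo_inv_not_north[of \<mu>] by (simp add: V)
    qed (use V north in \<open>simp_all add: C_infinity_on_stereo_inv 1(2) mu_north_stereo_inv
        stereo_inv_mu_north\<close>)
  next
    case 2
    have V: "V = P1 \<inter> ?S" using P1_south_pole by (auto simp: 2 north_def)
    show thesis
    proof (rule that[of "\<lambda>\<mu>. half_turn (stereo_inv \<mu>)" ?S])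
      show "C_infinity_on UNIV (\<lambda>\<mu>. half_turn (stereo_inv \<mu>))"
        by (rule turn[OF C_infinity_on_stereo_inv])
      have "C_infinity_on ?S (\<lambda>x. mu_north (half_turn x))"
        by (rule C_infinity_on_compose[OF north turn])
          (use o(2) in \<open>auto simp: half_turn intro: smooth_intros\<close>)
      then show "C_infinity_on ?S f" by (simp add: 2 mu_south_eq[abs_def])
      show "half_turn (stereo_inv \<mu>) \<in> V" for \<mu>
        using stereo_inv_in_P1[of \<mu>] stereo_inv_not_north[of \<mu>] by (simp add: V half_turn)
      show "f (half_turn (stereo_inv \<mu>)) = \<mu>" for \<mu>
        by (simp add: 2 mu_south_eq half_turn mu_north_stereo_inv)
      show "half_turn (stereo_inv (f x)) = x" if "x \<in> V" for x
        using that stereo_inv_mu_north[of "half_turn x"] by (simp add: 2(2) mu_south_eq V half_turn)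
    qed (rule V)
  qed
qed

text \<open>The chart of the product of spheres pulled back along \<^const>\<open>geodesic_ends\<close>.\<close>

definition end_chart :: "((real^3) \<times> (real^3)) chart \<Rightarrow> geodesic chart" where
  "end_chart d = ({l \<in> oriented_geodesics. geodesic_ends l \<in> fst d}, snd d \<circ> geodesic_ends)"

text \<open>Lifted to the unit tangent bundle, the chart is a composition of rational maps; composing
  the inverse stereographic charts with \<^const>\<open>unit_vector_with_ends\<close> gives one smooth section over the
  whole image.\<close>

lemma end_chart_in_atlas:
  assumes "d \<in> P1xP1_minus_atlas"
  shows "end_chart d \<in> geodesic_atlas"
proof -
  obtain V f V' f' where d: "d = ((V \<times> V') \<inter> P1xP1_minus, map_prod f f')"
    and Vf: "(V, f) \<in> P1_atlas" and Vf': "(V', f') \<in> P1_atlas"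
    using assms unfolding P1xP1_minus_atlas_def by blast
  obtain g D where g: "C_infinity_on UNIV g" "C_infinity_on D f" "V = P1 \<inter> D"
    "\<And>\<mu>. g \<mu> \<in> V" "\<And>\<mu>. f (g \<mu>) = \<mu>" "\<And>x. x \<in> V \<Longrightarrow> g (f x) = x"
    by (rule P1_chart_inverse[OF Vf]) (rule that; (assumption | simp))
  obtain g' D' where g': "C_infinity_on UNIV g'" "C_infinity_on D' f'" "V' = P1 \<inter> D'"
    "\<And>\<mu>. g' \<mu> \<in> V'" "\<And>\<mu>. f' (g' \<mu>) = \<mu>" "\<And>x. x \<in> V' \<Longrightarrow> g' (f' x) = x"
    by (rule P1_chart_inverse[OF Vf']) (rule that; (assumption | simp))
  define W where "W = {l \<in> oriented_geodesics. geodesic_ends l \<in> fst d}"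
  define \<phi> where "\<phi> = snd d \<circ> geodesic_ends"
  define R where "R = {y. - g (fst y) \<noteq> g' (snd y)}"
  define \<sigma> where "\<sigma> y = unit_vector_with_ends (- g (fst y), g' (snd y))" for y
  define U where "U = {u \<in> unit_tangent_bundle. geodesic_through u \<in> W}"
  define N where "N = {u \<in> ends_domain. - forward_end u \<in> D \<and> backward_end u \<in> D'}"
  have gP: "g \<mu> \<in> P1" "g' \<mu> \<in> P1" for \<mu> using g(3,4) g'(3,4) by auto
  have \<sigma>: "\<sigma> y \<in> unit_tangent_bundle" "geodesic_ends (geodesic_through (\<sigma> y)) = (g (fst y),
      g' (snd y))"
    if "y \<in> R" for y
    using that gP[of "fst y"] gP[of "snd y"] unit_vector_with_ends[of "- g (fst y)" "g' (snd y)"]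
      geodesic_ends_section[of "g (fst y)" "g' (snd y)"]
    by (auto simp: \<sigma>_def R_def P1_uminus mem_P1xP1_minus)
  have \<sigma>W: "geodesic_through (\<sigma> y) \<in> W" "\<phi> (geodesic_through (\<sigma> y)) = y" if "y \<in> R" for y
    using \<sigma>[OF that] that g(4) g'(4) gP g(5) g'(5)
    by (auto simp: W_def \<phi>_def d oriented_geodesics_eq mem_P1xP1_minus R_def)
  have inj: "inj_on \<phi> W"
  proof
    fix l l' assume l: "l \<in> W" "l' \<in> W" "\<phi> l = \<phi> l'"
    have inv: "map_prod g g' (\<phi> l) = geodesic_ends l" if "l \<in> W" for l
      using that g(6) g'(6) by (cases "geodesic_ends l") (simp add: W_def \<phi>_def d)
    have "geodesic_ends l = geodesic_ends l'"
      using inv[OF l(1)] inv[OF l(2)] l(3) by simp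
    then show "l = l'"
      using l(1,2) inj_onD[OF bij_betw_imp_inj_on[OF geodesic_ends_bij],
          of l l'] by (simp add: W_def)
  qed
  have image: "\<phi> ` W = R"
  proof (intro equalityI subsetI)
    fix y assume "y \<in> \<phi> ` W"
    then obtain l where "l \<in> W" "y = \<phi> l" by blast
    moreover obtain x x' where "geodesic_ends l = (x, x')" by fastforce
    ultimately have "(x, x') \<in> fst d" "y = (f x, f' x')" by (simp_all add: W_def \<phi>_def d)
    then show "y \<in> R" using g(6) g'(6) by (auto simp: d R_def mem_P1xP1_minus)
  next
    fix y assume "y \<in> R"
    then show "y \<in> \<phi> ` W" using \<sigma>W[of y]
      by (intro image_eqI[of y \<phi> "geodesic_through (\<sigma> y)"]) simp_all
  qed
  have gsm: "C_infinity_on UNIV (\<lambda>y :: complex \<times> complex. - g (fst y))"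
    "C_infinity_on UNIV (\<lambda>y :: complex \<times> complex. g' (snd y))"
    by (intro smooth_intros C_infinity_on_compose[OF g(1)] C_infinity_on_compose[OF g'(1)]; simp)+
  have "open R"
    unfolding R_def by (intro open_Collect_neq C_infinity_on_imp_continuous gsm)
  then have "C_infinity_on R \<sigma>"
    unfolding \<sigma>_def
    by (intro unit_vector_with_ends_smooth C_infinity_on_subset[OF gsm(1)] C_infinity_on_subset[OF
        gsm(2)])
      (auto simp: P1_uminus gP R_def)
  then have \<sigma>sm: "smooth_on R \<sigma>" by (rule C_infinity_on_imp_smooth_on)
  have N_eq: "N = {u \<in> ends_domain. - forward_end u \<in> D} \<inter> {u \<in> ends_domain. backward_end u \<in> D'}"
    by (auto simp: N_def)
  have m: "C_infinity_on ends_domain (\<lambda>u. - forward_end u)"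
    by (intro smooth_intros C_infinity_on_ends)
  have "open {u \<in> ends_domain. - forward_end u \<in> D}"
    by (rule C_infinity_on_open_preimage[OF m C_infinity_on_open[OF g(2)]])
  moreover have "open {u \<in> ends_domain. backward_end u \<in> D'}"
    by (rule C_infinity_on_open_preimage[OF C_infinity_on_ends(2) C_infinity_on_open[OF g'(2)]])
  ultimately have N: "open N" unfolding N_eq by (rule open_Int)
  \<comment> \<open>The lifted domain is cut out by the two sphere charts alone: the reflected diagonal is never
      met.\<close>
  have U: "U = unit_tangent_bundle \<inter> N"
    using unit_tangent_bundle_subset_ends_domain ends_in_P1 ends_distinct
    by (auto simp: U_def W_def N_def d geodesic_ends_through oriented_geodesics_eq mem_P1xP1_minus
        g(3) g'(3) P1_uminus)
  have "C_infinity_on N (\<lambda>u. (f (- forward_end u), f' (backward_end u)))"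
  proof (rule C_infinity_on_Pair)
    show "C_infinity_on N (\<lambda>u. f (- forward_end u))"
      by (rule C_infinity_on_compose[OF g(2) C_infinity_on_subset[OF m _ N]]) (auto simp: N_def)
    show "C_infinity_on N (\<lambda>u. f' (backward_end u))"
      by (rule C_infinity_on_compose[OF g'(2) C_infinity_on_subset[OF C_infinity_on_ends(2) _ N]])
        (auto simp: N_def)
  qed
  then have "\<forall>k. Ck_on k (\<lambda>u. (f (- forward_end u), f' (backward_end u))) N"
    by (simp add: C_infinity_on_def)
  moreover have eq: "(\<phi> \<circ> geodesic_through) u = (f (- forward_end u), f' (backward_end u))"
      if "u \<in> U" for u
    using that by (simp add: U_def \<phi>_def d geodesic_ends_through)
  ultimately have sm: "smooth_on U (\<phi> \<circ> geodesic_through)"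
    unfolding smooth_on_def
    by (intro ballI exI[of _ N] exI[of _ "\<lambda>u. (f (- forward_end u), f' (backward_end u))"] conjI N)
      (use U in auto)
  have sec: "\<exists>N \<tau>. open N \<and> y \<in> N \<and> N \<subseteq> \<phi> ` W \<and> smooth_on N \<tau> \<and>
      (\<forall>y'\<in>N. \<tau> y' \<in> unit_tangent_bundle \<and> geodesic_through (\<tau> y') = chart_inv (W, \<phi>) y')"
    if "y \<in> \<phi> ` W" for y
  proof (intro exI[of _ R] exI[of _ \<sigma>] conjI ballI)
    fix y' assume "y' \<in> R"
    then show "\<sigma> y' \<in> unit_tangent_bundle" "geodesic_through (\<sigma> y') = chart_inv (W, \<phi>) y'"
      using \<sigma>(1)[of y'] \<sigma>W[of y'] chart_inv_apply[of "(W, \<phi>)"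
          "geodesic_through (\<sigma> y')"] inj by simp_all
  qed (use that image \<open>open R\<close> \<sigma>sm in simp_all)
  have opU: "openin (top_of_set unit_tangent_bundle) U"
    using U N by (auto simp: openin_open)
  have W: "W \<subseteq> oriented_geodesics" by (auto simp: W_def)
  have oW: "open (\<phi> ` W)" using image \<open>open R\<close> by simp
  have "(W, \<phi>) \<in> geodesic_atlas"
    unfolding geodesic_atlas_def mem_Collect_eq prod.case
    by (intro conjI ballI W inj oW opU[unfolded U_def] sm[unfolded U_def] sec)
  then show ?thesis by (simp add: end_chart_def W_def \<phi>_def)
qed

section \<open>The atlas of the space of geodesics\<close>

lemma smooth_on_imp_C_infinity_on:
  assumes "open N" "smooth_on N f"
  shows "C_infinity_on N f"
proof (rule C_infinity_on_local)
  fix x assume x: "x \<in> N"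
  obtain N' g where N': "open N'" "x \<in> N'" "\<forall>k. Ck_on k g N'" "\<forall>y\<in>N \<inter> N'. g y = f y"
    using assms(2) x unfolding smooth_on_def by blast
  have "C_infinity_on N' g" using N' by (simp add: C_infinity_on_def)
  then have "C_infinity_on (N \<inter> N') g"
    by (rule C_infinity_on_subset) (use N' assms(1) in auto)
  then have "C_infinity_on (N \<inter> N') f"
    by (rule C_infinity_on_cong) (use N' in auto)
  then show "\<exists>M. x \<in> M \<and> M \<subseteq> N \<and> C_infinity_on M f"
    using x N' by (intro exI[of _ "N \<inter> N'"]) auto
qed

lemma geodesic_atlasD:
  assumes "c \<in> geodesic_atlas"
  shows "fst c \<subseteq> oriented_geodesics" "inj_on (snd c) (fst c)" "open (snd c ` fst c)"
    "openin (top_of_set unit_tangent_bundle) {u \<in> unit_tangent_bundle. geodesic_through u \<in> fst c}"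
    "smooth_on {u \<in> unit_tangent_bundle. geodesic_through u \<in> fst c} (snd c \<circ> geodesic_through)"
    "y \<in> snd c ` fst c \<Longrightarrow> \<exists>N \<sigma>. open N \<and> y \<in> N \<and> N \<subseteq> snd c ` fst c \<and> smooth_on N \<sigma> \<and>
           (\<forall>y'\<in>N. \<sigma> y' \<in> unit_tangent_bundle \<and> geodesic_through (\<sigma> y') = chart_inv c y')"
  using assms unfolding geodesic_atlas_def by auto

text \<open>A transition is locally \<open>(d \<circ> geodesic_through) \<circ> \<sigma>\<close> for a smooth section \<open>\<sigma>\<close> of \<open>c\<close>. As \<open>d
  \<circ> geodesic_through\<close> is only the restriction of a smooth map to the unit tangent bundle, \<open>\<sigma>\<close> has
  to be shrunk until it stays in the domain of an extension.\<close>

lemma geodesic_atlas_smooth: "smooth_atlas geodesic_atlas"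
  unfolding smooth_atlas_def
proof (intro conjI ballI)
  fix c d assume c: "c \<in> geodesic_atlas" and d: "d \<in> geodesic_atlas"
  show "C_infinity_on (snd c ` (fst c \<inter> fst d)) (transition c d)"
  proof (rule C_infinity_on_local)
    fix y assume "y \<in> snd c ` (fst c \<inter> fst d)"
    then obtain p where p: "p \<in> fst c" "p \<in> fst d" "y = snd c p" by blast
    then have "y \<in> snd c ` fst c" by blast
    from geodesic_atlasD(6)[OF c this] obtain N \<sigma> where N: "open N" "y \<in> N" "N \<subseteq> snd c ` fst c"
      and "smooth_on N \<sigma>"
      and \<sigma>: "\<And>y'. y' \<in> N \<Longrightarrow> \<sigma> y' \<in> unit_tangent_bundle"
        "\<And>y'. y' \<in> N \<Longrightarrow> geodesic_through (\<sigma> y') = chart_inv c y'"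
      by blast
    then have s: "C_infinity_on N \<sigma>" by (intro smooth_on_imp_C_infinity_on)
    have inv: "chart_inv c (snd c q) = q" if "q \<in> fst c" for q
      using chart_inv_apply[OF geodesic_atlasD(2)[OF c] that] .
    let ?U = "{u \<in> unit_tangent_bundle. geodesic_through u \<in> fst d}"
    have "\<sigma> y \<in> ?U"
      using \<sigma>[OF N(2)] p inv[OF p(1)] by simp
    then obtain N2 g where N2: "open N2" "\<sigma> y \<in> N2" "\<forall>k. Ck_on k g N2"
        "\<forall>u\<in>?U \<inter> N2. g u = (snd d \<circ> geodesic_through) u"
      using geodesic_atlasD(5)[OF d] unfolding smooth_on_def by blast
    obtain N1 where N1: "open N1" "?U = unit_tangent_bundle \<inter> N1"
      using geodesic_atlasD(4)[OF d] by (auto simp: openin_open)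
    \<comment> \<open>\<open>N1\<close> keeps the section over the domain of \<open>d\<close>, and \<open>N2\<close> inside the domain of the extension
        \<open>g\<close>.\<close>
    define M where "M = {y' \<in> N. \<sigma> y' \<in> N1 \<inter> N2}"
    have M: "open M" "y \<in> M" "M \<subseteq> N"
      unfolding M_def using C_infinity_on_open_preimage[OF s open_Int[OF N1(1) N2(1)]] N(2) N2(2)
          N1(2)
        \<open>\<sigma> y \<in> ?U\<close> by auto
    have MU: "\<sigma> y' \<in> ?U \<inter> N2" if "y' \<in> M" for y'
    proof -
      have "\<sigma> y' \<in> unit_tangent_bundle \<inter> N1" using that \<sigma>(1) by (simp add: M_def)
      then show ?thesis using N1(2) that by (simp add: M_def)
    qed
    have "M \<subseteq> snd c ` (fst c \<inter> fst d)"
    proof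
      fix y' assume y': "y' \<in> M"
      then obtain q where q: "q \<in> fst c" "y' = snd c q" using M(3) N(3) by blast
      have "q \<in> fst d" using MU[OF y'] \<sigma>(2)[of y'] y' M(3) inv[OF q(1)] q(2) by auto
      then show "y' \<in> snd c ` (fst c \<inter> fst d)" using q by blast
    qed
    moreover have "C_infinity_on M (\<lambda>y. g (\<sigma> y))"
    proof (rule C_infinity_on_compose[of N2 g M \<sigma>])
      show "C_infinity_on N2 g" using N2 by (simp add: C_infinity_on_def)
      show "C_infinity_on M \<sigma>" using C_infinity_on_subset[OF s M(3,1)] .
      show "\<sigma> ` M \<subseteq> N2" using MU by blast
    qed
    then have "C_infinity_on M (transition c d)"
    proof (rule C_infinity_on_cong[where g = "transition c d"])
      fix y' assume "y' \<in> M"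
      then show "g (\<sigma> y') = transition c d y'"
        using N2(4) MU[of y'] \<sigma>(2)[of y'] M(3) by auto
    qed
    ultimately show "\<exists>M. y \<in> M \<and> M \<subseteq> snd c ` (fst c \<inter> fst d) \<and> C_infinity_on M (transition c d)"
      using M(2) by blast
  qed
qed (rule geodesic_atlasD(2))

lemma geodesic_atlas_change_coordinates:
  assumes c: "c \<in> geodesic_atlas"
    and h: "C_infinity_on (snd c ` fst c) h" and k: "C_infinity_on (\<phi> ` fst c) k"
    and hk: "\<And>p. p \<in> fst c \<Longrightarrow> h (snd c p) = \<phi> p" "\<And>p. p \<in> fst c \<Longrightarrow> k (\<phi> p) = snd c p"
  shows "(fst c, \<phi>) \<in> geodesic_atlas"
proof -
  note D = geodesic_atlasD[OF c]
  let ?U = "{u \<in> unit_tangent_bundle. geodesic_through u \<in> fst c}"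
  have inj: "inj_on \<phi> (fst c)"
    by (rule inj_onI) (metis hk(2) D(2) inj_onD)
  have inv: "chart_inv (fst c, \<phi>) (\<phi> p) = p" "chart_inv c (snd c p) = p" if "p \<in> fst c" for p
    using chart_inv_apply[of "(fst c, \<phi>)" p] chart_inv_apply[OF D(2)] inj that by simp_all
  have "smooth_on ?U (\<phi> \<circ> geodesic_through)"
    unfolding smooth_on_def
  proof
    fix u assume u: "u \<in> ?U"
    then obtain N g where N: "open N" "u \<in> N" "\<forall>k. Ck_on k g N"
        "\<forall>u\<in>?U \<inter> N. g u = (snd c \<circ> geodesic_through) u"
      using D(5) unfolding smooth_on_def by blast
    then have g: "C_infinity_on N g" by (simp add: C_infinity_on_def)
    let ?N = "{x \<in> N. g x \<in> snd c ` fst c}"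
    have o: "open ?N" by (rule C_infinity_on_open_preimage[OF g D(3)])
    have gu: "g u' = snd c (geodesic_through u')" if "u' \<in> ?U" "u' \<in> N" for u'
      using N(4) that by simp
    have "C_infinity_on ?N (\<lambda>x. h (g x))"
      by (rule C_infinity_on_compose[OF h C_infinity_on_subset[OF g _ o]]) auto
    moreover have "\<forall>u'\<in>?U \<inter> ?N. h (g u') = (\<phi> \<circ> geodesic_through) u'"
      using gu hk(1) by auto
    moreover have "u \<in> ?N" using gu[of u] u N(2) by auto
    ultimately show "\<exists>N g. open N \<and> u \<in> N \<and> (\<forall>k. Ck_on k g N) \<and>
        (\<forall>y\<in>?U \<inter> N. g y = (\<phi> \<circ> geodesic_through) y)"
      unfolding C_infinity_on_def by blast
  qed
  moreover have "\<exists>N \<sigma>. open N \<and> y \<in> N \<and> N \<subseteq> \<phi> ` fst c \<and> smooth_on N \<sigma> \<and>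
      (\<forall>y'\<in>N. \<sigma> y' \<in> unit_tangent_bundle \<and> geodesic_through (\<sigma> y') = chart_inv (fst c, \<phi>) y')"
    if "y \<in> \<phi> ` fst c" for y
  proof -
    obtain p where p: "p \<in> fst c" "y = \<phi> p" using \<open>y \<in> \<phi> ` fst c\<close> by blast
    then have "k y \<in> snd c ` fst c" using hk(2) by auto
    from D(6)[OF this] obtain N \<sigma> where N: "open N" "k y \<in> N" "N \<subseteq> snd c ` fst c"
      and "smooth_on N \<sigma>"
      and \<sigma>: "\<And>y'. y' \<in> N \<Longrightarrow> \<sigma> y' \<in> unit_tangent_bundle"
        "\<And>y'. y' \<in> N \<Longrightarrow> geodesic_through (\<sigma> y') = chart_inv c y'"
      by blast
    then have s: "C_infinity_on N \<sigma>" by (intro smooth_on_imp_C_infinity_on)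
    let ?N = "{z \<in> \<phi> ` fst c. k z \<in> N}"
    have o: "open ?N" by (rule C_infinity_on_open_preimage[OF k N(1)])
    have "C_infinity_on ?N (\<lambda>z. \<sigma> (k z))"
      by (rule C_infinity_on_compose[OF s C_infinity_on_subset[OF k _ o]]) auto
    then have "smooth_on ?N (\<lambda>z. \<sigma> (k z))" by (rule C_infinity_on_imp_smooth_on)
    moreover have "\<sigma> (k z) \<in> unit_tangent_bundle \<and> geodesic_through (\<sigma> (k z)) = chart_inv (fst c,
        \<phi>) z"
      if "z \<in> ?N" for z
    proof -
      obtain q where q: "q \<in> fst c" "z = \<phi> q" using \<open>z \<in> ?N\<close> by blast
      have "k z \<in> N" using \<open>z \<in> ?N\<close> by blast
      then show ?thesis using \<sigma>[of "k z"] hk(2)[OF q(1)] inv[OF q(1)] q(2) by simp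
    qed
    moreover have "y \<in> ?N" using N(2) p by blast
    ultimately show ?thesis
      using o by (intro exI[of _ ?N] exI[of _ "\<lambda>z. \<sigma> (k z)"]) auto
  qed
  ultimately show ?thesis
    unfolding geodesic_atlas_def using inj D(1,4) C_infinity_on_open[OF k] by simp
qed

text \<open>Between the two poles the product of the stereographic coordinates is one, so a transition
  is either the identity or the inverse.\<close>

lemma P1_transition_holomorphic:
  assumes "(V, f) \<in> P1_atlas" "(V', f') \<in> P1_atlas" "x \<in> V" "x \<in> V'"
  obtains h h' where "(h has_field_derivative h') (at (f x))"
    "\<And>y. y \<in> V \<Longrightarrow> y \<in> V' \<Longrightarrow> f' y = h (f y)"
proof -
  have prod: "mu_north y * mu_south y = 1" if "y \<in> P1" "y \<noteq> north" "y \<noteq> - north" for y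
  proof -
    have nz: "1 - y $ 3 \<noteq> 0" "1 + y $ 3 \<noteq> 0"
      using that P1_north_pole P1_south_pole by (auto simp: north_def)
    have "Complex (y $ 1) (y $ 2) * Complex (y $ 1) (- (y $ 2)) =
        of_real ((1 - y $ 3) * (1 + y $ 3))"
      using that(1) unfolding mem_P1 by (simp add: complex_eq_iff) algebra
    then show ?thesis
      using nz unfolding mu_north_def mu_south_def times_divide_times_eq
      by (simp del: of_real_diff of_real_add flip: of_real_mult)
  qed
  consider "V = V'" "f = f'" | "{(V, f), (V', f')} = {(P1 - {north}, mu_north), (P1 - {- north},
      mu_south)}"
    using assms(1,2) unfolding P1_atlas_def by blast
  then show thesis
  proof cases
    case 1
    then show thesis using that[of "\<lambda>z. z" 1] by auto
  next
    case 2
    then have P: "f y * f' y = 1" if "y \<in> V" "y \<in> V'" for y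
      using that prod[of y] by (auto simp: doubleton_eq_iff mult.commute)
    show thesis
    proof (rule that)
      have "f x \<noteq> 0" using P[OF assms(3,4)] by auto
      then show "(inverse has_field_derivative - (inverse (f x) ^ Suc (Suc 0))) (at (f x))"
        by (rule DERIV_inverse)
      show "f' y = inverse (f y)" if "y \<in> V" "y \<in> V'" for y
        using P[OF that] by (metis inverse_unique)
    qed
  qed
qed

lemma end_chart_transitions_holomorphic:
  assumes "d \<in> P1xP1_minus_atlas" "d' \<in> P1xP1_minus_atlas"
  defines "e \<equiv> end_chart d" and "e' \<equiv> end_chart d'"
  shows "holomorphic2_on (snd e ` (fst e \<inter> fst e')) (transition e e')"
  unfolding holomorphic2_on_def
proof
  have eA: "e \<in> geodesic_atlas" "e' \<in> geodesic_atlas"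
    using end_chart_in_atlas assms by simp_all
  fix z assume z: "z \<in> snd e ` (fst e \<inter> fst e')"
  then obtain p where p: "p \<in> fst e" "p \<in> fst e'" "z = snd e p" by blast
  obtain V1 f1 V2 f2 where d: "d = ((V1 \<times> V2) \<inter> P1xP1_minus, map_prod f1 f2)"
    and V: "(V1, f1) \<in> P1_atlas" "(V2, f2) \<in> P1_atlas"
    using assms(1) unfolding P1xP1_minus_atlas_def by blast
  obtain W1 g1 W2 g2 where d': "d' = ((W1 \<times> W2) \<inter> P1xP1_minus, map_prod g1 g2)"
    and W: "(W1, g1) \<in> P1_atlas" "(W2, g2) \<in> P1_atlas"
    using assms(2) unfolding P1xP1_minus_atlas_def by blast
  obtain x1 x2 where x: "geodesic_ends p = (x1, x2)" by fastforce
  have xV: "x1 \<in> V1" "x1 \<in> W1" "x2 \<in> V2" "x2 \<in> W2"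
    using p x by (auto simp: e_def e'_def end_chart_def d d')
  obtain h1 h1' where h1: "(h1 has_field_derivative h1') (at (f1 x1))"
    "\<And>y. y \<in> V1 \<Longrightarrow> y \<in> W1 \<Longrightarrow> g1 y = h1 (f1 y)"
    using P1_transition_holomorphic[OF V(1) W(1) xV(1,2)] by metis
  obtain h2 h2' where h2: "(h2 has_field_derivative h2') (at (f2 x2))"
    "\<And>y. y \<in> V2 \<Longrightarrow> y \<in> W2 \<Longrightarrow> g2 y = h2 (f2 y)"
    using P1_transition_holomorphic[OF V(2) W(2) xV(3,4)] by metis
  have zx: "fst z = f1 x1" "snd z = f2 x2" using p(3) x by (simp_all add: e_def end_chart_def d)
  have "((\<lambda>y. (h1 (fst y), h2 (snd y))) has_derivative (\<lambda>v. (h1' * fst v, h2' * snd v))) (at z)"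
    using h1(1) h2(1) unfolding has_field_derivative_def zx[symmetric]
    by (intro has_derivative_Pair)
      (auto intro: has_derivative_compose[where g = h1] has_derivative_compose[where g = h2]
        bounded_linear.has_derivative[OF bounded_linear_fst has_derivative_ident]
        bounded_linear.has_derivative[OF bounded_linear_snd has_derivative_ident])
  then have "(transition e e' has_derivative (\<lambda>v. (h1' * fst v, h2' * snd v))) (at z)"
  proof (rule has_derivative_transform_within_open[OF _ smooth_atlasD(4)[OF geodesic_atlas_smooth
      eA] z])
    fix y assume "y \<in> snd e ` (fst e \<inter> fst e')"
    then obtain q where q: "q \<in> fst e" "q \<in> fst e'" "y = snd e q" by blast
    obtain y1 y2 where y: "geodesic_ends q = (y1, y2)" by fastforce
    have "y1 \<in> V1" "y1 \<in> W1" "y2 \<in> V2" "y2 \<in> W2"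
      using q y by (auto simp: e_def e'_def end_chart_def d d')
    then have "(h1 (f1 y1), h2 (f2 y2)) = snd e' q"
      using h1(2) h2(2) y by (simp add: e'_def end_chart_def d')
    moreover have "y = (f1 y1, f2 y2)" using q(3) y by (simp add: e_def end_chart_def d)
    ultimately show "(h1 (fst y), h2 (snd y)) = transition e e' y"
      using smooth_atlasD(2)[OF geodesic_atlas_smooth eA(1) q(1)] q(3) by simp
  qed
  then show "\<exists>D. (transition e e' has_derivative D) (at z) \<and> (\<forall>v. D (mult_ii v) = mult_ii (D v))"
    by (intro exI conjI) (assumption, simp add: mult_ii_def mult.left_commute)
qed

section \<open>The coordinates on the non-vertical geodesics\<close>

text \<open>The light-like vector over the boundary point with affine coordinate \<open>z\<close>.\<close>

definition hermitian_of_complex :: "complex \<Rightarrow> hermitian" where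
  "hermitian_of_complex z = ((cmod z)\<^sup>2, z, 1)"

lemma hermitian_of_complex: "hermitian_of_complex z \<in> null_cone"
    "direction (hermitian_of_complex z) = stereo_inv z"
  "lorentz (hermitian_of_complex z) (hermitian_of_complex w) = (cmod (z - w))\<^sup>2"
proof -
  show "hermitian_of_complex z \<in> null_cone"
    using stereo_inv_pos[of z] by (simp add: null_cone_def lorentz_def hermitian_of_complex_def
        power2_norm_eq_inner)
  show "lorentz (hermitian_of_complex z) (hermitian_of_complex w) = (cmod (z - w))\<^sup>2"
    by (simp add: lorentz_def hermitian_of_complex_def power2_norm_eq_inner inner_diff_left
        inner_diff_right inner_commute)
qed (simp add: hermitian_of_complex_def stereo_inv_def)

text \<open>The parametrisation \<^const>\<open>Phi\<close> is the orbit of the flow with the boundary points \<open>\<eta> \<plusminus> 1 / cnj \<xi>\<close>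
  as ends, and \<open>r = 0\<close> is its highest point: there the two light-like vectors have the same entry
  \<open>c\<close>.\<close>

lemma coord_geodesic_ends:
  assumes "\<xi> \<noteq> 0"
  shows "coord_geodesic (\<xi>, \<eta>) \<in> oriented_geodesics"
    "geodesic_ends (coord_geodesic (\<xi>, \<eta>)) = (- stereo_inv (\<eta> + 1 / cnj \<xi>),
        stereo_inv (\<eta> - 1 / cnj \<xi>))"
proof -
  define m where "m = cmod \<xi> *\<^sub>R hermitian_of_complex (\<eta> + 1 / cnj \<xi>)"
  define n where "n = cmod \<xi> *\<^sub>R hermitian_of_complex (\<eta> - 1 / cnj \<xi>)"
  have mn: "m \<in> null_cone" "n \<in> null_cone"
    using assms by (simp_all add: m_def n_def null_cone_scaleR hermitian_of_complex)
  \<comment> \<open>The factor \<open>cmod \<xi>\<close> normalises the pairing, as the ends have distance \<open>2 / cmod \<xi>\<close>.\<close>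
  have "\<eta> + 1 / cnj \<xi> - (\<eta> - 1 / cnj \<xi>) = 2 / cnj \<xi>" by simp
  then have "lorentz m n = (cmod \<xi>)\<^sup>2 * (cmod (2 / cnj \<xi>))\<^sup>2"
    by (simp only: m_def n_def lorentz_simps hermitian_of_complex power2_eq_square mult.assoc)
  also have "\<dots> = 4" using assms by (simp add: norm_divide power_divide)
  finally have l: "lorentz m n = 4" .
  note c = null_curve[OF mn l] and g = null_curve_geodesic[OF mn l]
  have "Phi (\<xi>, \<eta>) r = fst (null_curve m n r)" for r
  proof -
    define w where "w = 1 / cnj \<xi>"
    have B: "(1/2::real) *\<^sub>R (exp r *\<^sub>R (k *\<^sub>R (\<eta> + w)) + exp (- r) *\<^sub>R (k *\<^sub>R (\<eta> - w))) =
        k *\<^sub>R (cosh r *\<^sub>R \<eta> + sinh r *\<^sub>R w)" for k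
      unfolding cosh_field_def sinh_field_def complex_eq_iff by (simp add: field_simps)
    have C: "(1/2) * (exp r * k + exp (- r) * k) = k * cosh r" for k :: real
      unfolding cosh_field_def by (simp add: field_simps)
    have X: "snd ((1/2::real) *\<^sub>R (exp r *\<^sub>R m + exp (- r) *\<^sub>R n)) =
        (cmod \<xi> *\<^sub>R (cosh r *\<^sub>R \<eta> + sinh r *\<^sub>R w), cmod \<xi> * cosh r)"
      unfolding m_def n_def hermitian_of_complex_def w_def[symmetric] scaleR_Pair snd_conv add_Pair
          B
        real_scaleR_def mult_1_right C ..
    have T: "of_real (tanh r) / cnj \<xi> = (sinh r / cosh r) *\<^sub>R w"
      by (simp add: tanh_def scaleR_conv_of_real w_def)
    show ?thesis
      unfolding null_curve_def unit_vector_of_null_def half_space_point_def case_prod_unfold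
          fst_conv X snd_conv
        Phi_def Let_def T
      using assms by (simp add: vec_eq_iff forall_3 field_simps)
  qed
  then have P: "Phi (\<xi>, \<eta>) = (\<lambda>r. fst (null_curve m n r))" by blast
  have "coord_geodesic (\<xi>, \<eta>) = range (null_curve m n)"
    unfolding coord_geodesic_def P g(2) by simp
  also have "\<dots> = geodesic_through (null_curve m n 0)"
    using geodesic_through_eq_null_curve[OF c(1)[of 0]] c(2,3)[of 0] by simp
  finally have cg: "coord_geodesic (\<xi>, \<eta>) = geodesic_through (null_curve m n 0)" .
  show "coord_geodesic (\<xi>, \<eta>) \<in> oriented_geodesics"
    unfolding cg oriented_geodesics_eq using c(1) by blast
  show "geodesic_ends (coord_geodesic (\<xi>, \<eta>)) = (- stereo_inv (\<eta> + 1 / cnj \<xi>),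
      stereo_inv (\<eta> - 1 / cnj \<xi>))"
    unfolding cg geodesic_ends_through[OF c(1)] null_curve_ends[OF mn l] using assms
    by (simp add: m_def n_def direction_scaleR hermitian_of_complex)
qed

text \<open>The point \<open>\<infinity>\<close> of the boundary is the north pole. An end lies there iff the entry \<open>c\<close> of its
  light-like vector vanishes, that is iff \<open>v $ 1 = \<plusminus> p $ 1\<close>, and then a unit vector has no
  horizontal part.\<close>

lemma vertical_vector_iff:
  assumes "(p, v) \<in> unit_tangent_bundle"
  shows "v \<in> span {axis 1 1} \<longleftrightarrow> forward_end (p, v) = north \<or> backward_end (p, v) = north"
proof -
  have t: "p $ 1 \<noteq> 0" and v: "(v $ 1)\<^sup>2 + ((v $ 2)\<^sup>2 + (v $ 3)\<^sup>2) = (p $ 1)\<^sup>2"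
    using assms by (auto simp: mem_unit_tangent_bundle inner_vec_def sum_3 power2_eq_square)
  have N: "direction n = north \<longleftrightarrow> snd (snd n) = 0" if n: "n \<in> null_cone" for n
  proof -
    obtain a b c where abc: "n = (a, b, c)" by (metis prod.collapse)
    have "a + c \<noteq> 0" using n by (auto simp: null_cone_def abc)
    then have "1 - direction n $ 3 = 2 * c / (a + c)"
      by (simp add: direction_def abc field_simps)
    then show ?thesis
      unfolding north_def P1_north_pole[OF direction_in_P1[OF n]] using \<open>a + c \<noteq> 0\<close> by (simp add:
          abc)
  qed
  have "v \<in> span {axis 1 1} \<longleftrightarrow> v $ 2 = 0 \<and> v $ 3 = 0"
    by (auto simp: span_singleton vec_eq_iff forall_3 axis_def)
  also have "\<dots> \<longleftrightarrow> (v $ 1)\<^sup>2 = (p $ 1)\<^sup>2"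
    unfolding v[symmetric] by (simp add: sum_power2_eq_zero_iff)
  also have "\<dots> \<longleftrightarrow> v $ 1 = p $ 1 \<or> v $ 1 = - (p $ 1)"
    by (rule power2_eq_iff)
  also have "\<dots> \<longleftrightarrow> forward_end (p, v) = north \<or> backward_end (p, v) = north"
    unfolding forward_end_def backward_end_def N[OF null_vectors_of_unit_vector(1)[OF assms]] N[OF
        null_vectors_of_unit_vector(2)[OF assms]]
    using t by (auto simp: forward_null_def backward_null_def hyperboloid_point_def
        hyperboloid_velocity_def field_simps power2_eq_square)
  finally show ?thesis .
qed

lemma nonvertical_geodesics_eq:
  "nonvertical_geodesics = {l \<in> oriented_geodesics. geodesic_ends l \<in> (P1 - {- north}) \<times> (P1 -
      {north})}"
proof -
  have "(\<forall>(p, v)\<in>geodesic_through u. v \<in> span {axis 1 1}) \<longleftrightarrow> forward_end u = north \<or> backward_end u =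
      north"
    if u: "u \<in> unit_tangent_bundle" for u
  proof -
    have "(\<forall>(p, v)\<in>geodesic_through u. v \<in> span {axis 1 1}) \<longleftrightarrow>
        (\<forall>w\<in>geodesic_through u. forward_end w = north \<or> backward_end w = north)"
      by (rule ball_cong) (auto simp: geodesic_through_def geodesic_flow_rel_iff
          vertical_vector_iff)
    also have "\<dots> \<longleftrightarrow> forward_end u = north \<or> backward_end u = north"
      using u by (auto simp: geodesic_through_def geodesic_flow_rel_iff)
    finally show ?thesis .
  qed
  note v = this
  have "l \<in> nonvertical_geodesics \<longleftrightarrow>
      l \<in> oriented_geodesics \<and> geodesic_ends l \<in> (P1 - {- north}) \<times> (P1 - {north})" for l
  proof (cases "l \<in> oriented_geodesics")
    case True
    then obtain u where u: "u \<in> unit_tangent_bundle" "l = geodesic_through u"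
      by (auto simp: oriented_geodesics_eq)
    show ?thesis
      unfolding nonvertical_geodesics_def mem_Collect_eq u(2) v[OF u(1)] geodesic_ends_through[OF
          u(1)]
      using ends_in_P1[OF u(1)] by (simp add: P1_uminus)
  qed (simp add: nonvertical_geodesics_def)
  then show ?thesis by (intro set_eqI) (simp only: mem_Collect_eq)
qed

text \<open>The transition from \<open>(\<xi>, \<eta>)\<close> to the stereographic coordinates of the ends: for the boundary
  points \<open>z = \<eta> + 1 / cnj \<xi>\<close> and \<open>w = \<eta> - 1 / cnj \<xi>\<close> the value is \<open>(- cnj z, w)\<close>, because the
  southern coordinate of the antipode of \<open>z\<close> is \<open>- cnj z\<close>.\<close>

definition ends_of_coords :: "complex \<times> complex \<Rightarrow> complex \<times> complex" where
  "ends_of_coords = (\<lambda>(\<xi>, \<eta>). (- cnj \<eta> - 1 / \<xi>, \<eta> - 1 / cnj \<xi>))"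

definition coords_of_ends :: "complex \<times> complex \<Rightarrow> complex \<times> complex" where
  "coords_of_ends = (\<lambda>(a, b). (- 2 / (a + cnj b), (b - cnj a) / 2))"

text \<open>The chart of the product of spheres with the forward end away from \<open>\<infinity>\<close>, whence its antipode
  is not the south pole, and with the backward end away from \<open>\<infinity>\<close>.\<close>

definition nonvertical_ends :: "((real^3) \<times> (real^3)) chart" where
  "nonvertical_ends =
     (((P1 - {- north}) \<times> (P1 - {north})) \<inter> P1xP1_minus, map_prod mu_south mu_north)"

lemma nonvertical_ends: "nonvertical_ends \<in> P1xP1_minus_atlas"
  unfolding P1xP1_minus_atlas_def nonvertical_ends_def P1_atlas_def by blast

lemma fst_end_chart_nonvertical: "fst (end_chart nonvertical_ends) = nonvertical_geodesics"
  using geodesic_ends_bij unfolding end_chart_def nonvertical_ends_def nonvertical_geodesics_eq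
  by (auto dest: bij_betwE)

lemma coords_of_ends_of_coords: "x \<in> coord_domain \<Longrightarrow> coords_of_ends (ends_of_coords x) = x"
  by (cases x) (simp add: coords_of_ends_def ends_of_coords_def coord_domain_def)

lemma coord_geodesic_nonvertical:
  assumes "x \<in> coord_domain"
  shows "coord_geodesic x \<in> nonvertical_geodesics"
    "snd (end_chart nonvertical_ends) (coord_geodesic x) = ends_of_coords x"
proof -
  obtain \<xi> \<eta> where x: "x = (\<xi>, \<eta>)" by fastforce
  then have \<xi>: "\<xi> \<noteq> 0" using assms by (auto simp: coord_domain_def)
  note e = coord_geodesic_ends[OF \<xi>, of \<eta>]
  have N: "stereo_inv z \<noteq> north" for z
    using stereo_inv_not_north[of z] P1_north_pole[OF stereo_inv_in_P1[of z]] by (auto simp: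
        north_def)
  show "coord_geodesic x \<in> nonvertical_geodesics"
    unfolding x nonvertical_geodesics_eq using e N by (simp add: P1_uminus stereo_inv_in_P1)
  have S: "mu_south (- y) = - cnj (mu_north y)" for y
    by (simp add: mu_south_def mu_north_def complex_eq_iff Re_divide_of_real Im_divide_of_real
        del: of_real_diff)
  show "snd (end_chart nonvertical_ends) (coord_geodesic x) = ends_of_coords x"
    unfolding x end_chart_def nonvertical_ends_def using e(2)
    by (simp add: S mu_north_stereo_inv ends_of_coords_def)
qed

lemma coord_geodesic_surj:
  assumes "l \<in> nonvertical_geodesics"
  obtains x where "x \<in> coord_domain" "l = coord_geodesic x"
proof -
  obtain u where u: "u \<in> unit_tangent_bundle" "l = geodesic_through u"
    using assms by (auto simp: nonvertical_geodesics_def oriented_geodesics_eq)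
  have nn: "forward_end u \<noteq> north" "backward_end u \<noteq> north"
    using assms u by (auto simp: nonvertical_geodesics_eq geodesic_ends_through)
  define z w where "z = mu_north (forward_end u)" and "w = mu_north (backward_end u)"
  have zw: "stereo_inv z = forward_end u" "stereo_inv w = backward_end u"
    using stereo_inv_mu_north P1_north_pole ends_in_P1[OF u(1)] nn by (auto simp: z_def w_def
        north_def)
  then have "z \<noteq> w" using ends_distinct[OF u(1)] by auto
  define \<xi> \<eta> where "\<xi> = 2 / cnj (z - w)" and "\<eta> = (z + w) / 2"
  have \<xi>: "\<xi> \<noteq> 0" using \<open>z \<noteq> w\<close> by (simp add: \<xi>_def)
  have "1 / cnj \<xi> = (z - w) / 2" by (simp add: \<xi>_def)
  then have "\<eta> + 1 / cnj \<xi> = z" "\<eta> - 1 / cnj \<xi> = w" by (simp_all add: \<eta>_def field_simps)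
  then have "geodesic_ends (coord_geodesic (\<xi>, \<eta>)) = geodesic_ends l"
    using coord_geodesic_ends(2)[OF \<xi>, of \<eta>] zw u by (simp add: geodesic_ends_through)
  then have "l = coord_geodesic (\<xi>, \<eta>)"
    using inj_onD[OF bij_betw_imp_inj_on[OF geodesic_ends_bij]] coord_geodesic_ends(1)[OF \<xi>, of \<eta>]
      assms by (metis (no_types, lifting) nonvertical_geodesics_def mem_Collect_eq)
  then show thesis using that[of "(\<xi>, \<eta>)"] \<xi> by (simp add: coord_domain_def)
qed

lemma coord_chart_apply:
  assumes "x \<in> coord_domain"
  shows "snd coord_chart (coord_geodesic x) = x"
proof -
  have "inj_on coord_geodesic coord_domain"
    by (rule inj_onI) (metis coord_geodesic_nonvertical(2) coords_of_ends_of_coords)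
  then show ?thesis using assms by (simp add: coord_chart_def)
qed

lemma coord_chart_image: "snd coord_chart ` nonvertical_geodesics = coord_domain"
proof (intro equalityI subsetI)
  show "x \<in> coord_domain" if "x \<in> snd coord_chart ` nonvertical_geodesics" for x
    using that by (auto elim!: coord_geodesic_surj simp: coord_chart_apply)
  show "x \<in> snd coord_chart ` nonvertical_geodesics" if "x \<in> coord_domain" for x
    using coord_chart_apply[OF that] coord_geodesic_nonvertical(1)[OF that] by (metis image_eqI)
qed

lemma open_coord_domain: "open coord_domain"
  unfolding coord_domain_def by (intro open_Times) auto

lemma C_infinity_on_ends_of_coords: "C_infinity_on coord_domain ends_of_coords"
  unfolding ends_of_coords_def case_prod_unfold
  by (intro smooth_intros open_coord_domain) (auto simp: coord_domain_def)

lemma coord_chart_in_atlas: "coord_chart \<in> geodesic_atlas"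
proof -
  let ?e = "end_chart nonvertical_ends"
  have e: "?e \<in> geodesic_atlas" by (rule end_chart_in_atlas[OF nonvertical_ends])
  have img: "snd ?e ` fst ?e = ends_of_coords ` coord_domain"
  proof -
    have nv: "nonvertical_geodesics = coord_geodesic ` coord_domain"
      by (auto elim!: coord_geodesic_surj simp: coord_geodesic_nonvertical(1))
    show ?thesis
      unfolding fst_end_chart_nonvertical nv image_image
      by (rule image_cong[OF refl coord_geodesic_nonvertical(2)])
  qed
  have "fst y + cnj (snd y) \<noteq> 0" if "y \<in> ends_of_coords ` coord_domain" for y
    using that by (auto simp: ends_of_coords_def coord_domain_def)
  then have "C_infinity_on (snd ?e ` fst ?e) coords_of_ends"
    using geodesic_atlasD(3)[OF e] unfolding img coords_of_ends_def case_prod_unfold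
    by (intro smooth_intros) auto
  moreover have "C_infinity_on (snd coord_chart ` fst ?e) ends_of_coords"
    unfolding fst_end_chart_nonvertical coord_chart_image by (rule C_infinity_on_ends_of_coords)
  moreover have "coords_of_ends (snd ?e p) = snd coord_chart p \<and>
      ends_of_coords (snd coord_chart p) = snd ?e p"
    if "p \<in> fst ?e" for p
    using that unfolding fst_end_chart_nonvertical
    by (auto elim!: coord_geodesic_surj simp: coord_chart_apply coord_geodesic_nonvertical
        coords_of_ends_of_coords)
  ultimately have "(fst ?e, snd coord_chart) \<in> geodesic_atlas"
    using geodesic_atlas_change_coordinates[OF e] by blast
  then show ?thesis by (simp add: fst_end_chart_nonvertical coord_chart_def)
qed

section \<open>Rotation of Jacobi fields and the theorem\<close>

lemma inverse_fst_derivative: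
  fixes \<xi> :: complex
  assumes "\<xi> \<noteq> 0"
  shows "((\<lambda>y. inverse (fst y)) has_derivative (\<lambda>v. - fst v / \<xi>\<^sup>2)) (at (\<xi>, \<eta>))"
    "((\<lambda>y. inverse (cnj (fst y))) has_derivative (\<lambda>v. - cnj (fst v) / (cnj \<xi>)\<^sup>2)) (at (\<xi>, \<eta>))"
proof -
  have f: "(fst has_derivative fst) (at (\<xi>, \<eta>))"
    by (rule has_derivative_fst[OF has_derivative_ident])
  show "((\<lambda>y. inverse (fst y)) has_derivative (\<lambda>v. - fst v / \<xi>\<^sup>2)) (at (\<xi>, \<eta>))"
    by (rule has_derivative_eq_rhs[OF Deriv.has_derivative_inverse[OF _ f]])
      (use assms in \<open>simp_all add: fun_eq_iff power2_eq_square divide_inverse\<close>)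
  show "((\<lambda>y. inverse (cnj (fst y))) has_derivative (\<lambda>v. - cnj (fst v) / (cnj \<xi>)\<^sup>2)) (at (\<xi>, \<eta>))"
    by (rule has_derivative_eq_rhs[OF Deriv.has_derivative_inverse[OF _
            bounded_linear.has_derivative[OF bounded_linear_cnj f]]])
      (use assms in \<open>simp_all add: fun_eq_iff power2_eq_square divide_inverse\<close>)
qed

lemma ends_of_coords_derivative:
  assumes "\<xi> \<noteq> 0"
  shows "(ends_of_coords has_derivative
     (\<lambda>v. (- cnj (snd v) + fst v / \<xi>\<^sup>2, snd v + cnj (fst v) / (cnj \<xi>)\<^sup>2))) (at (\<xi>, \<eta>))"
proof -
  have e: "ends_of_coords = (\<lambda>y. (- cnj (snd y) - inverse (fst y), snd y - inverse (cnj (fst y))))"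
    by (auto simp: ends_of_coords_def divide_inverse)
  have s: "(snd has_derivative snd) (at (\<xi>, \<eta>))"
    by (rule has_derivative_snd[OF has_derivative_ident])
  have "(ends_of_coords has_derivative
     (\<lambda>v. (- cnj (snd v) - - fst v / \<xi>\<^sup>2, snd v - - cnj (fst v) / (cnj \<xi>)\<^sup>2))) (at (\<xi>, \<eta>))"
    unfolding e
    by (intro has_derivative_Pair has_derivative_diff inverse_fst_derivative[OF assms] s
        has_derivative_minus bounded_linear.has_derivative[OF bounded_linear_cnj s])
  then show ?thesis by simp
qed

text \<open>In terms of \<open>\<rho> = 1 / cnj \<xi>\<close> this reads \<open>(d\<rho>, d\<eta>) \<mapsto> (- \<i> d\<eta>, - \<i> d\<rho>)\<close>: the forward end \<open>\<eta> +
  \<rho>\<close> is multiplied by \<open>- \<i>\<close> and the backward end \<open>\<eta> - \<rho>\<close> by \<open>\<i>\<close>.\<close>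

definition JU_formula :: "complex \<times> complex \<Rightarrow> complex \<times> complex \<Rightarrow> complex \<times> complex" where
  "JU_formula = (\<lambda>(\<xi>, \<eta>) (X, Y). (- \<i> * \<xi>\<^sup>2 * cnj Y, \<i> * cnj X / (cnj \<xi>)\<^sup>2))"

text \<open>The velocity of \<^const>\<open>Phi\<close> normalised to Euclidean length one; \<open>u\<close> is the horizontal direction
  of the geodesic.\<close>

definition coord_velocity :: "complex \<Rightarrow> real \<Rightarrow> real^3" where
  "coord_velocity u r = vector [- tanh r, Re u / cosh r, Im u / cosh r]"

lemma tanh_cosh_real: "(tanh r)\<^sup>2 + (1 / cosh r)\<^sup>2 = 1" for r :: real
  by (simp add: tanh_def power_divide flip: add_divide_distrib cosh_square_eq)

lemma inverse_cnj:
  assumes "\<xi> \<noteq> 0"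
  shows "inverse (cnj \<xi>) = (1 / cmod \<xi>) *\<^sub>R sgn \<xi>" "sgn (inverse (cnj \<xi>)) = sgn \<xi>"
proof -
  have "(1 / cmod \<xi>) *\<^sub>R sgn \<xi> = \<xi> / of_real ((cmod \<xi>)\<^sup>2)"
    by (simp add: sgn_div_norm scaleR_conv_of_real power2_eq_square divide_inverse)
  also have "\<dots> = inverse (cnj \<xi>)"
    unfolding complex_norm_square using assms by (simp add: field_simps)
  finally show i: "inverse (cnj \<xi>) = (1 / cmod \<xi>) *\<^sub>R sgn \<xi>" ..
  show "sgn (inverse (cnj \<xi>)) = sgn \<xi>"
    unfolding i sgn_scaleR using assms by (simp add: sgn_sgn)
qed

lemma velocity_Phi:
  assumes "\<xi> \<noteq> 0"
  shows "velocity (Phi (\<xi>, \<eta>)) r = (Phi (\<xi>, \<eta>) r $ 1) *\<^sub>R coord_velocity (sgn \<xi>) r"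
proof -
  have P: "Phi (\<xi>, \<eta>) r $ i = (if i = 1 then 1 / (cmod \<xi> * cosh r)
      else if i = 2 then Re \<eta> + tanh r * Re (1 / cnj \<xi>)
      else Im \<eta> + tanh r * Im (1 / cnj \<xi>))" for r i
  proof -
    have "complex_of_real (tanh r) / cnj \<xi> = complex_of_real (tanh r) * (1 / cnj \<xi>)" by simp
    then show ?thesis
      using exhaust_3[of i] by (auto simp: Phi_def Let_def simp del: times_divide_eq_right)
  qed
  have i: "1 / cnj \<xi> = (1 / cmod \<xi>) *\<^sub>R sgn \<xi>"
    using inverse_cnj(1)[OF assms] by (simp add: inverse_eq_divide)
  have t: "((\<lambda>r. c + tanh r * k) has_real_derivative (1 / cosh r)\<^sup>2 * k) (at r)" for c k :: real
  proof -
    have "(1 / cosh r)\<^sup>2 = 1 - (tanh r)\<^sup>2" using tanh_cosh_real[of r] by simp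
    then show ?thesis by (auto intro!: derivative_eq_intros)
  qed
  have s: "((\<lambda>r. 1 / (cmod \<xi> * cosh r)) has_real_derivative 1 / (cmod \<xi> * cosh r) * - tanh r) (at
      r)"
    using assms by (auto intro!: derivative_eq_intros simp: tanh_def power2_eq_square divide_simps)
  have "(Phi (\<xi>, \<eta>) has_vector_derivative (Phi (\<xi>, \<eta>) r $ 1) *\<^sub>R coord_velocity (sgn \<xi>) r) (at r)"
    unfolding has_vector_derivative_real3_iff forall_3 P
    using s t[of "Re \<eta>" "Re (1 / cnj \<xi>)"] t[of "Im \<eta>" "Im (1 / cnj \<xi>)"]
    by (simp add: coord_velocity_def i power2_eq_square mult_ac)
  then show ?thesis unfolding velocity_def by (rule vector_derivative_at)
qed

text \<open>The derivative of \<^const>\<open>Phi\<close> at a fixed time in the coordinates \<open>(1 / cnj \<xi>, \<eta>)\<close>, in which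
  \<^const>\<open>Phi\<close> is real linear apart from the norm in the height.\<close>

definition Phi_derivative :: "complex \<Rightarrow> complex \<Rightarrow> complex \<Rightarrow> real \<Rightarrow> real^3" where
  "Phi_derivative u \<delta> Y r = vector [(u \<bullet> \<delta>) / cosh r, Re Y + tanh r * Re \<delta>, Im Y + tanh r * Im \<delta>]"

lemma frechet_derivative_Phi:
  assumes "\<xi> \<noteq> 0"
  shows "frechet_derivative (\<lambda>y. Phi y r) (at (\<xi>, \<eta>)) (X, Y) =
    Phi_derivative (sgn \<xi>) (- cnj X / (cnj \<xi>)\<^sup>2) Y r"
proof -
  define F :: "complex \<times> complex \<Rightarrow> real^3" where
    "F z = vector [norm (fst z) / cosh r, Re (snd z) + tanh r * Re (fst z),
        Im (snd z) + tanh r * Im (fst z)]" for z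
  \<comment> \<open>Chain rule through the coordinates \<open>(1 / cnj \<xi>, \<eta>)\<close>.\<close>
  define h :: "complex \<times> complex \<Rightarrow> complex \<times> complex" where "h y = (inverse (cnj (fst y)), snd y)"
      for y
  have PF: "Phi y r = F (h y)" for y
    by (cases y) (simp add: Phi_def F_def h_def Let_def vec_eq_iff forall_3 norm_inverse
        divide_inverse mult.commute)
  have h: "(h has_derivative (\<lambda>v. (- cnj (fst v) / (cnj \<xi>)\<^sup>2, snd v))) (at (\<xi>, \<eta>))"
    unfolding h_def[abs_def]
    by (intro has_derivative_Pair inverse_fst_derivative[OF assms] has_derivative_snd
        has_derivative_ident)
  have v3: "(vector [a, b, c] :: real^3) = a *\<^sub>R axis 1 1 + b *\<^sub>R axis 2 1 + c *\<^sub>R axis 3 1"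
      for a b c
    by (simp add: vec_eq_iff forall_3 axis_def)
  define \<rho> where "\<rho> = inverse (cnj \<xi>)"
  have \<rho>: "\<rho> \<noteq> 0" "sgn \<rho> = sgn \<xi>" using assms inverse_cnj(2)[OF assms] by (simp_all add: \<rho>_def)
  have f: "(fst has_derivative fst) (at (\<rho>, \<eta>))" and s: "(snd has_derivative snd) (at (\<rho>, \<eta>))"
    by (rule has_derivative_fst[OF has_derivative_ident], rule has_derivative_snd[OF
        has_derivative_ident])
  have n: "(norm has_derivative (\<lambda>v. sgn \<xi> \<bullet> v)) (at (fst (\<rho>, \<eta>)))"
    unfolding fst_conv
    by (rule has_derivative_eq_rhs[OF has_derivative_norm[OF \<rho>(1)]])
      (simp add: fun_eq_iff \<rho>(2) inner_commute)
  have 1: "((\<lambda>z. norm (fst z) / cosh r) has_derivative (\<lambda>v. (sgn \<xi> \<bullet> fst v) / cosh r)) (at (\<rho>, \<eta>))"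
    by (rule bounded_linear.has_derivative[OF bounded_linear_divide has_derivative_compose[OF f n]])
  have 2: "((\<lambda>z. L (snd z) + tanh r * L (fst z)) has_derivative (\<lambda>v. L (snd v) + tanh r * L (fst
      v))) (at (\<rho>, \<eta>))"
    if "bounded_linear L" for L :: "complex \<Rightarrow> real"
    by (intro has_derivative_add bounded_linear.has_derivative[OF that s]
        bounded_linear.has_derivative[OF bounded_linear_mult_right bounded_linear.has_derivative[OF
            that f]])
  have "(F has_derivative (\<lambda>v. Phi_derivative (sgn \<xi>) (fst v) (snd v) r)) (at (\<rho>, \<eta>))"
    unfolding F_def[abs_def] Phi_derivative_def v3
    by (intro has_derivative_add bounded_linear.has_derivative[OF bounded_linear_scaleR_left]
        1 2 bounded_linear_Re bounded_linear_Im)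
  then have F: "(F has_derivative (\<lambda>v. Phi_derivative (sgn \<xi>) (fst v) (snd v) r)) (at (h (\<xi>, \<eta>)))"
    by (simp add: h_def \<rho>_def)
  have "((\<lambda>y. Phi y r) has_derivative (\<lambda>v. Phi_derivative (sgn \<xi>) (- cnj (fst v) / (cnj \<xi>)\<^sup>2) (snd
      v) r)) (at (\<xi>, \<eta>))"
    using has_derivative_compose[OF h F] unfolding PF fst_conv snd_conv .
  then show ?thesis by (simp add: frechet_derivative_at[symmetric])
qed

text \<open>Rewrite rules that reduce polynomials modulo the relation \<open>a\<^sup>2 + b\<^sup>2 = 1\<close>.\<close>

lemma unit_square_eliminate:
  fixes a b x :: real
  assumes "a\<^sup>2 + b\<^sup>2 = 1"
  shows "b * b = 1 - a * a" "b * (b * x) = x - a * (a * x)"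
proof -
  show b: "b * b = 1 - a * a" using assms by (simp add: power2_eq_square)
  show "b * (b * x) = x - a * (a * x)"
    using arg_cong[OF b, of "\<lambda>y. y * x"] by (simp add: algebra_simps)
qed

text \<open>The component along the velocity drops out of the cross product, which leaves the derivative
  of \<^const>\<open>Phi\<close> itself.\<close>

lemma jacobi_iso_eq:
  assumes "\<xi> \<noteq> 0"
  defines "u \<equiv> sgn \<xi>"
  shows "jacobi_iso (\<xi>, \<eta>) (X, Y) r =
    (let w = Phi_derivative u (- cnj X / (cnj \<xi>)\<^sup>2) Y r; e = coord_velocity u r
     in w - (w \<bullet> e) *\<^sub>R e)"
    and "rotate_field (\<xi>, \<eta>) (jacobi_iso (\<xi>, \<eta>) (X, Y)) r =
     cross3 (coord_velocity u r) (Phi_derivative u (- cnj X / (cnj \<xi>)\<^sup>2) Y r)"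
proof -
  have cross: "cross3 e (w - k *\<^sub>R e) = cross3 e w" for e w :: "real^3" and k
    by (simp add: cross3_def vec_eq_iff forall_3 algebra_simps)
  define p where "p = Phi (\<xi>, \<eta>) r"
  have p: "p $ 1 \<noteq> 0" using assms by (simp add: p_def Phi_def Let_def)
  show j: "jacobi_iso (\<xi>, \<eta>) (X, Y) r =
    (let w = Phi_derivative u (- cnj X / (cnj \<xi>)\<^sup>2) Y r; e = coord_velocity u r
     in w - (w \<bullet> e) *\<^sub>R e)"
    unfolding jacobi_iso_def proj_perp_def hyp_metric_def velocity_Phi[OF assms(1)]
      frechet_derivative_Phi[OF assms(1)] u_def[symmetric] p_def[symmetric] Let_def
    using p by (simp add: power2_eq_square)
  show "rotate_field (\<xi>, \<eta>) (jacobi_iso (\<xi>, \<eta>) (X, Y)) r =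
     cross3 (coord_velocity u r) (Phi_derivative u (- cnj X / (cnj \<xi>)\<^sup>2) Y r)"
    unfolding rotate_field_def j rot90_def velocity_Phi[OF assms(1)] u_def[symmetric]
        p_def[symmetric] Let_def
    using p cross by simp
qed

text \<open>With \<open>q = 1 / cosh r\<close> and \<open>h = tanh r\<close> all components are polynomials, and the claim is an
  identity modulo \<open>a\<^sup>2 + b\<^sup>2 = 1\<close> and \<open>h\<^sup>2 + q\<^sup>2 = 1\<close>.\<close>

lemma rotate_jacobi_iso:
  assumes "\<xi> \<noteq> 0"
  shows "rotate_field (\<xi>, \<eta>) (jacobi_iso (\<xi>, \<eta>) X) = jacobi_iso (\<xi>, \<eta>) (JU_formula (\<xi>, \<eta>) X)"
proof
  fix r :: real
  obtain X1 X2 where X: "X = (X1, X2)" by fastforce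
  define \<delta> where "\<delta> = - cnj X1 / (cnj \<xi>)\<^sup>2"
  have 1: "JU_formula (\<xi>, \<eta>) X = (- \<i> * \<xi>\<^sup>2 * cnj X2, - \<i> * \<delta>)"
    by (simp add: JU_formula_def X \<delta>_def)
  have 2: "- cnj (- \<i> * \<xi>\<^sup>2 * cnj X2) / (cnj \<xi>)\<^sup>2 = - \<i> * X2"
    using assms by simp
  define a b where "a = Re (sgn \<xi>)" and "b = Im (sgn \<xi>)"
  define q h where "q = 1 / cosh r" and "h = tanh r"
  have q: "x / cosh r = x * q" for x by (simp add: q_def)
  have ab: "a\<^sup>2 + b\<^sup>2 = 1" using assms cmod_power2[of "sgn \<xi>"] by (simp add: a_def b_def norm_sgn)
  have hq: "h\<^sup>2 + q\<^sup>2 = 1" using tanh_cosh_real[of r] by (simp add: q_def h_def)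
  show "rotate_field (\<xi>, \<eta>) (jacobi_iso (\<xi>, \<eta>) X) r = jacobi_iso (\<xi>, \<eta>) (JU_formula (\<xi>, \<eta>) X) r"
    unfolding X jacobi_iso_eq(2)[OF assms] unfolding X[symmetric] 1 jacobi_iso_eq(1)[OF assms] 2
        \<delta>_def[symmetric] Let_def
    unfolding Phi_derivative_def coord_velocity_def q h_def[symmetric] inner_complex_def
      a_def[symmetric] b_def[symmetric]
    by (simp add: cross3_def vec_eq_iff forall_3 inner_vec_def sum_3 algebra_simps
        unit_square_eliminate[OF ab] unit_square_eliminate[OF hq])
qed

text \<open>Measured in the plane normal to the geodesic, along the horizontal vector \<open>\<i> u\<close> and along
  the vector orthogonal to it, a Jacobi field has components of the form \<open>A + tanh r * B\<close>, where
  the four real constants are the components of \<open>\<delta>\<close> and of the second coordinate along \<open>u\<close> and \<open>\<i>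
  u\<close>. Two times, \<open>r = 0\<close> and \<open>r = 1\<close>, suffice to recover them.\<close>

lemma inj_jacobi_iso:
  assumes "\<xi> \<noteq> 0"
  shows "inj (jacobi_iso (\<xi>, \<eta>))"
proof (rule injI)
  fix X Z :: "complex \<times> complex"
  assume eq: "jacobi_iso (\<xi>, \<eta>) X = jacobi_iso (\<xi>, \<eta>) Z"
  define a b where "a = Re (sgn \<xi>)" and "b = Im (sgn \<xi>)"
  have ab: "a\<^sup>2 + b\<^sup>2 = 1" using assms cmod_power2[of "sgn \<xi>"] by (simp add: a_def b_def norm_sgn)
  define \<delta> where "\<delta> X = - cnj (fst X) / (cnj \<xi>)\<^sup>2" for X :: "complex \<times> complex"
  have comp: "(1 / cosh r) * J $ 1 + tanh r * (a * J $ 2 + b * J $ 3) =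
      (a * Re (\<delta> X) + b * Im (\<delta> X)) + tanh r * (a * Re (snd X) + b * Im (snd X))"
    "a * J $ 3 - b * J $ 2 = (a * Im (snd X) - b * Re (snd X)) + tanh r * (a * Im (\<delta> X) - b * Re (\<delta>
        X))"
    if J: "J = jacobi_iso (\<xi>, \<eta>) X r" for J X r
  proof -
    define q h where "q = 1 / cosh r" and "h = tanh r"
    have q: "x / cosh r = x * q" for x by (simp add: q_def)
    have hq: "h\<^sup>2 + q\<^sup>2 = 1" using tanh_cosh_real[of r] by (simp add: q_def h_def)
    have jj: "J = (let w = Phi_derivative (sgn \<xi>) (\<delta> X) (snd X) r;
        e = coord_velocity (sgn \<xi>) r in w - (w \<bullet> e) *\<^sub>R e)"
      using jacobi_iso_eq(1)[OF assms, of \<eta> "fst X" "snd X" r] unfolding J \<delta>_def by simp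
    show "(1 / cosh r) * J $ 1 + tanh r * (a * J $ 2 + b * J $ 3) =
      (a * Re (\<delta> X) + b * Im (\<delta> X)) + tanh r * (a * Re (snd X) + b * Im (snd X))"
      "a * J $ 3 - b * J $ 2 = (a * Im (snd X) - b * Re (snd X)) + tanh r * (a * Im (\<delta> X) - b * Re
          (\<delta> X))"
      unfolding jj Let_def Phi_derivative_def coord_velocity_def q h_def[symmetric]
          inner_complex_def
        a_def[symmetric] b_def[symmetric]
      by (simp_all add: inner_vec_def sum_3 algebra_simps
          unit_square_eliminate[OF ab] unit_square_eliminate[OF hq])
  qed
  define \<Delta> where "\<Delta> = \<delta> X - \<delta> Z"
  define E where "E = snd X - snd Z"
  have 1: "(a * Re \<Delta> + b * Im \<Delta>) + tanh r * (a * Re E + b * Im E) = 0"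
    and 2: "(a * Im E - b * Re E) + tanh r * (a * Im \<Delta> - b * Re \<Delta>) = 0" for r
    using comp[of "jacobi_iso (\<xi>, \<eta>) X r" X r] comp[of "jacobi_iso (\<xi>, \<eta>) X r" Z r] eq
    by (simp_all add: \<Delta>_def E_def algebra_simps)
  have t: "tanh (1::real) \<noteq> 0" by simp
  have e: "a * Re \<Delta> + b * Im \<Delta> = 0" "a * Im E - b * Re E = 0"
    "a * Re E + b * Im E = 0" "a * Im \<Delta> - b * Re \<Delta> = 0"
    using 1[of 0] 2[of 0] 1[of 1] 2[of 1] t by auto
  \<comment> \<open>The pairs vanish because the rotation by \<open>a + \<i> b\<close> can be undone.\<close>
  have "x = a * (a * x + b * y) - b * (a * y - b * x)" "y = b * (a * x + b * y) + a * (a * y - b *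
      x)" for x y
    by (simp_all add: algebra_simps unit_square_eliminate[OF ab])
  from this[where x = "Re \<Delta>" and y = "Im \<Delta>"] this[where x = "Re E" and y = "Im E"]
  have "Re \<Delta> = 0" "Im \<Delta> = 0" "Re E = 0" "Im E = 0"
    unfolding e by simp_all
  then have "\<Delta> = 0" "E = 0" by (simp_all add: complex_eq_iff)
  then have "snd X = snd Z" "\<delta> X = \<delta> Z" by (simp_all add: \<Delta>_def E_def)
  moreover from this(2) have "fst X = fst Z" using assms by (simp add: \<delta>_def)
  ultimately show "X = Z" by (simp add: prod_eq_iff)
qed

lemma JU_eq: "\<xi> \<noteq> 0 \<Longrightarrow> JU (\<xi>, \<eta>) X = JU_formula (\<xi>, \<eta>) X"
  by (simp add: JU_def rotate_jacobi_iso the_inv_f_f inj_jacobi_iso)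

theorem theorem1:
  shows "\<exists>J. almost_complex_structure geodesic_atlas J \<and> extends_JU J \<and>
    integrable_on_manifold oriented_geodesics geodesic_atlas J \<and>
    biholomorphic oriented_geodesics (holomorphic_charts geodesic_atlas J)
      P1xP1_minus P1xP1_minus_atlas"
proof -
  note A = geodesic_atlas_smooth
  let ?E = "end_chart ` P1xP1_minus_atlas"
  have cover: "\<exists>e\<in>?E. l \<in> fst e" if l: "l \<in> oriented_geodesics" for l
  proof -
    obtain x y where xy: "geodesic_ends l = (x, y)" by fastforce
    have m: "(x, y) \<in> P1xP1_minus" using bij_betwE[OF geodesic_ends_bij] l xy by metis
    have "\<exists>V f. (V, f) \<in> P1_atlas \<and> x \<in> V" if "x \<in> P1" for x
    proof (cases "x = north")
      case True
      then have "x \<noteq> - north" by (simp add: north_def vec_eq_iff forall_3 axis_def)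
      then show ?thesis using that by (auto simp: P1_atlas_def)
    qed (use that in \<open>auto simp: P1_atlas_def\<close>)
    then obtain V f V' f' where "(V, f) \<in> P1_atlas" "x \<in> V" "(V', f') \<in> P1_atlas" "y \<in> V'"
      using m by (meson mem_P1xP1_minus)
    then have "((V \<times> V') \<inter> P1xP1_minus, map_prod f f') \<in> P1xP1_minus_atlas"
      "l \<in> fst (end_chart ((V \<times> V') \<inter> P1xP1_minus, map_prod f f'))"
      using m l xy by (auto simp: P1xP1_minus_atlas_def end_chart_def)
    then show ?thesis by blast
  qed
  obtain J where J: "almost_complex_structure geodesic_atlas J"
      "?E \<subseteq> holomorphic_charts geodesic_atlas J"
  proof (rule almost_complex_structure_from_holomorphic_atlas[OF A, of ?E])
    show "?E \<subseteq> geodesic_atlas" using end_chart_in_atlas by blast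
    show "\<exists>e\<in>?E. p \<in> fst e" if "c \<in> geodesic_atlas" "p \<in> fst c" for c p
      using cover geodesic_atlasD(1)[OF that(1)] that(2) by blast
    show "holomorphic2_on (snd e ` (fst e \<inter> fst e')) (transition e e')" if "e \<in> ?E" "e' \<in> ?E"
        for e e'
      using that end_chart_transitions_holomorphic by blast
  qed (rule that)
  have "extends_JU J"
    unfolding extends_JU_def
  proof (intro conjI ballI coord_chart_in_atlas ext)
    fix l v assume l: "l \<in> nonvertical_geodesics"
    obtain x where x: "x \<in> coord_domain" "l = coord_geodesic x" using coord_geodesic_surj[OF l] .
    obtain \<xi> \<eta> where \<xi>: "x = (\<xi>, \<eta>)" "\<xi> \<noteq> 0" using x(1) by (auto simp: coord_domain_def)
    define e where "e = end_chart nonvertical_ends"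
    have e: "e \<in> holomorphic_charts geodesic_atlas J" "e \<in> geodesic_atlas" "fst e =
        nonvertical_geodesics"
      using J(2) nonvertical_ends end_chart_in_atlas fst_end_chart_nonvertical by (auto simp: e_def)
    have le: "l \<in> fst coord_chart" "l \<in> fst e" using l e(3) by (simp_all add: coord_chart_def)
    have Je: "J e l = mult_ii" using e(1) le by (auto simp: holomorphic_charts_def)
    define D where "D = transition_derivative coord_chart e l"
    define D' where "D' = transition_derivative e coord_chart l"
    have D: "D v = (- cnj (snd v) + fst v / \<xi>\<^sup>2, snd v + cnj (fst v) / (cnj \<xi>)\<^sup>2)" for v
    proof -
      have "(ends_of_coords has_derivative
        (\<lambda>v. (- cnj (snd v) + fst v / \<xi>\<^sup>2, snd v + cnj (fst v) / (cnj \<xi>)\<^sup>2))) (at x)"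
        unfolding \<xi>(1) by (rule ends_of_coords_derivative[OF \<xi>(2)])
      then have "(transition coord_chart e has_derivative
        (\<lambda>v. (- cnj (snd v) + fst v / \<xi>\<^sup>2, snd v + cnj (fst v) / (cnj \<xi>)\<^sup>2))) (at x)"
      proof (rule has_derivative_transform_within_open[OF _ open_coord_domain x(1)])
        fix y assume y: "y \<in> coord_domain"
        have "chart_inv coord_chart y = coord_geodesic y"
          using smooth_atlasD(2)[OF A coord_chart_in_atlas, of "coord_geodesic y"]
            coord_geodesic_nonvertical(1)[OF y] coord_chart_apply[OF y] by (simp add:
                coord_chart_def)
        then show "ends_of_coords y = transition coord_chart e y"
          using coord_geodesic_nonvertical(2)[OF y] by (simp add: e_def)
      qed
      then show ?thesis
        unfolding D_def x(2) coord_chart_apply[OF x(1)] by (simp add: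
            frechet_derivative_at[symmetric])
    qed
    \<comment> \<open>The transformation law from the coordinates to the holomorphic chart of the ends determines
        \<open>J\<close>.\<close>
    have "D (J coord_chart l v) = mult_ii (D v)"
      using J(1)[unfolded almost_complex_structure_def, THEN conjunct2, THEN conjunct2, rule_format,
          OF coord_chart_in_atlas e(2) IntI[OF le]] by (simp only: D_def Je)
    also have "\<dots> = D (JU x v)"
      unfolding \<xi>(1) JU_eq[OF \<xi>(2)] D using \<xi>(2)
      by (cases v) (simp add: JU_formula_def mult_ii_def field_simps)
    finally have "D' (D (J coord_chart l v)) = D' (D (JU x v))" by simp
    then have "J coord_chart l v = JU x v"
      unfolding D_def D'_def transition_derivative_compose[OF A coord_chart_in_atlas e(2)
          coord_chart_in_atlas le le(1)]
        transition_derivative_self[OF A coord_chart_in_atlas le(1)] .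
    then show "J coord_chart l v = JU (snd coord_chart l) v"
      unfolding x(2) coord_chart_apply[OF x(1)] .
  qed
  moreover have "integrable_on_manifold oriented_geodesics geodesic_atlas J"
    unfolding integrable_on_manifold_def using cover J(2) by blast
  moreover have "biholomorphic oriented_geodesics (holomorphic_charts geodesic_atlas J) P1xP1_minus
      P1xP1_minus_atlas"
  proof (rule biholomorphic_from_pulled_back_charts[OF A J(1) _ geodesic_ends_bij])
    show "fst c \<subseteq> oriented_geodesics" if "c \<in> geodesic_atlas" for c
      by (rule geodesic_atlasD(1)[OF that])
    show "fst d \<subseteq> P1xP1_minus" if "d \<in> P1xP1_minus_atlas" for d
      using that unfolding P1xP1_minus_atlas_def by auto
    show "({p \<in> oriented_geodesics. geodesic_ends p \<in> fst d}, snd d \<circ> geodesic_ends)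
        \<in> holomorphic_charts geodesic_atlas J" if "d \<in> P1xP1_minus_atlas" for d
      using J(2) that by (auto simp: end_chart_def)
  qed
  ultimately show ?thesis using J(1) by blast
qed

end
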